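(* Assume that $\phi_\Theta$ is continuous on $[0,+\infty)$ and let $f\in\mathcal A^\Theta([0,T])$. Then, for every $(x,v)\in\mathbb R^{2d}$, the Cauchy problem $$\dot X=V,\qquad\dot V=E_f(t,X)\quad\text{for }t\in(0,T),\qquad X(0)=x,\ V(0)=v$$ admits a globally-defined classical solution. Moreover, if $\Phi_\Theta(r)=\int_0^r\phi_\Theta(s)\,ds$ satisfies $$\int_{0^+}\frac{dr}{\sqrt{\Phi_\Theta(r)}}=+\infty,$$ then the solution of this problem is unique and the induced flow is a measure-preserving homeomorphism of $\mathbb R^{2d}$ at each time $t\in[0,T]$.
   Context: Fix $T\in(0,+\infty)$, a dimension $d$, and $\kappa\in\{-1,+1\}$. For $f\in L^\infty([0,T];L^1(\mathbb R^{2d}))$ set $\rho_f(t,x)=\int_{\mathbb R^d}f(t,x,v)\,dv$ and $E_f(t,x)=\kappa\int_{\mathbb R^d}K(x-y)\rho_f(t,y)\,dy$, with $K(x)=x/|x|^d$ for $x\ne0$. Growth function: $\Theta\colon[0,+\infty)\to(0,+\infty)$ is a fixed non-decreasing function. $\phi_\Theta\colon[0,+\infty)\to[0,+\infty)$ is defined by $\phi_\Theta(0)=0$, $\phi_\Theta(r)=r|\log r|\,\Theta(|\log r|)$ for $r\in(0,e^{-d-1})$, and $\phi_\Theta(r)=e^{-d-1}(d+1)\Theta(d+1)$ for $r\ge e^{-d-1}$. Spaces: $Y^\Theta_{\mathrm{ul}}(\mathbb R^d)$ is the set of functions $g$ with $\sup_{p\in[1,\infty)}\|g\|_{L^p_{\mathrm{ul}}}/\Theta(p)<+\infty$,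 where $\|g\|_{L^p_{\mathrm{ul}}}=\sup_{x\in\mathbb R^d}\|g\|_{L^p(B_1(x))}$. $\mathcal A^\Theta([0,T])=\{f\in L^\infty([0,T];L^1(\mathbb R^{2d})):\rho_f\in L^\infty([0,T];Y^\Theta_{\mathrm{ul}}(\mathbb R^d))\}$. Since $E_f$ is only bounded measurable in time, a (classical) solution is a Lipschitz curve $(X,V)\in W^{1,\infty}([0,T];\mathbb R^{2d})$ satisfying the equations for a.e. $t$ (equivalently, in integral form) and the initial condition. Measure-preserving refers to Lebesgue measure on $\mathbb R^{2d}$. *)

theory Defs
  imports "HOL-Analysis.Analysis"
begin

(* The space R^d is an arbitrary type 'a :: euclidean_space, with d = DIM('a); phase space is
   'a \<times> 'a.  All measurability and integration is with respect to Lebesgue measure, i.e. the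
   completed measure "lebesgue". *)

definition growth_fun :: "(real \<Rightarrow> real) \<Rightarrow> bool" where
  "growth_fun \<Theta> \<longleftrightarrow> (\<forall>p\<ge>0. \<Theta> p > 0) \<and> mono_on {0..} \<Theta>"

(* Only the values at r \<ge> 0 are meaningful. *)
definition phi :: "nat \<Rightarrow> (real \<Rightarrow> real) \<Rightarrow> real \<Rightarrow> real" where
  "phi d \<Theta> r =
     (if r = 0 then 0
      else if r < exp (- real d - 1) then r * \<bar>ln r\<bar> * \<Theta> \<bar>ln r\<bar>
      else exp (- real d - 1) * (real d + 1) * \<Theta> (real d + 1))"

definition Phi :: "nat \<Rightarrow> (real \<Rightarrow> real) \<Rightarrow> real \<Rightarrow> real" where
  "Phi d \<Theta> r = (LINT s:{0..r}|lborel. phi d \<Theta> s)"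

(* Divergence of the integral of h \<ge> 0 at the left endpoint 0. *)
definition diverges_at_0 :: "(real \<Rightarrow> real) \<Rightarrow> bool" where
  "diverges_at_0 h \<longleftrightarrow> (\<forall>\<epsilon>>0. (\<integral>\<^sup>+ r\<in>{0<..<\<epsilon>}. ennreal (h r) \<partial>lborel) = \<infinity>)"

definition Lp_norm_on :: "real \<Rightarrow> 'a::euclidean_space set \<Rightarrow> ('a \<Rightarrow> real) \<Rightarrow> ennreal" where
  "Lp_norm_on p A g =
     (let I = (\<integral>\<^sup>+ y\<in>A. ennreal (\<bar>g y\<bar> powr p) \<partial>lebesgue)
      in if I = \<infinity> then \<infinity> else ennreal (enn2real I powr (1 / p)))"

definition Lp_ul_norm :: "real \<Rightarrow> ('a::euclidean_space \<Rightarrow> real) \<Rightarrow> ennreal" where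
  "Lp_ul_norm p g = (SUP x. Lp_norm_on p (ball x 1) g)"

definition Y_ul_norm :: "(real \<Rightarrow> real) \<Rightarrow> ('a::euclidean_space \<Rightarrow> real) \<Rightarrow> ennreal" where
  "Y_ul_norm \<Theta> g = (SUP p\<in>{1..}. Lp_ul_norm p g / ennreal (\<Theta> p))"

definition Y_ul :: "(real \<Rightarrow> real) \<Rightarrow> ('a::euclidean_space \<Rightarrow> real) set" where
  "Y_ul \<Theta> = {g \<in> borel_measurable lebesgue. Y_ul_norm \<Theta> g < \<infinity>}"

(* Elements of L^\<infinity>([0,T]; L^1(R^{2d})) are given by jointly measurable representatives; the values
   f t for t outside [0,T], or for t in a null set, are irrelevant. *)
definition Linf_L1 :: "real \<Rightarrow> (real \<Rightarrow> 'a::euclidean_space \<times> 'a \<Rightarrow> real) set" where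
  "Linf_L1 T =
     {f. case_prod f \<in> borel_measurable (lebesgue_on ({0..T} \<times> UNIV)) \<and>
         (\<exists>C. AE t in lebesgue_on {0..T}.
            integrable lebesgue (f t) \<and> (\<integral>z. \<bar>f t z\<bar> \<partial>lebesgue) \<le> C)}"

definition rho :: "(real \<Rightarrow> 'a::euclidean_space \<times> 'a \<Rightarrow> real) \<Rightarrow> real \<Rightarrow> 'a \<Rightarrow> real" where
  "rho f t x = (\<integral>v. f t (x, v) \<partial>lebesgue)"

(* Measurability of rho f in time is inherited from the joint measurability of f; membership in
   L^\<infinity>([0,T]; Y_ul) adds an essential bound on the norm. *)
definition A_space :: "(real \<Rightarrow> real) \<Rightarrow> real \<Rightarrow> (real \<Rightarrow> 'a::euclidean_space \<times> 'a \<Rightarrow> real) set" where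
  "A_space \<Theta> T =
     {f \<in> Linf_L1 T. \<exists>C::real. AE t in lebesgue_on {0..T}.
        rho f t \<in> Y_ul \<Theta> \<and> Y_ul_norm \<Theta> (rho f t) \<le> ennreal C}"

definition K :: "'a::euclidean_space \<Rightarrow> 'a" where
  "K x = x /\<^sub>R norm x ^ DIM('a)"

definition E_field ::
    "real \<Rightarrow> (real \<Rightarrow> 'a::euclidean_space \<times> 'a \<Rightarrow> real) \<Rightarrow> real \<Rightarrow> 'a \<Rightarrow> 'a" where
  "E_field \<kappa> f t x = \<kappa> *\<^sub>R (\<integral>y. rho f t y *\<^sub>R K (x - y) \<partial>lebesgue)"

(* A curve in W^{1,\<infinity>}([0,T]) is encoded as a Lipschitz function on [0,T]. *)
definition solution ::
    "real \<Rightarrow> (real \<Rightarrow> 'a::euclidean_space \<Rightarrow> 'a) \<Rightarrow> 'a \<Rightarrow> 'a \<Rightarrow> (real \<Rightarrow> 'a) \<Rightarrow> (real \<Rightarrow> 'a) \<Rightarrow> bool" where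
  "solution T E x v X V \<longleftrightarrow>
     (\<exists>L. L-lipschitz_on {0..T} (\<lambda>t. (X t, V t))) \<and>
     (AE t in lebesgue_on {0<..<T}.
        (X has_vector_derivative V t) (at t) \<and>
        (V has_vector_derivative E t (X t)) (at t)) \<and>
     X 0 = x \<and> V 0 = v"

(* Well defined for t in [0,T] as soon as solutions exist and are unique on [0,T]. Hilbert choice is
   used because curves are total functions, whose values outside [0,T] are arbitrary. *)
definition flow ::
    "real \<Rightarrow> (real \<Rightarrow> 'a::euclidean_space \<Rightarrow> 'a) \<Rightarrow> real \<Rightarrow> 'a \<times> 'a \<Rightarrow> 'a \<times> 'a" where
  "flow T E t = (\<lambda>(x, v). (SOME Z. solution T E x v (fst \<circ> Z) (snd \<circ> Z)) t)"

definition lebesgue_preserving :: "('b::euclidean_space \<Rightarrow> 'b) \<Rightarrow> bool" where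
  "lebesgue_preserving h \<longleftrightarrow>
     h \<in> measurable lebesgue lebesgue \<and>
     (\<forall>A\<in>sets lebesgue. emeasure lebesgue (h -` A) = emeasure lebesgue A)"

end

theory Submission
  imports Defs "HOL-Complex_Analysis.Great_Picard"
begin

text \<open>
  Taking \<open>p = \<bar>log r\<bar>\<close> in the bound on \<open>\<rho>\<close> and decomposing \<open>K\<close> dyadically gives
  \<open>\<bar>E t x - E t y\<bar> \<le> C \<phi> r\<close> whenever \<open>\<bar>x - y\<bar> \<le> r\<close>. The inequality \<open>\<bar>x - y\<bar> \<le> r\<close>, rather than
  equality, is what compensates for the possible lack of monotonicity of \<open>\<phi>\<close>: if
  \<open>w\<close> is the double time integral of \<open>\<bar>E(t, X) - E(t, X')\<bar>\<close>, then
  \<open>\<bar>X - X'\<bar> \<le> w\<close> and hence \<open>w'' \<le> C \<phi>(w)\<close>, so that \<open>w'\<^sup>2 \<le> 2 C \<Phi>(w)\<close> and the Osgood condition forces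
  \<open>w = 0\<close>. Existence follows from Arzela-Ascoli applied to the symplectic Euler scheme, whose steps
  are shears. By uniqueness the scheme converges pointwise to the flow, so the flow does not increase the
  measure of open sets; applied also to the time-reversed equation, this shows that it preserves measure.
\<close>

section \<open>Calculus of real curves\<close>

text \<open>With \<open>p = \<bar>ln r\<bar>\<close> the factor \<open>r powr (- d / p)\<close> left
  over by the local \<open>L^p\<close> estimates is the constant \<open>exp d\<close>. The threshold
  \<open>exp (- d - 1)\<close> in \<open>phi\<close> then says \<open>p > d + 1\<close>, which keeps
  \<open>p\<close> uniformly above the critical exponent \<open>d\<close>: the singular part of the
  kernel sums like a geometric series with a ratio independent of \<open>p\<close>, and only the
  intermediate annulus contributes a factor \<open>\<bar>ln r\<bar>\<close>.

  On the dynamical side the force is merely bounded and measurable in time and has no derivative in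
  space. Curves are therefore handled through integral equations, which pass to limits by dominated
  convergence, and no Jacobian is available for the measure. A pointwise limit of measure-preserving
  maps retains only an inequality on open sets; equality comes from the inverse map, which is a flow
  of the same kind up to a change of sign of the velocity. Finally, the field of \<open>f\<close> is
  controlled at almost every time only, so it is first replaced by a Borel field that is controlled
  at all times and has the same solutions.\<close>

lemma has_integral_affine_real:
  fixes f :: "real \<Rightarrow> 'a::euclidean_space"
  assumes "(f has_integral i) {a..b}"
  shows shift_has_integral: "((\<lambda>t. f (t + c)) has_integral i) {a - c..b - c}"
    and reflect_has_integral: "((\<lambda>t. f (c - t)) has_integral i) {c - b..c - a}"
proof -
  show "((\<lambda>t. f (t + c)) has_integral i) {a - c..b - c}"
    using has_integral_affinity'[of f i a b 1 c] assms by (simp add: algebra_simps)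
  have "(\<lambda>x. (1 / (-1)) *\<^sub>R x + - ((1 / (-1)) *\<^sub>R c)) ` {a..b} = {c - b..c - a}"
    by (auto simp: image_iff intro!: bexI[of _ "c - _"])
  then show "((\<lambda>t. f (c - t)) has_integral i) {c - b..c - a}"
    using has_integral_affinity[of f i a b "-1" c] assms by (auto simp: algebra_simps image_def)
qed

text \<open>Difference quotients of a Lipschitz function are bounded, so dominated convergence applies.\<close>
lemma lipschitz_has_integral_ae_derivative:
  fixes F :: "real \<Rightarrow> 'a::euclidean_space"
  assumes "a \<le> b" and lip: "L-lipschitz_on {a..b} F"
    and der: "AE t in lebesgue_on {a<..<b}. (F has_vector_derivative f t) (at t)"
  shows "(f has_integral (F b - F a)) {a..b}"
proof -
  \<comment> \<open>Clamping the argument extends \<open>F\<close> by constants to a globally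
    Lipschitz \<open>G\<close>, so the quotients at \<open>t + h n\<close> make sense up to the
    endpoint \<open>b\<close>.\<close>
  define c where "c t = max a (min b t)" for t
  define G where "G t = F (c t)" for t
  have L0: "L \<ge> 0" using lip by (rule lipschitz_on_nonneg)
  have cin: "c t \<in> {a..b}" for t using \<open>a \<le> b\<close> by (auto simp: c_def)
  have Glip: "norm (G s - G t) \<le> L * \<bar>s - t\<bar>" for s t
  proof -
    have "norm (G s - G t) \<le> L * dist (c s) (c t)"
      using lipschitz_onD[OF lip cin cin, of s t] by (simp add: G_def dist_norm)
    also have "dist (c s) (c t) \<le> \<bar>s - t\<bar>"
      by (auto simp: c_def dist_real_def)
    finally show ?thesis using L0 by (simp add: mult_left_mono)
  qed
  have "L-lipschitz_on UNIV G"
    by (intro lipschitz_onI L0) (use Glip in \<open>auto simp: dist_norm\<close>)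
  then have Gcont: "continuous_on S G" for S
    using lipschitz_on_continuous_on continuous_on_subset by blast
  have Gint: "G integrable_on {u..v}" for u v
    using Gcont by (rule integrable_continuous_real)
  obtain N where N: "negligible N" and Nder: "\<And>t. \<lbrakk>t \<in> {a<..<b}; t \<notin> N\<rbrakk> \<Longrightarrow> (F has_vector_derivative f t) (at t)"
  proof -
    from der have "AE t in lebesgue. t \<in> {a<..<b} \<longrightarrow> (F has_vector_derivative f t) (at t)"
      by (simp add: AE_restrict_space_iff)
    then obtain M where "{t. \<not> (t \<in> {a<..<b} \<longrightarrow> (F has_vector_derivative f t) (at t))} \<subseteq> M" "M \<in> null_sets lebesgue"
      by (auto elim!: AE_E simp: null_sets_def)
    then show ?thesis
      by (intro that[of M]) (auto simp: negligible_iff_null_sets)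
  qed
  define h where "h n = inverse (real (Suc n))" for n
  have hpos: "h n > 0" for n by (simp add: h_def)
  have hlim: "h \<longlonglongrightarrow> 0" unfolding h_def by (rule LIMSEQ_inverse_real_of_nat)
  define q where "q n t = (G (t + h n) - G t) /\<^sub>R h n" for n t
  \<comment> \<open>After a translation the bulk of the two integrals cancels; what remains are
    averages over short intervals to the right of \<open>b\<close> and of \<open>a\<close>, which
    tend to the endpoint values.\<close>
  have qint: "(q n has_integral ((integral {b..b + h n} G) /\<^sub>R h n - (integral {a..a + h n} G) /\<^sub>R h n)) {a..b}" for n
  proof -
    have "((\<lambda>t. G (t + h n)) has_integral integral {a + h n..b + h n} G) {a..b}"
      using shift_has_integral[OF integrable_integral[OF Gint, of "a + h n" "b + h n"], of "h n"] by simp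
    then have 1: "(q n has_integral ((integral {a + h n..b + h n} G - integral {a..b} G) /\<^sub>R h n)) {a..b}"
      unfolding q_def by (intro has_integral_cmul has_integral_diff integrable_integral Gint)
    have 2: "integral {a..a + h n} G + integral {a + h n..b + h n} G = integral {a..b + h n} G"
      using hpos[of n] \<open>a \<le> b\<close> by (intro Henstock_Kurzweil_Integration.integral_combine Gint) auto
    have 3: "integral {a..b} G + integral {b..b + h n} G = integral {a..b + h n} G"
      using hpos[of n] \<open>a \<le> b\<close> by (intro Henstock_Kurzweil_Integration.integral_combine Gint) auto
    have *: "q - y = z - p" if "p + q = s" "y + z = s" for p q s y z :: 'a
    proof -
      have "q = s - p" "z = s - y" using that by (metis add_diff_cancel_left')+
      then show ?thesis by simp
    qed
    have "integral {a + h n..b + h n} G - integral {a..b} G = integral {b..b + h n} G - integral {a..a + h n} G"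
      by (rule *[OF 2 3])
    with 1 show ?thesis by (simp add: scaleR_diff_right)
  qed
  have avg: "(\<lambda>n. (integral {u..u + h n} G) /\<^sub>R h n) \<longlonglongrightarrow> G u" for u
  proof -
    have "norm ((integral {u..u + h n} G) /\<^sub>R h n - G u) \<le> L * h n" for n :: nat
    proof -
      have "((\<lambda>s. G s - G u) has_integral (integral {u..u + h n} G - h n *\<^sub>R G u)) {u..u + h n}"
        using has_integral_diff[OF integrable_integral[OF Gint, of u "u + h n"] has_integral_const_real[of "G u" u "u + h n"]]
          hpos[of n] by simp
      then have "norm (integral {u..u + h n} G - h n *\<^sub>R G u) \<le> (L * h n) * h n"
      proof (rule has_integral_bound_real[where S="{}", THEN order.trans, rotated 2])
        show "norm (G x - G u) \<le> L * h n" if "x \<in> {u..u + h n} - {}" for x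
          using that L0 by (intro order.trans[OF Glip] mult_left_mono) auto
      qed (use hpos[of n] L0 in auto)
      moreover have "integral {u..u + h n} G /\<^sub>R h n - G u = (integral {u..u + h n} G - h n *\<^sub>R G u) /\<^sub>R h n"
        using hpos[of n] by (simp add: scaleR_diff_right)
      ultimately show ?thesis using hpos[of n] by (simp add: divide_simps mult.commute)
    qed
    moreover have "(\<lambda>n. L * h n) \<longlonglongrightarrow> 0" using tendsto_mult_right_zero[OF hlim] .
    ultimately have "(\<lambda>n. (integral {u..u + h n} G) /\<^sub>R h n - G u) \<longlonglongrightarrow> 0"
      by (rule Lim_null_comparison[OF always_eventually[OF allI]])
    then show ?thesis by (simp add: LIM_zero_iff)
  qed
  let ?N = "N \<union> {a, b}"
  have negN: "negligible ?N" using N by auto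
  \<comment> \<open>Dominated convergence is applied with a limit at every point, so quotients and
    derivative are both set to 0 on the exceptional null set, to which the endpoints have been
    added.\<close>
  define q' where "q' n t = (if t \<in> ?N then 0 else q n t)" for n t
  define f' where "f' t = (if t \<in> ?N then 0 else f t)" for t
  have q'int: "(q' n has_integral ((integral {b..b + h n} G) /\<^sub>R h n - (integral {a..a + h n} G) /\<^sub>R h n)) {a..b}" for n
    by (rule has_integral_spike[OF negN _ qint]) (auto simp: q'_def)
  have bnd: "norm (q' n t) \<le> L" for n t
    using Glip[of "t + h n" t] hpos[of n] L0 by (auto simp: q'_def q_def divide_simps mult.commute)
  have lim: "(\<lambda>n. q' n t) \<longlonglongrightarrow> f' t" if "t \<in> {a..b}" for t
  proof (cases "t \<in> ?N")
    case False
    with that have t: "t \<in> {a<..<b}" "t \<notin> N" by auto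
    have "(F has_vector_derivative f t) (at t)" using t by (rule Nder)
    then have "(G has_vector_derivative f t) (at t)"
      by (rule has_vector_derivative_transform_within_open[of _ _ _ "{a<..<b}"])
         (use t in \<open>auto simp: G_def c_def\<close>)
    then have "((\<lambda>s. norm (G (t + s) - G t - s *\<^sub>R f t) / norm s) \<longlongrightarrow> 0) (at 0)"
      by (simp add: has_vector_derivative_def has_derivative_at)
    moreover have "\<forall>\<^sub>F s in at 0. norm (G (t + s) - G t - s *\<^sub>R f t) / norm s = norm ((G (t + s) - G t) /\<^sub>R s - f t)"
    proof (rule eventually_at_filter[THEN iffD2], rule always_eventually, intro allI impI)
      fix s :: real assume "s \<noteq> 0"
      then have "(G (t + s) - G t) /\<^sub>R s - f t = (G (t + s) - G t - s *\<^sub>R f t) /\<^sub>R s"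
        by (simp add: scaleR_diff_right)
      then show "norm (G (t + s) - G t - s *\<^sub>R f t) / norm s = norm ((G (t + s) - G t) /\<^sub>R s - f t)"
        by (simp add: divide_inverse mult.commute)
    qed
    ultimately have "((\<lambda>s. norm ((G (t + s) - G t) /\<^sub>R s - f t)) \<longlongrightarrow> 0) (at 0)"
      by (rule Lim_transform_eventually)
    then have "((\<lambda>s. (G (t + s) - G t) /\<^sub>R s) \<longlongrightarrow> f t) (at 0)"
      by (simp add: LIM_zero_iff tendsto_norm_zero_iff)
    moreover have "filterlim h (at 0) sequentially"
      unfolding filterlim_at using hlim hpos by (auto simp: less_imp_neq[symmetric] intro!: always_eventually)
    ultimately have "(\<lambda>n. q n t) \<longlonglongrightarrow> f t"
      unfolding q_def by (rule filterlim_compose)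
    then show ?thesis using False by (simp add: q'_def f'_def)
  qed (auto simp: q'_def f'_def)
  have "f' integrable_on {a..b}" "(\<lambda>n. integral {a..b} (q' n)) \<longlonglongrightarrow> integral {a..b} f'"
    by (rule dominated_convergence[of q' "{a..b}" "\<lambda>_. L"]; use q'int bnd lim in \<open>auto simp: has_integral_iff\<close>)+
  moreover have "(\<lambda>n. integral {a..b} (q' n)) \<longlonglongrightarrow> G b - G a"
    using q'int tendsto_diff[OF avg[of b] avg[of a]] by (simp add: has_integral_iff)
  ultimately have "(f' has_integral (G b - G a)) {a..b}"
    by (metis LIMSEQ_unique has_integral_iff)
  then have "(f has_integral (G b - G a)) {a..b}"
    by (rule has_integral_spike[OF negN, rotated]) (auto simp: f'_def)
  then show ?thesis using \<open>a \<le> b\<close> by (simp add: G_def c_def)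
qed

text \<open>Henstock's lemma bounds the total length of any disjoint family of intervals on which the difference
  quotient is off by more than \<open>\<epsilon>\<close>; Vitali's theorem covers the bad set by such a family.\<close>
lemma indefinite_integral_ae_derivative:
  fixes f :: "real \<Rightarrow> 'a::euclidean_space"
  assumes f: "f integrable_on {a..b}"
  shows "AE x in lebesgue_on {a<..<b}. ((\<lambda>t. integral {a..t} f) has_vector_derivative f x) (at x)"
proof -
  define F where "F t = integral {a..t} f" for t
  define I where "I x y = {min x y..max x y}" for x y :: real
  define \<delta> where "\<delta> x y = norm (F y - F x - (y - x) *\<^sub>R f x)" for x y
  define bad where "bad \<epsilon> = {x \<in> {a<..<b}. \<forall>d>0. \<exists>y\<in>{a..b}. y \<noteq> x \<and> \<bar>y - x\<bar> < d \<and> \<delta> x y > \<epsilon> * \<bar>y - x\<bar>}" for \<epsilon>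
  have Fdiff: "integral {x..y} f = F y - F x" if "a \<le> x" "x \<le> y" "y \<le> b" for x y
  proof -
    have "integral {a..x} f + integral {x..y} f = integral {a..y} f"
      using that by (intro Henstock_Kurzweil_Integration.integral_combine integrable_on_subinterval[OF f]) auto
    then show ?thesis by (simp add: F_def algebra_simps)
  qed
  have \<delta>I: "norm (measure lborel (I x y) *\<^sub>R f x - integral (I x y) f) = \<delta> x y" if "x \<in> {a..b}" "y \<in> {a..b}" for x y
  proof (cases "x \<le> y")
    case True
    then show ?thesis using that Fdiff[of x y] by (simp add: I_def \<delta>_def norm_minus_commute)
  next
    case False
    then have "norm (measure lborel (I x y) *\<^sub>R f x - integral (I x y) f) = norm ((x - y) *\<^sub>R f x - (F x - F y))"
      using that Fdiff[of y x] by (simp add: I_def)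
    also have "(x - y) *\<^sub>R f x - (F x - F y) = F y - F x - (y - x) *\<^sub>R f x" by (simp add: algebra_simps)
    finally show ?thesis by (simp add: \<delta>_def)
  qed
  have neg: "negligible (bad \<epsilon>)" if "\<epsilon> > 0" for \<epsilon>
    unfolding negligible_outer_le
  proof (intro allI impI)
    fix e :: real assume "e > 0"
    have "f integrable_on cbox a b" using f by simp
    then obtain \<gamma> where \<gamma>: "gauge \<gamma>" and fine: "\<And>p. \<lbrakk>p tagged_partial_division_of (cbox a b); \<gamma> fine p\<rbrakk> \<Longrightarrow>
             sum (\<lambda>(x,k). norm(measure lborel k *\<^sub>R f x - integral k f)) p < \<epsilon> * e"
      using Henstock_lemma[of f a b "\<epsilon> * e"] \<open>e > 0\<close> \<open>\<epsilon> > 0\<close> by auto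
    \<comment> \<open>A pair \<open>(x, y)\<close> encodes the interval between \<open>x\<close> and
      \<open>y\<close> tagged at its endpoint \<open>x\<close>. In one dimension this interval is
      the closed ball with centre \<open>m\<close> and radius \<open>r\<close>, the form that
      Vitali's theorem covers with.\<close>
    define K where "K = {(x, y). x \<in> {a..b} \<and> y \<in> {a..b} \<and> y \<noteq> x \<and> I x y \<subseteq> \<gamma> x \<and> \<delta> x y > \<epsilon> * \<bar>y - x\<bar>}"
    define m where "m = (\<lambda>(x::real, y). (x + y) / 2)"
    define r where "r = (\<lambda>(x::real, y). \<bar>y - x\<bar> / 2)"
    have cb: "cball (m i) (r i) = I (fst i) (snd i)" for i
    proof -
      have "m i - r i = min (fst i) (snd i)" "m i + r i = max (fst i) (snd i)"
        by (auto simp: m_def r_def min_def max_def field_simps split: prod.splits)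
      then show ?thesis by (simp add: cball_eq_atLeastAtMost I_def)
    qed
    have cov: "\<exists>i. i \<in> K \<and> x \<in> cball (m i) (r i) \<and> r i < d" if x: "x \<in> bad \<epsilon>" and "0 < d" for x d
    proof -
      from gaugeD[OF \<gamma>, of x] obtain d' where d': "d' > 0" "ball x d' \<subseteq> \<gamma> x"
        by (meson open_contains_ball)
      obtain y where y: "y \<in> {a..b}" "y \<noteq> x" "\<bar>y - x\<bar> < min d d'" "\<delta> x y > \<epsilon> * \<bar>y - x\<bar>"
        using x \<open>0 < d\<close> d'(1) unfolding bad_def by (auto dest!: spec[of _ "min d d'"])
      have "I x y \<subseteq> ball x d'" using y by (auto simp: I_def dist_real_def)
      with y d' x have "(x, y) \<in> K" by (auto simp: K_def bad_def)
      then show ?thesis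
        using y by (intro exI[of _ "(x,y)"]) (auto simp: cb, auto simp: I_def r_def)
    qed
    have rpos: "0 < r i" if "i \<in> K" for i
      using that by (auto simp: K_def r_def)
    obtain C where C: "countable C" "C \<subseteq> K"
      and disj: "pairwise (\<lambda>i j. disjnt (cball (m i) (r i)) (cball (m j) (r j))) C"
      and negC: "negligible (bad \<epsilon> - (\<Union>i \<in> C. cball (m i) (r i)))"
      using Vitali_covering_theorem_cballs[of K r "bad \<epsilon>" m, OF rpos cov] by blast
    \<comment> \<open>The selected tagged intervals form a \<open>\<gamma>\<close>-fine partial
      division, so their errors sum to at most \<open>\<epsilon> * e\<close>; each error exceeds
      \<open>\<epsilon>\<close> times the length, which leaves total length at most
      \<open>e\<close>.\<close>
    have fin: "measure lebesgue (\<Union>i\<in>D. cball (m i) (r i)) \<le> e" if D: "D \<subseteq> C" "finite D" for D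
    proof -
      define p where "p = (\<lambda>i. (fst i, I (fst i) (snd i))) ` D"
      have inj: "inj_on (\<lambda>i. (fst i, I (fst i) (snd i))) D"
      proof (rule inj_onI)
        fix i j assume ij: "i \<in> D" "j \<in> D" "(fst i, I (fst i) (snd i)) = (fst j, I (fst j) (snd j))"
        show "i = j"
        proof (rule ccontr)
          assume "i \<noteq> j"
          then have "disjnt (cball (m i) (r i)) (cball (m j) (r j))" using disj ij D by (auto simp: pairwise_def)
          moreover have "m i \<in> cball (m i) (r i)" using rpos[of i] ij D C by auto
          moreover have "cball (m i) (r i) = cball (m j) (r j)" unfolding cb using ij(3) by (metis prod.inject)
          ultimately show False by (auto simp: disjnt_def)
        qed
      qed
      have "p tagged_partial_division_of (cbox a b)"
        unfolding tagged_partial_division_of_def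
      proof (intro conjI allI impI)
        show "finite p" using D by (simp add: p_def)
        fix x k assume "(x, k) \<in> p"
        then obtain i where i: "i \<in> D" "x = fst i" "k = I (fst i) (snd i)" by (auto simp: p_def)
        then have "i \<in> K" using D C by auto
        then show "x \<in> k" "k \<subseteq> cbox a b" "\<exists>a b. k = cbox a b"
          using i by (auto simp: I_def K_def simp flip: box_real)
      next
        fix x k x' k' assume *: "(x, k) \<in> p \<and> (x', k') \<in> p \<and> (x, k) \<noteq> (x', k')"
        then obtain i j where i: "i \<in> D" "k = I (fst i) (snd i)" and j: "j \<in> D" "k' = I (fst j) (snd j)" and "i \<noteq> j"
          by (auto simp: p_def)
        then have "disjnt (cball (m i) (r i)) (cball (m j) (r j))" using disj D by (auto simp: pairwise_def)
        then show "interior k \<inter> interior k' = {}"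
          using interior_subset[of k] interior_subset[of k'] unfolding i j cb[symmetric] disjnt_def by blast
      qed
      moreover have "\<gamma> fine p"
        using D C by (fastforce simp: fine_def p_def K_def)
      ultimately have "(\<Sum>(x,k)\<in>p. norm (measure lborel k *\<^sub>R f x - integral k f)) < \<epsilon> * e" by (rule fine)
      also have "(\<Sum>(x,k)\<in>p. norm (measure lborel k *\<^sub>R f x - integral k f)) = (\<Sum>i\<in>D. \<delta> (fst i) (snd i))"
      proof -
        have "norm (measure lborel (I (fst i) (snd i)) *\<^sub>R f (fst i) - integral (I (fst i) (snd i)) f) = \<delta> (fst i) (snd i)"
          if "i \<in> D" for i using that D C by (intro \<delta>I) (auto simp: K_def)
        then show ?thesis unfolding p_def by (subst sum.reindex[OF inj]) simp
      qed
      finally have 1: "(\<Sum>i\<in>D. \<delta> (fst i) (snd i)) \<le> \<epsilon> * e" by simp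
      have "\<epsilon> * (\<Sum>i\<in>D. \<bar>snd i - fst i\<bar>) \<le> (\<Sum>i\<in>D. \<delta> (fst i) (snd i))"
        unfolding sum_distrib_left using D C by (intro sum_mono) (force simp: K_def)
      with 1 have "\<epsilon> * (\<Sum>i\<in>D. \<bar>snd i - fst i\<bar>) \<le> \<epsilon> * e" by simp
      then have 2: "(\<Sum>i\<in>D. \<bar>snd i - fst i\<bar>) \<le> e" using \<open>\<epsilon> > 0\<close> by simp
      have "measure lebesgue (\<Union>i\<in>D. cball (m i) (r i)) \<le> (\<Sum>i\<in>D. measure lebesgue (cball (m i) (r i)))"
        by (rule measure_UNION_le) (use D in auto)
      also have "\<dots> = (\<Sum>i\<in>D. \<bar>snd i - fst i\<bar>)"
        by (intro sum.cong refl) (auto simp: cb I_def min_def max_def)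
      finally show ?thesis using 2 by simp
    qed
    have U: "(\<Union>i\<in>C. cball (m i) (r i)) \<in> lmeasurable" "measure lebesgue (\<Union>i\<in>C. cball (m i) (r i)) \<le> e"
      using fmeasurable_UN_bound[OF C(1), of "\<lambda>i. cball (m i) (r i)" lebesgue e]
        measure_UN_bound[OF C(1), of "\<lambda>i. cball (m i) (r i)" lebesgue e] fin \<open>e > 0\<close> by auto
    let ?T = "(\<Union>i\<in>C. cball (m i) (r i)) \<union> (bad \<epsilon> - (\<Union>i \<in> C. cball (m i) (r i)))"
    show "\<exists>T. bad \<epsilon> \<subseteq> T \<and> T \<in> lmeasurable \<and> measure lebesgue T \<le> e"
    proof (intro exI conjI)
      show "bad \<epsilon> \<subseteq> ?T" by blast
      show "?T \<in> lmeasurable" using U(1) negligible_imp_measurable[OF negC] by (rule fmeasurable.Un)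
      have "measure lebesgue ?T \<le> e + 0"
        using U negC by (intro order.trans[OF measure_Un_le] add_mono) (auto simp: negligible_imp_measure0 negligible_imp_sets)
      then show "measure lebesgue ?T \<le> e" by simp
    qed
  qed
  \<comment> \<open>Countably many tolerances suffice, since \<open>bad\<close> grows as
    \<open>\<epsilon>\<close> decreases.\<close>
  define N where "N = (\<Union>n. bad (inverse (real (Suc n))))"
  have "negligible N" unfolding N_def by (intro negligible_Union_nat neg) auto
  moreover have "(F has_vector_derivative f x) (at x)" if x: "x \<in> {a<..<b}" "x \<notin> N" for x
    unfolding has_vector_derivative_def has_derivative_at_alt
  proof (intro conjI allI impI bounded_linear_scaleR_left)
    fix e :: real assume "e > 0"
    then obtain n where n: "inverse (real (Suc n)) < e" using reals_Archimedean by blast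
    from x have "x \<notin> bad (inverse (real (Suc n)))" by (auto simp: N_def)
    then have "\<exists>d>0. \<forall>y\<in>{a..b}. y \<noteq> x \<longrightarrow> \<bar>y - x\<bar> < d \<longrightarrow> \<delta> x y \<le> inverse (real (Suc n)) * \<bar>y - x\<bar>"
      using x unfolding bad_def mem_Collect_eq not_less[symmetric] by blast
    then obtain d where d: "d > 0" "\<And>y. \<lbrakk>y \<in> {a..b}; y \<noteq> x; \<bar>y - x\<bar> < d\<rbrakk> \<Longrightarrow> \<delta> x y \<le> inverse (real (Suc n)) * \<bar>y - x\<bar>"
      by blast
    show "\<exists>d>0. \<forall>y. norm (y - x) < d \<longrightarrow> norm (F y - F x - (y - x) *\<^sub>R f x) \<le> e * norm (y - x)"
    proof (intro exI[of _ "min d (min (x - a) (b - x))"] conjI allI impI)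
      show "0 < min d (min (x - a) (b - x))" using d x by auto
      fix y assume y: "norm (y - x) < min d (min (x - a) (b - x))"
      show "norm (F y - F x - (y - x) *\<^sub>R f x) \<le> e * norm (y - x)"
      proof (cases "y = x")
        case False
        have "y \<in> {a..b}" using y by (auto simp: abs_less_iff)
        then have "\<delta> x y \<le> inverse (real (Suc n)) * \<bar>y - x\<bar>" using d(2)[of y] y False by auto
        also have "\<dots> \<le> e * \<bar>y - x\<bar>" using n by (intro mult_right_mono) auto
        finally show ?thesis by (simp add: \<delta>_def)
      qed simp
    qed
  qed
  ultimately show ?thesis
    unfolding F_def[symmetric]
    by (subst AE_restrict_space_iff) (auto simp: negligible_iff_null_sets intro!: AE_I'[of N])
qed

lemma LIMSEQ_if_subsequences:
  fixes X :: "nat \<Rightarrow> 'a::metric_space"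
  assumes "\<And>r :: nat \<Rightarrow> nat. strict_mono r \<Longrightarrow> \<exists>s :: nat \<Rightarrow> nat. strict_mono s \<and> (\<lambda>n. X (r (s n))) \<longlonglongrightarrow> L"
  shows "X \<longlonglongrightarrow> L"
proof (rule ccontr)
  assume "\<not> X \<longlonglongrightarrow> L"
  then obtain e where e: "e > 0" "\<forall>N. \<exists>n\<ge>N. dist (X n) L \<ge> e"
    by (auto simp: lim_sequentially not_less)
  then have "infinite {n. dist (X n) L \<ge> e}"
    by (auto simp: infinite_nat_iff_unbounded_le)
  then obtain r :: "nat \<Rightarrow> nat" where r: "strict_mono r" "\<And>n. r n \<in> {n. dist (X n) L \<ge> e}"
    using infinite_enumerate by blast
  obtain s where "strict_mono s" "(\<lambda>n. X (r (s n))) \<longlonglongrightarrow> L" using assms[OF r(1)] by blast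
  then obtain n where "dist (X (r (s n))) L < e" using e(1) unfolding lim_sequentially by blast
  then show False using r(2)[of "s n"] by simp
qed

section \<open>An Osgood lemma for second-order inequalities\<close>

text \<open>Away from 0 the integrand is continuous and its gauge integral can be estimated;
  monotone convergence carries a bound uniform in \<open>r\<close> over to the Lebesgue integral
  used in \<open>diverges_at_0\<close>.\<close>

lemma nn_integral_inverse_sqrt_bound:
  fixes P :: "real \<Rightarrow> real"
  assumes contP: "continuous_on {0..} P" and Ppos: "\<And>r. r > 0 \<Longrightarrow> P r > 0"
    and "b > 0"
    and bound: "\<And>r. \<lbrakk>0 < r; r < b\<rbrakk> \<Longrightarrow> integral {r..b} (\<lambda>x. 1 / sqrt (P x)) \<le> B"
  shows "(\<integral>\<^sup>+ r\<in>{0<..<b}. ennreal (1 / sqrt (P r)) \<partial>lborel) \<le> ennreal B"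
proof -
  let ?f = "\<lambda>x. 1 / sqrt (P x)"
  \<comment> \<open>The shift by 2 makes \<open>c n < b\<close> strict already at
    \<open>n = 0\<close>.\<close>
  define c where "c n = b / real (n + 2)" for n
  have c: "0 < c n" "c n < b" for n using \<open>b > 0\<close> by (auto simp: c_def divide_simps add_pos_nonneg)
  define g where "g n x = ennreal (?f x) * indicator {c n..b} x" for n x
  have cont: "continuous_on {c n..b} ?f" for n
  proof (intro continuous_intros continuous_on_subset[OF contP] ballI)
    show "sqrt (P x) \<noteq> 0" if "x \<in> {c n..b}" for x using Ppos[of x] c[of n] that by auto
  qed (use c[of n] in auto)
  have gB: "(\<integral>\<^sup>+x. g n x \<partial>lborel) \<le> ennreal B" for n
  proof -
    have "(?f has_integral integral {c n..b} ?f) {c n..b}"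
      by (intro integrable_integral integrable_continuous_real cont)
    then have "((\<lambda>x. if x \<in> {c n..b} then ?f x else 0) has_integral integral {c n..b} ?f) UNIV"
      by (simp only: has_integral_restrict_UNIV)
    moreover have "(\<lambda>x. if x \<in> {c n..b} then ?f x else 0) \<in> borel_measurable borel"
      using borel_measurable_continuous_on_if[OF _ cont, of n] by (simp add: continuous_on_const)
    moreover have "0 \<le> (if x \<in> {c n..b} then ?f x else 0)" for x
      using Ppos[of x] c[of n] by auto
    ultimately have "(\<integral>\<^sup>+x. ennreal (if x \<in> {c n..b} then ?f x else 0) \<partial>lborel) = ennreal (integral {c n..b} ?f)"
      by (rule nn_integral_has_integral_lborel[rotated 2])
    also have "(\<integral>\<^sup>+x. ennreal (if x \<in> {c n..b} then ?f x else 0) \<partial>lborel) = (\<integral>\<^sup>+x. g n x \<partial>lborel)"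
      by (intro nn_integral_cong) (auto simp: g_def)
    finally show ?thesis using bound[OF c] by (simp add: ennreal_leI)
  qed
  have gm: "g n \<in> borel_measurable lborel" for n
  proof -
    have "(\<lambda>x. if x \<in> {c n..b} then ?f x else 0) \<in> borel_measurable lborel"
      using borel_measurable_continuous_on_if[OF _ cont, of n] by (simp add: continuous_on_const)
    then have "(\<lambda>x. ennreal (if x \<in> {c n..b} then ?f x else 0)) \<in> borel_measurable lborel" by simp
    moreover have "(\<lambda>x. ennreal (if x \<in> {c n..b} then ?f x else 0)) = g n" by (auto simp: g_def fun_eq_iff)
    ultimately show ?thesis by simp
  qed
  have "c n \<ge> c (Suc n)" for n using \<open>b > 0\<close> by (auto simp: c_def field_simps)
  then have inc: "incseq g"
    by (intro incseq_SucI) (auto simp: g_def le_fun_def indicator_def intro: order_trans)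
  have "(\<integral>\<^sup>+ r\<in>{0<..<b}. ennreal (?f r) \<partial>lborel) \<le> (\<integral>\<^sup>+x. (SUP n. g n x) \<partial>lborel)"
  proof (intro nn_integral_mono)
    fix x
    show "ennreal (?f x) * indicator {0<..<b} x \<le> (SUP n. g n x)"
    proof (cases "x \<in> {0<..<b}")
      case True
      then obtain n :: nat where "b / x < real n" using reals_Archimedean2 by blast
      then have "c n \<le> x" using True \<open>b > 0\<close> by (auto simp: c_def field_simps)
      then have "ennreal (?f x) * indicator {0<..<b} x = g n x" using True by (auto simp: g_def)
      also have "\<dots> \<le> (SUP n. g n x)" by (rule SUP_upper) simp
      finally show ?thesis .
    qed auto
  qed
  also have "\<dots> = (SUP n. (\<integral>\<^sup>+x. g n x \<partial>lborel))"
    by (rule nn_integral_monotone_convergence_SUP[OF inc gm])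
  also have "\<dots> \<le> ennreal B" by (rule SUP_least) (rule gB)
  finally show ?thesis .
qed

text \<open>If \<open>w'' = h \<le> C \<phi>(w)\<close> then \<open>w'\<^sup>2 \<le> 2 C \<Phi>(w)\<close>, so \<open>\<integral> dr / sqrt \<Phi>\<close> along \<open>w\<close> is at most
  \<open>sqrt (2 C)\<close> times the elapsed time. The energy inequality is obtained by telescoping over uniform
  partitions, which avoids differentiating \<open>w'\<close>.\<close>
lemma osgood_second_order:
  fixes \<phi> w u h :: "real \<Rightarrow> real"
  assumes "0 \<le> T" "0 < C"
    and cont\<phi>: "continuous_on {0..} \<phi>" and \<phi>0: "\<phi> 0 = 0" and \<phi>pos: "\<And>r. r > 0 \<Longrightarrow> \<phi> r > 0"
    and h: "h integrable_on {0..T}" and h0: "\<And>t. t \<in> {0..T} \<Longrightarrow> 0 \<le> h t"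
    and hw: "\<And>t. t \<in> {0..T} \<Longrightarrow> h t \<le> C * \<phi> (w t)"
    and u: "\<And>t. t \<in> {0..T} \<Longrightarrow> u t = integral {0..t} h"
    and w: "\<And>t. t \<in> {0..T} \<Longrightarrow> w t = integral {0..t} u"
    and div: "diverges_at_0 (\<lambda>r. 1 / sqrt (integral {0..r} \<phi>))"
  shows "w T = 0"
proof -
  define P where "P r = integral {0..r} \<phi>" for r
  have \<phi>nn: "\<phi> r \<ge> 0" if "r \<ge> 0" for r using \<phi>0 \<phi>pos[of r] that by (cases "r = 0") auto
  have \<phi>int: "\<phi> integrable_on {x..y}" if "0 \<le> x" for x y
    by (rule integrable_continuous_real, rule continuous_on_subset[OF cont\<phi>]) (use that in auto)
  have hint: "h integrable_on {x..y}" if "0 \<le> x" "y \<le> T" for x y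
    using that by (intro integrable_on_subinterval[OF h]) auto
  have hmon: "integral {0..x} h + integral {x..y} h = integral {0..y} h" if "0 \<le> x" "x \<le> y" "y \<le> T" for x y
    using that by (intro Henstock_Kurzweil_Integration.integral_combine hint) auto
  have udiff: "u y - u x = integral {x..y} h" if "0 \<le> x" "x \<le> y" "y \<le> T" for x y
    using hmon[OF that] that by (simp add: u)
  have umono: "u x \<le> u y" if "0 \<le> x" "x \<le> y" "y \<le> T" for x y
    using udiff[OF that] integral_nonneg[OF hint, of x y] that h0 by auto
  have u0: "0 \<le> u x" if "0 \<le> x" "x \<le> T" for x
    using umono[of 0 x] u[of 0] that by simp
  have ucont: "continuous_on {0..T} u"
    using indefinite_integral_continuous_1[OF h] u by (simp cong: continuous_on_cong_simp)
  have uint: "u integrable_on {x..y}" if "0 \<le> x" "y \<le> T" for x y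
    by (rule integrable_continuous_real, rule continuous_on_subset[OF ucont]) (use that in auto)
  have wder: "(w has_real_derivative u t) (at t within {0..T})" if "t \<in> {0..T}" for t
  proof -
    have "((\<lambda>t. integral {0..t} u) has_real_derivative u t) (at t within {0..T})"
      using integral_has_real_derivative[OF ucont that] .
    then show ?thesis
      by (rule has_field_derivative_transform_within[where d=1]) (use w that in auto)
  qed
  have wcont: "continuous_on {0..T} w" using wder DERIV_continuous_on by blast
  have wmono: "w x \<le> w y" if "0 \<le> x" "x \<le> y" "y \<le> T" for x y
  proof -
    have "integral {0..x} u + integral {x..y} u = integral {0..y} u"
      using that by (intro Henstock_Kurzweil_Integration.integral_combine uint) auto
    moreover have "integral {x..y} u \<ge> 0" using that by (intro integral_nonneg uint u0) auto
    ultimately show ?thesis using that by (simp add: w)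
  qed
  have w0: "w 0 = 0" using w[of 0] \<open>0 \<le> T\<close> by simp
  have wnn: "w x \<ge> 0" if "0 \<le> x" "x \<le> T" for x using wmono[of 0 x] w0 that by simp
  have Pder: "(P has_real_derivative \<phi> r) (at r within {0..})" if "0 \<le> r" for r
  proof -
    have "(P has_real_derivative \<phi> r) (at r within {0..r + 1})"
      unfolding P_def using that by (intro integral_has_real_derivative continuous_on_subset[OF cont\<phi>]) auto
    moreover have "at r within {0..r + 1} = at r within {0..}"
      by (rule at_within_nhd[of _ "{..<r + 1}"]) auto
    ultimately show ?thesis by simp
  qed
  have Pcont: "continuous_on {0..} P" using Pder DERIV_continuous_on by (metis atLeast_iff)
  have Ppos: "P r > 0" if "r > 0" for r
  proof -
    have "P 0 < P r"
    proof (rule DERIV_pos_imp_increasing_open[OF that])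
      fix x :: real assume "0 < x" "x < r"
      moreover have "at x within {0..} = at x" using \<open>0 < x\<close> by (intro at_within_interior) auto
      ultimately show "\<exists>y. (P has_real_derivative y) (at x) \<and> 0 < y"
        using Pder[of x] \<phi>pos[of x] by auto
    qed (rule continuous_on_subset[OF Pcont], auto)
    then show ?thesis by (simp add: P_def)
  qed
  have \<phi>wcont: "continuous_on {0..T} (\<lambda>t. \<phi> (w t))"
    by (rule continuous_on_compose2[OF cont\<phi> wcont]) (use wnn in auto)
  then obtain B where B: "\<And>t. t \<in> {0..T} \<Longrightarrow> \<phi> (w t) \<le> B"
    using compact_continuous_image[OF \<phi>wcont] compact_imp_bounded bounded_imp_bdd_above
    by (metis bdd_above_def compact_Icc image_eqI)
  have B0: "B \<ge> 0" using B[of 0] \<open>0 \<le> T\<close> w0 \<phi>0 by simp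
  \<comment> \<open>The defect in the energy inequality; it vanishes at time 0 and has to be shown
    nonpositive.\<close>
  define G where "G t = u t ^ 2 - 2 * C * P (w t)" for t
  \<comment> \<open>\<open>u\<close> is nondecreasing, so in the integral of
    \<open>\<phi> (w \<tau>) * u \<tau>\<close> it may be replaced from below by \<open>u s\<close>.
    What this loses is of second order: an increment of \<open>u\<close> times an increment of
    time.\<close>
  have Gstep: "G t - G s \<le> C * B * (u t - u s) * (t - s)" if "0 \<le> s" "s \<le> t" "t \<le> T" for s t
  proof -
    have \<phi>wint: "(\<lambda>t. \<phi> (w t)) integrable_on {s..t}"
      by (rule integrable_continuous_real, rule continuous_on_subset[OF \<phi>wcont]) (use that in auto)
    have prodint: "(\<lambda>\<tau>. \<phi> (w \<tau>) * u \<tau>) integrable_on {s..t}"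
      by (rule integrable_continuous_real, intro continuous_intros continuous_on_subset[OF \<phi>wcont] continuous_on_subset[OF ucont])
        (use that in auto)
    have "((\<lambda>\<tau>. \<phi> (w \<tau>) * u \<tau>) has_integral P (w t) - P (w s)) {s..t}"
    proof (rule fundamental_theorem_of_calculus[OF that(2)])
      fix x assume x: "x \<in> {s..t}"
      have "((\<lambda>x. P (w x)) has_real_derivative \<phi> (w x) * u x) (at x within {0..T})"
        using that x wnn
        by (intro DERIV_image_chain[of P, unfolded o_def] wder has_field_derivative_subset[OF Pder]) auto
      then show "((\<lambda>x. P (w x)) has_vector_derivative \<phi> (w x) * u x) (at x within {s..t})"
        using that by (auto simp: has_real_derivative_iff_has_vector_derivative intro: has_vector_derivative_within_subset)
    qed
    then have Pw: "P (w t) - P (w s) = integral {s..t} (\<lambda>\<tau>. \<phi> (w \<tau>) * u \<tau>)" by (simp add: has_integral_iff)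
    have I0: "integral {s..t} (\<lambda>\<tau>. \<phi> (w \<tau>)) \<ge> 0"
      using that by (intro integral_nonneg \<phi>wint \<phi>nn wnn) auto
    have "u t - u s \<le> integral {s..t} (\<lambda>\<tau>. C * \<phi> (w \<tau>))"
      unfolding udiff[OF that] using that hw
      by (intro integral_le hint integrable_on_mult_right \<phi>wint) auto
    then have 1: "u t - u s \<le> C * integral {s..t} (\<lambda>\<tau>. \<phi> (w \<tau>))" by simp
    have "integral {s..t} (\<lambda>\<tau>. \<phi> (w \<tau>) * u s) \<le> integral {s..t} (\<lambda>\<tau>. \<phi> (w \<tau>) * u \<tau>)"
      using that by (intro integral_le integrable_on_mult_left \<phi>wint prodint mult_left_mono umono \<phi>nn wnn) auto
    then have 2: "u s * integral {s..t} (\<lambda>\<tau>. \<phi> (w \<tau>)) \<le> P (w t) - P (w s)"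
      by (simp add: Pw mult.commute)
    have "integral {s..t} (\<lambda>\<tau>. \<phi> (w \<tau>)) \<le> integral {s..t} (\<lambda>\<tau>. B)"
      using that B by (intro integral_le \<phi>wint) auto
    then have 3: "integral {s..t} (\<lambda>\<tau>. \<phi> (w \<tau>)) \<le> B * (t - s)" using that by (simp add: mult.commute)
    let ?I = "integral {s..t} (\<lambda>\<tau>. \<phi> (w \<tau>))"
    have us: "0 \<le> u s" "u s \<le> u t" using u0 umono that by auto
    have "G t - G s = (u t + u s) * (u t - u s) - 2 * C * (P (w t) - P (w s))"
      by (simp add: G_def power2_eq_square algebra_simps)
    also have "\<dots> \<le> (u t + u s) * (C * ?I) - 2 * C * (u s * ?I)"
      using 1 2 us \<open>0 < C\<close> by (intro diff_mono mult_left_mono) auto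
    also have "\<dots> = C * (u t - u s) * ?I" by (simp add: algebra_simps)
    also have "\<dots> \<le> C * (u t - u s) * (B * (t - s))"
      using 3 us \<open>0 < C\<close> by (intro mult_left_mono) auto
    finally show ?thesis by (simp add: mult_ac)
  qed
  have energy: "u t ^ 2 \<le> 2 * C * P (w t)" if t: "t \<in> {0..T}" for t
  proof -
    \<comment> \<open>On a uniform grid of \<open>n + 1\<close> steps the increments of
      \<open>u\<close> telescope to \<open>u t\<close>, while the common step length tends to
      0.\<close>
    have "G t \<le> (C * B * u t * t) * inverse (real (Suc n))" for n
    proof -
      define \<delta> where "\<delta> = t / real (Suc n)"
      have \<delta>: "0 \<le> \<delta>" "real (Suc n) * \<delta> = t" using t by (auto simp: \<delta>_def)
      have "k \<le> Suc n \<Longrightarrow> G (real k * \<delta>) \<le> C * B * u (real k * \<delta>) * \<delta>" for k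
      proof (induction k)
        case 0
        show ?case using \<open>0 \<le> T\<close> by (simp add: G_def w0 P_def u)
      next
        case (Suc k)
        have le: "real (Suc k) * \<delta> \<le> t" using Suc.prems \<delta> mult_right_mono[of "real (Suc k)" "real (Suc n)" \<delta>] by simp
        have "G (real (Suc k) * \<delta>) - G (real k * \<delta>)
            \<le> C * B * (u (real (Suc k) * \<delta>) - u (real k * \<delta>)) * (real (Suc k) * \<delta> - real k * \<delta>)"
          using le t \<delta>(1) by (intro Gstep) (auto simp: algebra_simps)
        moreover have "real (Suc k) * \<delta> - real k * \<delta> = \<delta>" by (simp add: algebra_simps)
        ultimately show ?case using Suc by (simp add: algebra_simps)
      qed
      from this[of "Suc n"] show ?thesis by (simp only: \<delta>(2) le_refl) (simp add: \<delta>_def divide_inverse mult_ac)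
    qed
    moreover have "(\<lambda>n. (C * B * u t * t) * inverse (real (Suc n))) \<longlonglongrightarrow> 0"
      using tendsto_mult_right_zero[OF LIMSEQ_inverse_real_of_nat] .
    ultimately have "G t \<le> 0" by (intro LIMSEQ_le_const) auto
    then show ?thesis by (simp add: G_def)
  qed
  show ?thesis
  proof (rule ccontr)
    assume "w T \<noteq> 0"
    then have b: "w T > 0" using wnn[of T] \<open>0 \<le> T\<close> by simp
    let ?f = "\<lambda>x. 1 / sqrt (P x)"
    have fcont: "continuous_on {0<..} ?f"
    proof (intro continuous_intros continuous_on_subset[OF Pcont] ballI)
      show "sqrt (P x) \<noteq> 0" if "x \<in> {0<..}" for x using Ppos[of x] that by auto
    qed auto
    have "integral {r..w T} ?f \<le> sqrt (2 * C) * T" if r: "0 < r" "r < w T" for r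
    proof -
      \<comment> \<open>Starting at the time where \<open>w\<close> reaches the level
        \<open>r > 0\<close> avoids the singularity of the integrand at 0; the resulting bound does
        not depend on \<open>r\<close>.\<close>
      obtain t where t: "0 \<le> t" "t \<le> T" "w t = r"
        using IVT'[of w 0 r T] r w0 \<open>0 \<le> T\<close> wcont by auto
      \<comment> \<open>In the variable \<open>H (w x)\<close> the energy inequality becomes a speed
        limit: its derivative is at most \<open>sqrt (2 * C)\<close>.\<close>
      define H where "H x = integral {r..x} ?f" for x
      have Hder: "(H has_real_derivative ?f x) (at x within {r..w T})" if "x \<in> {r..w T}" for x
        unfolding H_def using that r by (intro integral_has_real_derivative continuous_on_subset[OF fcont]) auto
      have wr: "w x \<in> {r..w T}" if "x \<in> {t..T}" for x
        using that t wmono[of t x] wmono[of x T] by auto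
      have der: "((\<lambda>x. sqrt (2 * C) * x - H (w x)) has_real_derivative sqrt (2 * C) - ?f (w x) * u x) (at x within {t..T})"
        if x: "x \<in> {t..T}" for x
      proof -
        have "((\<lambda>x. H (w x)) has_real_derivative ?f (w x) * u x) (at x within {t..T})"
          using x t wr
          by (intro DERIV_image_chain[of H, unfolded o_def] has_field_derivative_subset[OF Hder] has_field_derivative_subset[OF wder]) auto
        then show ?thesis by (auto intro!: derivative_eq_intros)
      qed
      have "sqrt (2 * C) * t - H (w t) \<le> sqrt (2 * C) * T - H (w T)"
      proof (rule DERIV_nonneg_imp_increasing_open[OF t(2)])
        show "continuous_on {t..T} (\<lambda>x. sqrt (2 * C) * x - H (w x))"
          using der by (rule DERIV_continuous_on)
        fix x assume x: "t < x" "x < T"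
        have "sqrt (P (w x)) > 0" using Ppos wr[of x] r x by simp
        moreover have "u x \<le> sqrt (2 * C) * sqrt (P (w x))"
          using energy[of x] x t by (simp add: real_le_rsqrt flip: real_sqrt_mult)
        ultimately have "sqrt (2 * C) - ?f (w x) * u x \<ge> 0" by (simp add: field_simps)
        moreover have "at x within {t..T} = at x" using x by (intro at_within_interior) auto
        ultimately show "\<exists>y. ((\<lambda>x. sqrt (2 * C) * x - H (w x)) has_real_derivative y) (at x) \<and> 0 \<le> y"
          using der[of x] x by auto
      qed
      moreover have "sqrt (2 * C) * t \<ge> 0" using t \<open>0 < C\<close> by simp
      ultimately show ?thesis using t by (simp add: H_def)
    qed
    then have "(\<integral>\<^sup>+ r\<in>{0<..<w T}. ennreal (?f r) \<partial>lborel) \<le> ennreal (sqrt (2 * C) * T)"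
      using nn_integral_inverse_sqrt_bound[OF Pcont Ppos b] by blast
    then show False using div b unfolding diverges_at_0_def P_def[symmetric]
      by (metis ennreal_less_top infinity_ennreal_def leD)
  qed
qed

section \<open>The Coulomb kernel and uniformly local densities\<close>

lemma dyadic_scale:
  fixes t :: real
  assumes "0 < t" "t < 1"
  obtains k where "1 / 2 ^ Suc k \<le> t" "t < 1 / 2 ^ k"
proof -
  define P where "P n \<longleftrightarrow> 1 / 2 ^ n \<le> t" for n :: nat
  obtain n where "1 / t < 2 ^ n" using real_arch_pow[of 2 "1 / t"] by auto
  then have "P n" using \<open>0 < t\<close> by (simp add: P_def field_simps less_imp_le)
  then have 1: "P (LEAST n. P n)" by (rule LeastI)
  have "\<not> P 0" using \<open>t < 1\<close> by (simp add: P_def)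
  then obtain k where k: "(LEAST n. P n) = Suc k" using 1 by (cases "LEAST n. P n") auto
  then have "\<not> P k" using not_less_Least[of k P] by simp
  then show ?thesis using 1 k by (intro that[of k]) (auto simp: P_def)
qed

lemma ennreal_term_le_suminf:
  fixes f :: "nat \<Rightarrow> ennreal"
  shows "f k \<le> (\<Sum>i. f i)"
  using sum_le_suminf[OF summableI, of "{k}" f] by simp

text \<open>\<open>\<bar>g\<bar> \<le> \<lambda> + \<bar>g\<bar>\<^sup>p \<lambda>\<^bsup>1-p\<^esup>\<close> with the optimal \<open>\<lambda> = N s\<^bsup>-d/p\<^esup>\<close> replaces Hoelder's inequality.\<close>
lemma nn_integral_ball_le_powr:
  fixes g :: "'a::euclidean_space \<Rightarrow> real"
  assumes [measurable]: "g \<in> borel_measurable borel"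
    and "p \<ge> 1" "N > 0" "0 < s" "s \<le> 1"
    and gp: "(\<integral>\<^sup>+y\<in>ball x 1. ennreal (\<bar>g y\<bar> powr p) \<partial>lborel) \<le> ennreal (N powr p)"
  shows "(\<integral>\<^sup>+y\<in>ball x s. ennreal \<bar>g y\<bar> \<partial>lborel)
    \<le> ennreal ((unit_ball_vol DIM('a) + 1) * N * s powr (DIM('a) - DIM('a) / p))"
proof -
  let ?V = "unit_ball_vol (real DIM('a))" and ?d = "real DIM('a)"
  \<comment> \<open>With this level both contributions, \<open>l\<close> times the volume power and
    \<open>l powr (1 - p) * N powr p\<close>, scale as
    \<open>N * s powr (d - d / p)\<close>.\<close>
  define l where "l = N * s powr (- ?d / p)"
  have l: "l > 0" using assms by (simp add: l_def)
  have pw: "\<bar>c\<bar> \<le> l + l powr (1 - p) * \<bar>c\<bar> powr p" for c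
  proof (cases "\<bar>c\<bar> \<le> l")
    case True
    then show ?thesis by (simp add: add_increasing2)
  next
    case False
    then have c: "\<bar>c\<bar> > l" by simp
    have "\<bar>c\<bar> = \<bar>c\<bar> powr (1 - p) * \<bar>c\<bar> powr p" using c l by (simp flip: powr_add)
    also have "\<dots> \<le> l powr (1 - p) * \<bar>c\<bar> powr p"
      using c l \<open>p \<ge> 1\<close> by (intro mult_right_mono powr_mono2') auto
    finally show ?thesis using l by simp
  qed
  have "(\<integral>\<^sup>+y\<in>ball x s. ennreal \<bar>g y\<bar> \<partial>lborel)
      \<le> (\<integral>\<^sup>+y. ennreal l * indicator (ball x s) y
            + ennreal (l powr (1 - p)) * (ennreal (\<bar>g y\<bar> powr p) * indicator (ball x 1) y) \<partial>lborel)"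
  proof (intro nn_integral_mono)
    fix y
    have "ennreal \<bar>g y\<bar> \<le> ennreal l + ennreal (l powr (1 - p)) * ennreal (\<bar>g y\<bar> powr p)"
      using pw[of "g y"] l by (simp flip: ennreal_plus ennreal_mult add: ennreal_leI)
    then show "ennreal \<bar>g y\<bar> * indicator (ball x s) y \<le> ennreal l * indicator (ball x s) y
            + ennreal (l powr (1 - p)) * (ennreal (\<bar>g y\<bar> powr p) * indicator (ball x 1) y)"
      using \<open>s \<le> 1\<close> by (auto split: split_indicator)
  qed
  also have "\<dots> = ennreal l * emeasure lborel (ball x s)
            + ennreal (l powr (1 - p)) * (\<integral>\<^sup>+y\<in>ball x 1. ennreal (\<bar>g y\<bar> powr p) \<partial>lborel)"
  proof -
    have b: "ball x c \<in> sets lborel" for c by simp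
    have m: "(\<lambda>y. ennreal (\<bar>g y\<bar> powr p) * indicator (ball x 1) y) \<in> borel_measurable lborel"
      by (intro borel_measurable_times_ennreal borel_measurable_indicator b) simp
    then have "(\<lambda>y. ennreal (l powr (1 - p)) * (ennreal (\<bar>g y\<bar> powr p) * indicator (ball x 1) y)) \<in> borel_measurable lborel"
      by (rule borel_measurable_times_ennreal[OF borel_measurable_const])
    moreover have "(\<lambda>y. ennreal l * indicator (ball x s) y) \<in> borel_measurable lborel"
      by (intro borel_measurable_times_ennreal borel_measurable_indicator b) simp
    ultimately show ?thesis
      using m b by (simp only: nn_integral_add nn_integral_cmult nn_integral_cmult_indicator)
  qed
  also have "\<dots> \<le> ennreal l * ennreal (?V * s ^ DIM('a)) + ennreal (l powr (1 - p)) * ennreal (N powr p)"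
    using gp \<open>0 < s\<close> by (intro add_mono mult_left_mono) (auto simp: emeasure_ball)
  also have "\<dots> = ennreal (l * (?V * s ^ DIM('a)) + l powr (1 - p) * N powr p)"
    using l \<open>0 < s\<close> by (simp add: ennreal_mult ennreal_plus)
  also have "l * (?V * s ^ DIM('a)) = ?V * N * s powr (?d - ?d / p)"
    using \<open>0 < s\<close> by (simp add: l_def powr_diff powr_minus powr_realpow divide_inverse mult_ac)
  also have "l powr (1 - p) * N powr p = N * s powr (?d - ?d / p)"
  proof -
    have "l powr (1 - p) = N powr (1 - p) * s powr ((- ?d / p) * (1 - p))"
      using assms by (simp add: l_def powr_mult powr_powr)
    also have "(- ?d / p) * (1 - p) = ?d - ?d / p" using \<open>p \<ge> 1\<close> by (simp add: field_simps)
    finally show ?thesis using \<open>N > 0\<close> by (simp add: powr_diff)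
  qed
  finally show ?thesis by (simp add: algebra_simps)
qed

lemma norm_K: "norm (K x) = (if x = 0 then 0 else 1 / norm x ^ (DIM('a) - 1))" for x :: "'a::euclidean_space"
proof -
  have "norm x ^ DIM('a) = norm x * norm x ^ (DIM('a) - 1)"
    by (simp add: power_eq_if)
  then show ?thesis by (simp add: K_def divide_inverse)
qed

lemma measurable_K [measurable]: "K \<in> borel_measurable borel"
  unfolding K_def[abs_def] by measurable

text \<open>The sum of a geometric series whose ratio \<open>2 powr (- 1 / (d + 1))\<close> is the
  worst case of \<open>2 powr (- (1 - d / p))\<close> over all \<open>p \<ge> d + 1\<close>. The
  factor \<open>2 ^ (d - 1)\<close> comes from bounding the kernel on a dyadic shell by its value at
  the inner radius.\<close>

definition near_const :: "nat \<Rightarrow> real" where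
  "near_const d = (unit_ball_vol d + 1) * 2 ^ (d - 1) / (1 - 2 powr (- 1 / (real d + 1)))"

lemma near_const_nonneg: "near_const d \<ge> 0"
proof -
  have "2 powr (- 1 / (real d + 1)) \<le> (2::real) powr 0" by (intro powr_mono) auto
  then show ?thesis unfolding near_const_def by (intro divide_nonneg_nonneg mult_nonneg_nonneg) auto
qed

text \<open>On the shell of outer radius \<open>h = R / 2 ^ k\<close> the kernel is of order
  \<open>h powr (1 - d)\<close> and the mass of the surrounding ball of order
  \<open>h powr (d - d / p)\<close>. The product \<open>h powr (1 - d / p)\<close> is summable
  because \<open>p > d\<close>, uniformly so for \<open>p \<ge> d + 1\<close>.\<close>

lemma nn_integral_K_ball_le:
  fixes g :: "'a::euclidean_space \<Rightarrow> real"
  assumes g[measurable]: "g \<in> borel_measurable borel"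
    and p: "p \<ge> real DIM('a) + 1" and "N > 0" "0 < R" "R \<le> 1"
    and gp: "(\<integral>\<^sup>+y\<in>ball x 1. ennreal (\<bar>g y\<bar> powr p) \<partial>lborel) \<le> ennreal (N powr p)"
  shows "(\<integral>\<^sup>+y\<in>ball x R. ennreal (\<bar>g y\<bar> * norm (K (x - y))) \<partial>lborel)
    \<le> ennreal (near_const DIM('a) * N * R powr (1 - DIM('a) / p))"
proof -
  let ?V = "unit_ball_vol (real DIM('a))" and ?d = "real DIM('a)"
  define c where "c k = (2 ^ Suc k / R) ^ (DIM('a) - 1)" for k :: nat
  have c0: "c k \<ge> 0" for k using \<open>0 < R\<close> by (simp add: c_def)
  define q where "q = 2 powr (- 1 / (?d + 1))"
  have q: "0 < q" "q < 1"
  proof -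
    have "q < 2 powr 0" unfolding q_def by (rule powr_less_mono) auto
    then show "q < 1" by simp
  qed (simp add: q_def)
  define A where "A = (?V + 1) * 2 ^ (DIM('a) - 1) * N * R powr (1 - ?d / p)"
  have A: "A \<ge> 0" using \<open>N > 0\<close> by (simp add: A_def)
  have "(\<integral>\<^sup>+y\<in>ball x R. ennreal (\<bar>g y\<bar> * norm (K (x - y))) \<partial>lborel)
      \<le> (\<integral>\<^sup>+y. (\<Sum>k. ennreal (c k) * (ennreal \<bar>g y\<bar> * indicator (ball x (R / 2 ^ k)) y)) \<partial>lborel)"
  proof (intro nn_integral_mono)
    fix y
    show "ennreal (\<bar>g y\<bar> * norm (K (x - y))) * indicator (ball x R) y
      \<le> (\<Sum>k. ennreal (c k) * (ennreal \<bar>g y\<bar> * indicator (ball x (R / 2 ^ k)) y))"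
    proof (cases "y \<in> ball x R \<and> y \<noteq> x")
      case True
      then have z: "0 < norm (x - y) / R" "norm (x - y) / R < 1" using \<open>0 < R\<close> by (auto simp: dist_norm)
      obtain k where k: "1 / 2 ^ Suc k \<le> norm (x - y) / R" "norm (x - y) / R < 1 / 2 ^ k"
        using dyadic_scale[OF z] .
      have "norm (K (x - y)) = (1 / norm (x - y)) ^ (DIM('a) - 1)"
        using True by (auto simp: norm_K power_one_over)
      also have "\<dots> \<le> c k" unfolding c_def
        using k(1) True \<open>0 < R\<close> by (intro power_mono) (auto simp: field_simps)
      finally have "ennreal (\<bar>g y\<bar> * norm (K (x - y))) \<le> ennreal (c k) * ennreal \<bar>g y\<bar>"
        using c0[of k] mult_right_mono[of "norm (K (x - y))" "c k" "\<bar>g y\<bar>"]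
        by (simp flip: ennreal_mult add: ennreal_leI mult.commute)
      moreover have "y \<in> ball x (R / 2 ^ k)" using k(2) \<open>0 < R\<close> by (simp add: dist_norm field_simps)
      ultimately have "ennreal (\<bar>g y\<bar> * norm (K (x - y))) * indicator (ball x R) y
          \<le> ennreal (c k) * (ennreal \<bar>g y\<bar> * indicator (ball x (R / 2 ^ k)) y)"
        using True by simp
      also have "\<dots> \<le> (\<Sum>k. ennreal (c k) * (ennreal \<bar>g y\<bar> * indicator (ball x (R / 2 ^ k)) y))"
        by (rule ennreal_term_le_suminf)
      finally show ?thesis .
    qed (auto simp: norm_K split: split_indicator)
  qed
  also have "\<dots> = (\<Sum>k. ennreal (c k) * (\<integral>\<^sup>+y\<in>ball x (R / 2 ^ k). ennreal \<bar>g y\<bar> \<partial>lborel))"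
  proof -
    have m: "(\<lambda>y. ennreal \<bar>g y\<bar> * indicator (ball x (R / 2 ^ k)) y) \<in> borel_measurable lborel" for k
      by (intro borel_measurable_times_ennreal borel_measurable_indicator) simp_all
    then have "(\<lambda>y. ennreal (c k) * (ennreal \<bar>g y\<bar> * indicator (ball x (R / 2 ^ k)) y)) \<in> borel_measurable lborel" for k
      by (rule borel_measurable_times_ennreal[OF borel_measurable_const])
    with m show ?thesis by (simp only: nn_integral_suminf nn_integral_cmult)
  qed
  also have "\<dots> \<le> (\<Sum>k. ennreal (A * q ^ k))"
  proof (intro suminf_le summableI)
    fix k
    have "(\<integral>\<^sup>+y\<in>ball x (R / 2 ^ k). ennreal \<bar>g y\<bar> \<partial>lborel)
        \<le> ennreal ((?V + 1) * N * (R / 2 ^ k) powr (?d - ?d / p))"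
      using assms by (intro nn_integral_ball_le_powr) (auto simp: divide_le_eq intro: order.trans[of _ 1])
    then have "ennreal (c k) * (\<integral>\<^sup>+y\<in>ball x (R / 2 ^ k). ennreal \<bar>g y\<bar> \<partial>lborel)
        \<le> ennreal (c k) * ennreal ((?V + 1) * N * (R / 2 ^ k) powr (?d - ?d / p))"
      by (rule mult_left_mono) simp
    also have "\<dots> = ennreal (c k * ((?V + 1) * N * (R / 2 ^ k) powr (?d - ?d / p)))"
      using c0 \<open>N > 0\<close> by (simp add: ennreal_mult)
    also have "\<dots> \<le> ennreal (A * q ^ k)"
    proof (rule ennreal_leI)
      define h where "h = R / 2 ^ k"
      have h: "h > 0" using \<open>0 < R\<close> by (simp add: h_def)
      have "c k = 2 ^ (DIM('a) - 1) * h powr (1 - ?d)"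
      proof -
        have "c k = (2 / h) ^ (DIM('a) - 1)" by (simp add: c_def h_def)
        also have "\<dots> = 2 ^ (DIM('a) - 1) * (1 / h ^ (DIM('a) - 1))" by (simp add: power_divide)
        also have "1 / h ^ (DIM('a) - 1) = h powr (- real (DIM('a) - 1))"
          using h by (simp only: powr_minus powr_realpow divide_inverse mult_1)
        also have "- real (DIM('a) - 1) = 1 - ?d" by (simp add: of_nat_diff)
        finally show ?thesis .
      qed
      then have "c k * ((?V + 1) * N * h powr (?d - ?d / p))
          = (?V + 1) * 2 ^ (DIM('a) - 1) * N * (h powr (1 - ?d) * h powr (?d - ?d / p))"
        by (simp add: mult_ac)
      also have "h powr (1 - ?d) * h powr (?d - ?d / p) = h powr (1 - ?d / p)"
        by (simp flip: powr_add)
      also have "h powr (1 - ?d / p) = R powr (1 - ?d / p) * (2 powr (- (1 - ?d / p))) ^ k"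
      proof -
        have "h powr (1 - ?d / p) = R powr (1 - ?d / p) * ((2 ^ k) powr (- (1 - ?d / p)))"
          using \<open>0 < R\<close> unfolding h_def by (subst powr_divide) (simp_all only: powr_minus divide_inverse zero_le_power zero_le_numeral less_imp_le)
        also have "(2 ^ k) powr (- (1 - ?d / p)) = (2 powr (- (1 - ?d / p))) ^ k"
          by (simp add: powr_powr mult.commute flip: powr_realpow)
        finally show ?thesis .
      qed
      also have "(?V + 1) * 2 ^ (DIM('a) - 1) * N * (R powr (1 - ?d / p) * (2 powr (- (1 - ?d / p))) ^ k)
          = A * (2 powr (- (1 - ?d / p))) ^ k" by (simp add: A_def mult_ac)
      also have "\<dots> \<le> A * q ^ k"
      proof -
        \<comment> \<open>This is where \<open>p \<ge> d + 1\<close> makes the ratio of the series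
          independent of \<open>p\<close>.\<close>
        have "?d / p \<le> ?d / (?d + 1)" using p by (intro divide_left_mono) auto
        also have "\<dots> = 1 - 1 / (?d + 1)" by (simp add: field_simps)
        finally have "2 powr (- (1 - ?d / p)) \<le> q" unfolding q_def by (intro powr_mono) auto
        then show ?thesis using A by (intro mult_left_mono power_mono) auto
      qed
      finally show "c k * ((?V + 1) * N * (R / 2 ^ k) powr (?d - ?d / p)) \<le> A * q ^ k" by (simp add: h_def)
    qed
    finally show "ennreal (c k) * (\<integral>\<^sup>+y\<in>ball x (R / 2 ^ k). ennreal \<bar>g y\<bar> \<partial>lborel) \<le> ennreal (A * q ^ k)" .
  qed
  also have "\<dots> = ennreal (A * (1 / (1 - q)))"
    using q A by (intro suminf_ennreal_eq sums_mult geometric_sums) auto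
  also have "A * (1 / (1 - q)) = near_const DIM('a) * N * R powr (1 - DIM('a) / p)"
    by (simp add: A_def near_const_def q_def mult_ac)
  finally show ?thesis .
qed

text \<open>For the kernel of degree \<open>- d\<close>, the order of the derivative of
  \<open>K\<close>, the scale cancels: every dyadic shell contributes at most the same amount, up to
  the factor \<open>r powr (- d / p)\<close>. The number \<open>n + 1\<close> of shells between
  \<open>r\<close> and 1 is the source of the logarithm in \<open>phi\<close>.\<close>

lemma nn_integral_annulus_le:
  fixes g :: "'a::euclidean_space \<Rightarrow> real"
  assumes g[measurable]: "g \<in> borel_measurable borel"
    and "p \<ge> 1" "N > 0" "0 < r" and n: "1 / 2 ^ Suc n \<le> r" "r < 1 / 2 ^ n"
    and gp: "(\<integral>\<^sup>+y\<in>ball x 1. ennreal (\<bar>g y\<bar> powr p) \<partial>lborel) \<le> ennreal (N powr p)"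
  shows "(\<integral>\<^sup>+y\<in>ball x 1 - ball x r. ennreal (\<bar>g y\<bar> / norm (x - y) ^ DIM('a)) \<partial>lborel)
    \<le> ennreal ((real n + 1) * (2 ^ DIM('a) * (unit_ball_vol DIM('a) + 1) * N * r powr (- real DIM('a) / p)))"
proof -
  let ?V = "unit_ball_vol (real DIM('a))" and ?d = "real DIM('a)"
  define c where "c k = (2::real) ^ (Suc k * DIM('a))" for k :: nat
  have c0: "c k \<ge> 0" for k by (simp add: c_def)
  define A where "A = 2 ^ DIM('a) * (?V + 1) * N * r powr (- ?d / p)"
  have A: "A \<ge> 0" using \<open>N > 0\<close> by (simp add: A_def)
  have "(\<integral>\<^sup>+y\<in>ball x 1 - ball x r. ennreal (\<bar>g y\<bar> / norm (x - y) ^ DIM('a)) \<partial>lborel)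
      \<le> (\<integral>\<^sup>+y. (\<Sum>k\<le>n. ennreal (c k) * (ennreal \<bar>g y\<bar> * indicator (ball x (1 / 2 ^ k)) y)) \<partial>lborel)"
  proof (intro nn_integral_mono)
    fix y
    show "ennreal (\<bar>g y\<bar> / norm (x - y) ^ DIM('a)) * indicator (ball x 1 - ball x r) y
      \<le> (\<Sum>k\<le>n. ennreal (c k) * (ennreal \<bar>g y\<bar> * indicator (ball x (1 / 2 ^ k)) y))"
    proof (cases "y \<in> ball x 1 - ball x r")
      case True
      then have z: "r \<le> norm (x - y)" "norm (x - y) < 1" by (auto simp: dist_norm)
      then have "0 < norm (x - y)" using \<open>0 < r\<close> by linarith
      from dyadic_scale[OF this z(2)]
      obtain k where k: "1 / 2 ^ Suc k \<le> norm (x - y)" "norm (x - y) < 1 / 2 ^ k" .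
      have "1 / 2 ^ Suc n < (1::real) / 2 ^ k" using n(1) z(1) k(2) by linarith
      then have "(2::real) ^ k < 2 ^ Suc n" by (simp add: divide_less_eq less_divide_eq field_simps)
      then have "k < Suc n" by (rule power_less_imp_less_exp[rotated]) simp
      then have kn: "k \<in> {..n}" by simp
      have "1 / norm (x - y) \<le> 2 ^ Suc k" using k(1) \<open>0 < norm (x - y)\<close> by (simp add: field_simps)
      then have "(1 / norm (x - y)) ^ DIM('a) \<le> (2 ^ Suc k) ^ DIM('a)" by (rule power_mono) simp
      then have "1 / norm (x - y) ^ DIM('a) \<le> c k" unfolding c_def power_mult by (simp add: power_one_over)
      then have "\<bar>g y\<bar> * (1 / norm (x - y) ^ DIM('a)) \<le> \<bar>g y\<bar> * c k" by (rule mult_left_mono) simp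
      then have "ennreal (\<bar>g y\<bar> / norm (x - y) ^ DIM('a)) \<le> ennreal (c k) * ennreal \<bar>g y\<bar>"
        using c0[of k] by (simp flip: ennreal_mult add: ennreal_leI mult.commute)
      moreover have "y \<in> ball x (1 / 2 ^ k)" using k(2) by (simp add: dist_norm)
      ultimately have "ennreal (\<bar>g y\<bar> / norm (x - y) ^ DIM('a)) * indicator (ball x 1 - ball x r) y
          \<le> ennreal (c k) * (ennreal \<bar>g y\<bar> * indicator (ball x (1 / 2 ^ k)) y)"
        using True by simp
      also have "\<dots> \<le> (\<Sum>k\<le>n. ennreal (c k) * (ennreal \<bar>g y\<bar> * indicator (ball x (1 / 2 ^ k)) y))"
        using kn by (intro member_le_sum) auto
      finally show ?thesis .
    qed auto
  qed
  also have "\<dots> = (\<Sum>k\<le>n. ennreal (c k) * (\<integral>\<^sup>+y\<in>ball x (1 / 2 ^ k). ennreal \<bar>g y\<bar> \<partial>lborel))"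
  proof -
    have m: "(\<lambda>y. ennreal \<bar>g y\<bar> * indicator (ball x (1 / 2 ^ k)) y) \<in> borel_measurable lborel" for k
      by (intro borel_measurable_times_ennreal borel_measurable_indicator) simp_all
    then have "(\<lambda>y. ennreal (c k) * (ennreal \<bar>g y\<bar> * indicator (ball x (1 / 2 ^ k)) y)) \<in> borel_measurable lborel" for k
      by (rule borel_measurable_times_ennreal[OF borel_measurable_const])
    with m show ?thesis by (simp only: nn_integral_sum nn_integral_cmult)
  qed
  also have "\<dots> \<le> (\<Sum>k\<le>n. ennreal A)"
  proof (intro sum_mono)
    fix k assume "k \<in> {..n}"
    have "(\<integral>\<^sup>+y\<in>ball x (1 / 2 ^ k). ennreal \<bar>g y\<bar> \<partial>lborel)
        \<le> ennreal ((?V + 1) * N * (1 / 2 ^ k) powr (?d - ?d / p))"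
      using assms by (intro nn_integral_ball_le_powr) auto
    then have "ennreal (c k) * (\<integral>\<^sup>+y\<in>ball x (1 / 2 ^ k). ennreal \<bar>g y\<bar> \<partial>lborel)
        \<le> ennreal (c k) * ennreal ((?V + 1) * N * (1 / 2 ^ k) powr (?d - ?d / p))"
      by (rule mult_left_mono) simp
    also have "\<dots> = ennreal (c k * ((?V + 1) * N * (1 / 2 ^ k) powr (?d - ?d / p)))"
      using c0 \<open>N > 0\<close> by (simp add: ennreal_mult)
    also have "\<dots> \<le> ennreal A"
    proof (rule ennreal_leI)
      define h where "h = (1::real) / 2 ^ k"
      have h: "h > 0" by (simp add: h_def)
      have "c k = 2 ^ DIM('a) * h powr (- ?d)"
        by (simp add: c_def h_def powr_minus powr_realpow power_add power_mult power_divide)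
      then have "c k * ((?V + 1) * N * h powr (?d - ?d / p))
          = 2 ^ DIM('a) * (?V + 1) * N * (h powr (- ?d) * h powr (?d - ?d / p))"
        by (simp add: mult_ac)
      also have "h powr (- ?d) * h powr (?d - ?d / p) = h powr (- ?d / p)"
        by (simp flip: powr_add)
      also have "\<dots> \<le> r powr (- ?d / p)"
      proof (rule powr_mono2')
        have "r < 1 / 2 ^ n" by (rule n(2))
        also have "(1::real) / 2 ^ n \<le> h"
          unfolding h_def using \<open>k \<in> {..n}\<close> by (intro divide_left_mono power_increasing) auto
        finally show "r \<le> h" by simp
      qed (use \<open>0 < r\<close> \<open>p \<ge> 1\<close> in auto)
      finally show "c k * ((?V + 1) * N * (1 / 2 ^ k) powr (?d - ?d / p)) \<le> A"
        using \<open>N > 0\<close> by (simp add: h_def A_def mult_left_mono)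
    qed
    finally show "ennreal (c k) * (\<integral>\<^sup>+y\<in>ball x (1 / 2 ^ k). ennreal \<bar>g y\<bar> \<partial>lborel) \<le> ennreal A" .
  qed
  also have "\<dots> = ennreal ((real n + 1) * A)"
    using A by (simp add: ennreal_mult ennreal_of_nat_eq_real_of_nat add.commute flip: ennreal_plus)
  finally show ?thesis by (simp add: A_def)
qed

lemma abs_power_diff_le:
  fixes a b M :: real
  assumes "0 \<le> a" "a \<le> M" "0 \<le> b" "b \<le> M"
  shows "\<bar>a ^ n - b ^ n\<bar> \<le> \<bar>a - b\<bar> * (n * M ^ (n - 1))"
proof -
  have "(\<Sum>i<n. b ^ (n - Suc i) * a ^ i) \<le> (\<Sum>i<n. M ^ (n - 1))"
  proof (intro sum_mono)
    fix i assume "i \<in> {..<n}"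
    then have "n - 1 = (n - Suc i) + i" by auto
    then have "M ^ (n - 1) = M ^ (n - Suc i) * M ^ i" by (metis power_add)
    then show "b ^ (n - Suc i) * a ^ i \<le> M ^ (n - 1)"
      using assms by (auto intro!: mult_mono power_mono)
  qed
  moreover have "0 \<le> (\<Sum>i<n. b ^ (n - Suc i) * a ^ i)" using assms by (intro sum_nonneg) auto
  ultimately show ?thesis
    unfolding power_diff_sumr2 abs_mult by (intro mult_left_mono) auto
qed

text \<open>A mean value estimate done by algebra: the difference is split into that of the
  numerators and that of the powers of the norms. Since \<open>norm y\<close> lies between 1/2 and
  3/2 of \<open>norm x\<close>, the power \<open>3 ^ (d - 1)\<close> arises as the quotient of the
  powers of 3/2 and 1/2.\<close>

lemma norm_K_diff_le:
  fixes x y :: "'a::euclidean_space"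
  assumes "x \<noteq> 0" and xy: "norm (x - y) \<le> norm x / 2"
  shows "norm (K x - K y) \<le> (1 + DIM('a) * 3 ^ (DIM('a) - 1)) * norm (x - y) / norm x ^ DIM('a)"
proof -
  define m where "m = DIM('a) - 1"
  have d: "DIM('a) = Suc m" unfolding m_def using DIM_positive[where 'a='a] by simp
  define a b where "a = norm x" and "b = norm y"
  have a: "a > 0" using assms by (simp add: a_def)
  have ab: "\<bar>b - a\<bar> \<le> norm (x - y)" unfolding a_def b_def by (metis norm_minus_commute norm_triangle_ineq3)
  then have b: "a / 2 \<le> b" "b \<le> 3 / 2 * a" using xy by (auto simp: a_def abs_le_iff)
  then have b0: "b > 0" using a by linarith
  have "K x - K y = (x - y) /\<^sub>R a ^ Suc m + (1 / a ^ Suc m - 1 / b ^ Suc m) *\<^sub>R y"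
    by (simp add: K_def d a_def b_def algebra_simps divide_inverse)
  then have "norm (K x - K y) \<le> norm (x - y) / a ^ Suc m + \<bar>1 / a ^ Suc m - 1 / b ^ Suc m\<bar> * b"
    using norm_triangle_ineq[of "(x - y) /\<^sub>R a ^ Suc m" "(1 / a ^ Suc m - 1 / b ^ Suc m) *\<^sub>R y"] a
    by (simp add: b_def divide_inverse mult.commute)
  also have "\<bar>1 / a ^ Suc m - 1 / b ^ Suc m\<bar> * b \<le> (real (Suc m) * 3 ^ m) * norm (x - y) / a ^ Suc m"
  proof -
    have "1 / a ^ Suc m - 1 / b ^ Suc m = (b ^ Suc m - a ^ Suc m) / (a ^ Suc m * b ^ Suc m)"
      using a b0 by (simp add: field_simps)
    then have "\<bar>1 / a ^ Suc m - 1 / b ^ Suc m\<bar> * b = \<bar>b ^ Suc m - a ^ Suc m\<bar> / (a ^ Suc m * b ^ m)"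
      using a b0 by (simp add: abs_mult field_simps)
    also have "\<dots> \<le> (norm (x - y) * (real (Suc m) * (3 / 2 * a) ^ m)) / (a ^ Suc m * (a / 2) ^ m)"
    proof (intro frac_le mult_left_mono power_mono)
      have "\<bar>b ^ Suc m - a ^ Suc m\<bar> \<le> \<bar>b - a\<bar> * (real (Suc m) * (3 / 2 * a) ^ (Suc m - 1))"
        using a b b0 by (intro abs_power_diff_le) auto
      also have "\<dots> \<le> norm (x - y) * (real (Suc m) * (3 / 2 * a) ^ (Suc m - 1))"
        using ab a by (intro mult_right_mono) auto
      finally show "\<bar>b ^ Suc m - a ^ Suc m\<bar> \<le> norm (x - y) * (real (Suc m) * (3 / 2 * a) ^ m)" by simp
    qed (use a b in auto)
    also have "\<dots> = (real (Suc m) * 3 ^ m) * norm (x - y) / a ^ Suc m"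
      using a by (simp add: power_divide power_mult_distrib)
    finally show ?thesis .
  qed
  finally show ?thesis by (simp add: d a_def algebra_simps add_divide_distrib)
qed

section \<open>Size and modulus of continuity of the field of one density\<close>

locale ul_density =
  fixes g :: "'a::euclidean_space \<Rightarrow> real" and \<Theta> :: "real \<Rightarrow> real" and A B :: real
  assumes g_measurable: "g \<in> borel_measurable borel"
    and growth: "growth_fun \<Theta>"
    and A_nonneg: "A \<ge> 0" and B_pos: "B > 0"
    and local_norm: "\<And>p x. p \<ge> 1 \<Longrightarrow>
      (\<integral>\<^sup>+y\<in>ball x 1. ennreal (\<bar>g y\<bar> powr p) \<partial>lborel) \<le> ennreal ((B * \<Theta> p) powr p)"
    and total_norm: "(\<integral>\<^sup>+y. ennreal \<bar>g y\<bar> \<partial>lborel) \<le> ennreal A"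
begin

lemmas [measurable] = g_measurable

lemma \<Theta>_pos: "p \<ge> 0 \<Longrightarrow> \<Theta> p > 0"
  using growth by (simp add: growth_fun_def)

lemma \<Theta>_mono: "0 \<le> p \<Longrightarrow> p \<le> q \<Longrightarrow> \<Theta> p \<le> \<Theta> q"
  using growth by (auto simp: growth_fun_def mono_on_def)

text \<open>The unit ball is estimated with the exponent \<open>d + 1\<close>; outside it the kernel
  is at most 1 and the total mass \<open>A\<close> takes over.\<close>

definition field_bound :: real where
  "field_bound = near_const DIM('a) * (B * \<Theta> (DIM('a) + 1)) + A"

text \<open>The factor \<open>exp d\<close> is \<open>r powr (- d / p)\<close> at
  \<open>p = \<bar>ln r\<bar>\<close>. The 6 comes from two near balls of radius
  \<open>3 * r\<close>, the 3 in the second term from counting dyadic shells, and the last summand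
  is the far field.\<close>

definition modulus_const :: real where
  "modulus_const =
    exp DIM('a) * B * (6 * near_const DIM('a) + 3 * (1 + DIM('a) * 3 ^ (DIM('a) - 1)) * 2 ^ DIM('a) * (unit_ball_vol DIM('a) + 1))
    + (1 + DIM('a) * 3 ^ (DIM('a) - 1)) * A / \<Theta> 0"

lemma field_bound_nonneg: "field_bound \<ge> 0"
  unfolding field_bound_def using near_const_nonneg A_nonneg B_pos \<Theta>_pos by (simp add: less_imp_le)

lemma modulus_const_nonneg: "modulus_const \<ge> 0"
  unfolding modulus_const_def using near_const_nonneg A_nonneg B_pos \<Theta>_pos[of 0] by simp

lemma nn_integral_K_le:
  "(\<integral>\<^sup>+y. ennreal (\<bar>g y\<bar> * norm (K (x - y))) \<partial>lborel) \<le> ennreal field_bound"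
proof -
  have "(\<integral>\<^sup>+y. ennreal (\<bar>g y\<bar> * norm (K (x - y))) \<partial>lborel)
      \<le> (\<integral>\<^sup>+y. ennreal (\<bar>g y\<bar> * norm (K (x - y))) * indicator (ball x 1) y + ennreal \<bar>g y\<bar> \<partial>lborel)"
  proof (intro nn_integral_mono)
    fix y
    show "ennreal (\<bar>g y\<bar> * norm (K (x - y))) \<le> ennreal (\<bar>g y\<bar> * norm (K (x - y))) * indicator (ball x 1) y + ennreal \<bar>g y\<bar>"
    proof (cases "y \<in> ball x 1")
      case False
      then have "norm (x - y) \<ge> 1" by (simp add: dist_norm)
      then have "norm (K (x - y)) \<le> 1" by (simp add: norm_K divide_le_eq one_le_power)
      then have "\<bar>g y\<bar> * norm (K (x - y)) \<le> \<bar>g y\<bar> * 1" by (intro mult_left_mono) auto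
      then show ?thesis using False by (simp add: ennreal_leI)
    qed simp
  qed
  also have "\<dots> = (\<integral>\<^sup>+y\<in>ball x 1. ennreal (\<bar>g y\<bar> * norm (K (x - y))) \<partial>lborel) + (\<integral>\<^sup>+y. ennreal \<bar>g y\<bar> \<partial>lborel)"
  proof (rule nn_integral_add)
    show "(\<lambda>y. ennreal (\<bar>g y\<bar> * norm (K (x - y))) * indicator (ball x 1) y) \<in> borel_measurable lborel"
      by (intro borel_measurable_times_ennreal borel_measurable_indicator; measurable)
  qed measurable
  also have "\<dots> \<le> ennreal (near_const DIM('a) * (B * \<Theta> (DIM('a) + 1)) * 1 powr (1 - DIM('a) / (DIM('a) + 1))) + ennreal A"
    using B_pos \<Theta>_pos total_norm by (intro add_mono nn_integral_K_ball_le local_norm) auto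
  also have "\<dots> = ennreal field_bound"
    using near_const_nonneg A_nonneg B_pos \<Theta>_pos by (simp add: field_bound_def less_imp_le flip: ennreal_plus)
  finally show ?thesis .
qed

text \<open>The domain is split by the size of \<open>norm (x - z)\<close>. Below
  \<open>2 * r\<close> the two kernels are bounded separately, \<open>z\<close> being within
  \<open>3 * r\<close> of both points. Beyond, the mean value estimate applies: up to distance 1 the
  annulus gives the logarithm, and from there on the total mass suffices.\<close>

lemma nn_integral_K_diff_le:
  assumes r: "0 < r" "r < exp (- real DIM('a) - 1)" and xy: "norm (x - y) \<le> r"
  shows "(\<integral>\<^sup>+z. ennreal (\<bar>g z\<bar> * norm (K (x - z) - K (y - z))) \<partial>lborel)
    \<le> ennreal (modulus_const * (r * \<bar>ln r\<bar> * \<Theta> \<bar>ln r\<bar>))"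
proof -
  let ?V = "unit_ball_vol (real DIM('a))" and ?d = "real DIM('a)"
  define p where "p = \<bar>ln r\<bar>"
  define D where "D = 1 + ?d * 3 ^ (DIM('a) - 1)"
  define N where "N = B * \<Theta> p"
  have "ln r < - ?d - 1" using r ln_less_cancel_iff[of r "exp (- ?d - 1)"] by simp
  then have p: "p > ?d + 1" "ln r = - p" by (auto simp: p_def)
  have p1: "p \<ge> 1" using p by simp
  \<comment> \<open>The near balls must fit into the unit balls on which the local norm is given;
    \<open>d \<ge> 1\<close> yields \<open>r < exp (- 2)\<close>.\<close>
  have r1: "3 * r \<le> 1"
  proof -
    have "r < exp (- 2)" using r(2) DIM_ge_Suc0[where 'a='a] by (intro less_le_trans[OF r(2)]) auto
    moreover have "3 \<le> exp (2::real)" using exp_ge_add_one_self[of "2::real"] by simp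
    moreover have "r * exp 2 < exp (- 2) * exp 2" using calculation(1) by (rule mult_strict_right_mono) simp
    then have "r * exp 2 < 1" by (simp flip: exp_add)
    moreover have "r * 3 \<le> r * exp 2" using calculation(2) r(1) by (intro mult_left_mono) auto
    ultimately show ?thesis by simp
  qed
  have N: "N > 0" using B_pos \<Theta>_pos[of p] p1 by (simp add: N_def)
  have D: "D \<ge> 1" by (simp add: D_def)
  \<comment> \<open>The reason for the choice of \<open>p\<close>: the loss from the integrability
    exponent becomes a constant.\<close>
  have rp: "r powr (- ?d / p) = exp ?d"
    using r p p1 by (simp add: powr_def)
  have r3: "(3 * r) powr (1 - ?d / p) \<le> 3 * r * exp ?d"
  proof -
    have "(3 * r) powr (1 - ?d / p) = 3 powr (1 - ?d / p) * (r powr 1 * r powr (- ?d / p))"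
      using r by (simp only: powr_mult powr_add[symmetric]) (simp add: powr_mult)
    also have "\<dots> \<le> 3 powr 1 * (r powr 1 * r powr (- ?d / p))"
      using p1 by (intro mult_right_mono powr_mono) auto
    finally show ?thesis unfolding rp using r by simp
  qed
  define near where "near = near_const DIM('a) * N * (3 * r * exp ?d)"
  have near_nonneg: "near \<ge> 0" using near_const_nonneg N r by (simp add: near_def)
  have near_bound: "(\<integral>\<^sup>+z\<in>ball c (3 * r). ennreal (\<bar>g z\<bar> * norm (K (c - z))) \<partial>lborel) \<le> ennreal near" for c
  proof -
    have "(\<integral>\<^sup>+z\<in>ball c (3 * r). ennreal (\<bar>g z\<bar> * norm (K (c - z))) \<partial>lborel)
        \<le> ennreal (near_const DIM('a) * N * (3 * r) powr (1 - ?d / p))"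
      using p p1 r r1 N local_norm[OF p1] by (intro nn_integral_K_ball_le) (auto simp: N_def)
    also have "\<dots> \<le> ennreal near"
      unfolding near_def using r3 near_const_nonneg N by (intro ennreal_leI mult_left_mono) auto
    finally show ?thesis .
  qed
  have "r < 1" using r1 r by simp
  from dyadic_scale[OF r(1) this] obtain n where n: "1 / 2 ^ Suc n \<le> r" "r < 1 / 2 ^ n" .
  \<comment> \<open>\<open>ln 2 \<ge> 1 / 2\<close> gives \<open>n < 2 * p\<close>, and
    \<open>1 \<le> p\<close> absorbs the additional shell.\<close>
  have n3: "real n + 1 \<le> 3 * p"
  proof -
    have "ln r < ln (1 / 2 ^ n)" using r n(2) by (subst ln_less_cancel_iff) auto
    then have "real n * ln 2 < p" using p by (simp add: ln_div ln_realpow)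
    moreover have "real n * (1 / 2) \<le> real n * ln 2" using ln2_ge_two_thirds by (intro mult_left_mono) auto
    ultimately show ?thesis using p1 by simp
  qed
  define ann where "ann = 3 * p * (2 ^ DIM('a) * (?V + 1) * N * exp ?d)"
  have ann_bound: "(\<integral>\<^sup>+z\<in>ball x 1 - ball x r. ennreal (\<bar>g z\<bar> / norm (x - z) ^ DIM('a)) \<partial>lborel) \<le> ennreal ann"
  proof -
    have "(\<integral>\<^sup>+z\<in>ball x 1 - ball x r. ennreal (\<bar>g z\<bar> / norm (x - z) ^ DIM('a)) \<partial>lborel)
        \<le> ennreal ((real n + 1) * (2 ^ DIM('a) * (?V + 1) * N * r powr (- ?d / p)))"
      by (rule nn_integral_annulus_le[OF g_measurable p1 N r(1) n]) (use local_norm[OF p1] in \<open>simp add: N_def\<close>)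
    also have "\<dots> \<le> ennreal ann"
      unfolding ann_def rp using n3 N by (intro ennreal_leI mult_right_mono) auto
    finally show ?thesis .
  qed
  have ann_nonneg: "ann \<ge> 0" using N p1 by (simp add: ann_def)
  let ?k = "\<lambda>c z. ennreal (\<bar>g z\<bar> * norm (K (c - z))) * indicator (ball c (3 * r)) z"
  let ?a = "\<lambda>z. ennreal (\<bar>g z\<bar> / norm (x - z) ^ DIM('a)) * indicator (ball x 1 - ball x r) z"
  have "(\<integral>\<^sup>+z. ennreal (\<bar>g z\<bar> * norm (K (x - z) - K (y - z))) \<partial>lborel)
      \<le> (\<integral>\<^sup>+z. (?k x z + ?k y z) + ennreal (D * r) * (?a z + ennreal \<bar>g z\<bar>) \<partial>lborel)"
  proof (intro nn_integral_mono)
    fix z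
    show "ennreal (\<bar>g z\<bar> * norm (K (x - z) - K (y - z))) \<le> (?k x z + ?k y z) + ennreal (D * r) * (?a z + ennreal \<bar>g z\<bar>)"
    proof (cases "norm (x - z) < 2 * r")
      case True
      then have "norm (y - z) < 3 * r"
        using xy norm_triangle_ineq[of "y - x" "x - z"] by (simp add: norm_minus_commute)
      then have "z \<in> ball x (3 * r)" "z \<in> ball y (3 * r)" using True r by (auto simp: dist_norm)
      moreover have "\<bar>g z\<bar> * norm (K (x - z) - K (y - z)) \<le> \<bar>g z\<bar> * norm (K (x - z)) + \<bar>g z\<bar> * norm (K (y - z))"
        unfolding distrib_left[symmetric] by (intro mult_left_mono norm_triangle_ineq4) simp
      then have "ennreal (\<bar>g z\<bar> * norm (K (x - z) - K (y - z))) \<le> ennreal (\<bar>g z\<bar> * norm (K (x - z))) + ennreal (\<bar>g z\<bar> * norm (K (y - z)))"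
        by (simp flip: ennreal_plus add: ennreal_leI)
      ultimately have "ennreal (\<bar>g z\<bar> * norm (K (x - z) - K (y - z))) \<le> ?k x z + ?k y z" by simp
      then show ?thesis by (rule order.trans) simp
    next
      case False
      then have xz: "norm ((x - z) - (y - z)) \<le> norm (x - z) / 2" "norm (x - z) > 0" using xy r by auto
      then have "norm (K (x - z) - K (y - z)) \<le> D * norm (x - y) / norm (x - z) ^ DIM('a)"
        using norm_K_diff_le[of "x - z" "y - z"] by (simp add: D_def)
      also have "\<dots> \<le> D * r / norm (x - z) ^ DIM('a)"
        using xy D by (intro divide_right_mono mult_left_mono) auto
      finally have "\<bar>g z\<bar> * norm (K (x - z) - K (y - z)) \<le> \<bar>g z\<bar> * (D * r / norm (x - z) ^ DIM('a))"
        by (rule mult_left_mono) simp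
      then have le: "ennreal (\<bar>g z\<bar> * norm (K (x - z) - K (y - z))) \<le> ennreal (D * r) * ennreal (\<bar>g z\<bar> / norm (x - z) ^ DIM('a))"
        using D r by (simp flip: ennreal_mult add: ennreal_leI mult_ac)
      have "ennreal (\<bar>g z\<bar> / norm (x - z) ^ DIM('a)) \<le> ?a z + ennreal \<bar>g z\<bar>"
      proof (cases "norm (x - z) < 1")
        case True
        then have "z \<in> ball x 1 - ball x r" using False r by (auto simp: dist_norm)
        then show ?thesis by simp
      next
        case False
        then have "\<bar>g z\<bar> / norm (x - z) ^ DIM('a) \<le> \<bar>g z\<bar> / 1"
          using xz(2) by (intro divide_left_mono one_le_power) (auto intro!: mult_pos_pos zero_less_power)
        then have "ennreal (\<bar>g z\<bar> / norm (x - z) ^ DIM('a)) \<le> ennreal \<bar>g z\<bar>" by (simp add: ennreal_leI)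
        then show ?thesis by (rule order.trans) simp
      qed
      then have "ennreal (D * r) * ennreal (\<bar>g z\<bar> / norm (x - z) ^ DIM('a)) \<le> ennreal (D * r) * (?a z + ennreal \<bar>g z\<bar>)"
        by (rule mult_left_mono) simp
      with le have "ennreal (\<bar>g z\<bar> * norm (K (x - z) - K (y - z))) \<le> ennreal (D * r) * (?a z + ennreal \<bar>g z\<bar>)"
        by (rule order.trans)
      then show ?thesis by (rule order.trans) simp
    qed
  qed
  also have "\<dots> = ((\<integral>\<^sup>+z. ?k x z \<partial>lborel) + (\<integral>\<^sup>+z. ?k y z \<partial>lborel)) + ennreal (D * r) * ((\<integral>\<^sup>+z. ?a z \<partial>lborel) + (\<integral>\<^sup>+z. ennreal \<bar>g z\<bar> \<partial>lborel))"
  proof -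
    have k: "?k c \<in> borel_measurable lborel" for c
      by (intro borel_measurable_times_ennreal borel_measurable_indicator; measurable)
    have a: "?a \<in> borel_measurable lborel"
      by (intro borel_measurable_times_ennreal borel_measurable_indicator; measurable)
    have b: "(\<lambda>z. ennreal \<bar>g z\<bar>) \<in> borel_measurable lborel" by measurable
    note ab = borel_measurable_add[OF a b]
    show ?thesis
      using nn_integral_add[OF borel_measurable_add[OF k[of x] k[of y]] borel_measurable_times_ennreal[OF borel_measurable_const ab, of "ennreal (D * r)"]]
      by (simp only: nn_integral_add[OF k k] nn_integral_add[OF a b] nn_integral_cmult[OF ab])
  qed
  also have "\<dots> \<le> (ennreal near + ennreal near) + ennreal (D * r) * (ennreal ann + ennreal A)"
    by (intro add_mono mult_left_mono near_bound ann_bound total_norm) auto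
  also have "\<dots> = ennreal (2 * near + D * r * (ann + A))"
    using near_nonneg ann_nonneg A_nonneg D r by (simp flip: ennreal_plus ennreal_mult)
  also have "\<dots> \<le> ennreal (modulus_const * (r * p * \<Theta> p))"
  proof (rule ennreal_leI)
    have T: "0 < \<Theta> 0" "\<Theta> 0 \<le> \<Theta> p" using \<Theta>_pos \<Theta>_mono p1 by auto
    have "near \<le> near_const DIM('a) * N * (3 * r * exp ?d) * p"
      using near_nonneg p1 mult_left_mono[of 1 p near] by (simp add: near_def)
    \<comment> \<open>The far field is only of order \<open>r\<close>; it is absorbed into the
      modulus because \<open>p \<ge> 1\<close> and
      \<open>\<Theta> p \<ge> \<Theta> 0 > 0\<close>.\<close>
    moreover have "D * r * A \<le> D * A / \<Theta> 0 * (r * p * \<Theta> p)"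
    proof -
      have "1 \<le> p * (\<Theta> p / \<Theta> 0)" using p1 T by (intro mult_ge1_I) auto
      then have "D * r * A * 1 \<le> D * r * A * (p * (\<Theta> p / \<Theta> 0))"
        using D r A_nonneg by (intro mult_left_mono) auto
      then show ?thesis by (simp add: mult_ac)
    qed
    ultimately have "2 * near + D * r * (ann + A)
        \<le> 2 * (near_const DIM('a) * N * (3 * r * exp ?d) * p) + D * r * ann + D * A / \<Theta> 0 * (r * p * \<Theta> p)"
      by (simp add: distrib_left)
    also have "\<dots> = modulus_const * (r * p * \<Theta> p)"
    proof -
      have "modulus_const = exp ?d * B * (6 * near_const DIM('a) + 3 * D * 2 ^ DIM('a) * (?V + 1)) + D * A / \<Theta> 0"
        by (simp add: modulus_const_def D_def)
      then show ?thesis by (simp add: ann_def N_def algebra_simps)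
    qed
    finally show "2 * near + D * r * (ann + A) \<le> modulus_const * (r * p * \<Theta> p)" .
  qed
  finally show ?thesis by (simp add: p_def)
qed

lemma integrable_K: "integrable lborel (\<lambda>y. g y *\<^sub>R K (x - y))"
proof (rule integrableI_bounded)
  have "(\<integral>\<^sup>+y. ennreal (norm (g y *\<^sub>R K (x - y))) \<partial>lborel) \<le> ennreal field_bound"
    using nn_integral_K_le[of x] by simp
  then show "(\<integral>\<^sup>+y. ennreal (norm (g y *\<^sub>R K (x - y))) \<partial>lborel) < \<infinity>"
    using ennreal_less_top le_less_trans by fastforce
qed simp

lemma norm_field_le: "norm (\<integral>y. g y *\<^sub>R K (x - y) \<partial>lborel) \<le> field_bound"
proof -
  have "ennreal (norm (\<integral>y. g y *\<^sub>R K (x - y) \<partial>lborel)) \<le> (\<integral>\<^sup>+y. ennreal (norm (g y *\<^sub>R K (x - y))) \<partial>lborel)"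
    by (rule integral_norm_bound_ennreal[OF integrable_K])
  also have "\<dots> \<le> ennreal field_bound" using nn_integral_K_le[of x] by simp
  finally show ?thesis using field_bound_nonneg by simp
qed

lemma norm_field_diff_le:
  assumes r: "0 < r" "r < exp (- real DIM('a) - 1)" and xy: "norm (x - y) \<le> r"
  shows "norm ((\<integral>z. g z *\<^sub>R K (x - z) \<partial>lborel) - (\<integral>z. g z *\<^sub>R K (y - z) \<partial>lborel))
    \<le> modulus_const * phi DIM('a) \<Theta> r"
proof -
  have "(\<integral>z. g z *\<^sub>R K (x - z) \<partial>lborel) - (\<integral>z. g z *\<^sub>R K (y - z) \<partial>lborel)
      = (\<integral>z. g z *\<^sub>R (K (x - z) - K (y - z)) \<partial>lborel)"
    by (simp add: scaleR_diff_right integrable_K)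
  also have "ennreal (norm \<dots>) \<le> (\<integral>\<^sup>+z. ennreal (norm (g z *\<^sub>R (K (x - z) - K (y - z)))) \<partial>lborel)"
    by (rule integral_norm_bound_ennreal) (simp add: scaleR_diff_right integrable_K)
  also have "\<dots> \<le> ennreal (modulus_const * (r * \<bar>ln r\<bar> * \<Theta> \<bar>ln r\<bar>))"
    using nn_integral_K_diff_le[OF assms] by simp
  finally show ?thesis
    using r modulus_const_nonneg \<Theta>_pos[of "\<bar>ln r\<bar>"] by (simp add: phi_def)
qed

end

section \<open>Second-order equations with bounded measurable forces\<close>

text \<open>The Cauchy problem in integral form, which is stable under pointwise limits. The final
  time \<tau> is a parameter because the flow at time \<tau> is inverted by running the reversed
  equation on \<open>{0..\<tau>}\<close>.\<close>

definition trajectory ::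
    "(real \<Rightarrow> 'a::euclidean_space \<Rightarrow> 'a) \<Rightarrow> real \<Rightarrow> 'a \<Rightarrow> 'a \<Rightarrow> (real \<Rightarrow> 'a) \<Rightarrow> (real \<Rightarrow> 'a) \<Rightarrow> bool" where
  "trajectory E \<tau> x v X V \<longleftrightarrow>
     continuous_on {0..\<tau>} X \<and> continuous_on {0..\<tau>} V \<and>
     (\<forall>t\<in>{0..\<tau>}. X t = x + integral {0..t} V \<and> V t = v + integral {0..t} (\<lambda>s. E s (X s)))"

lemma trajectory_subinterval:
  "trajectory E \<tau> x v X V \<Longrightarrow> \<sigma> \<le> \<tau> \<Longrightarrow> trajectory E \<sigma> x v X V"
  unfolding trajectory_def by (auto intro: continuous_on_subset)

lemma lipschitz_indefinite_integral:
  fixes F f :: "real \<Rightarrow> 'a::euclidean_space"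
  assumes "\<And>t. t \<in> {0..\<tau>} \<Longrightarrow> F t = c + integral {0..t} f"
    and f: "f integrable_on {0..\<tau>}" and bound: "\<And>t. t \<in> {0..\<tau>} \<Longrightarrow> norm (f t) \<le> B" and "B \<ge> 0"
    and "s \<in> {0..\<tau>}" "t \<in> {0..\<tau>}"
  shows "norm (F t - F s) \<le> B * \<bar>t - s\<bar>"
proof -
  have *: "norm (F t - F s) \<le> B * (t - s)" if "0 \<le> s" "s \<le> t" "t \<le> \<tau>" for s t
  proof -
    have int: "f integrable_on {x..y}" if "0 \<le> x" "y \<le> \<tau>" for x y
      using that by (intro integrable_on_subinterval[OF f]) auto
    have "integral {0..s} f + integral {s..t} f = integral {0..t} f"
      using that by (intro Henstock_Kurzweil_Integration.integral_combine int) auto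
    then have "F t - F s = integral {s..t} f" using assms(1) that by (simp add: algebra_simps flip: add_diff_eq)
    moreover have "norm (integral {s..t} f) \<le> B * (t - s)"
    proof -
      have "norm (integral {s..t} f) \<le> integral {s..t} (\<lambda>_. B)"
        using that bound by (intro integral_norm_bound_integral int) auto
      then show ?thesis using that by (simp add: mult.commute)
    qed
    ultimately show ?thesis by simp
  qed
  show ?thesis
    using *[of s t] *[of t s] assms(5,6) by (cases "s \<le> t") (auto simp: norm_minus_commute)
qed

text \<open>What the dynamics needs from the density. The bounds are required at every real time, so
  that the reversed field \<open>\<lambda>s. E (\<tau> - s)\<close> satisfies the same assumptions
  with the same constants.\<close>

locale force_field =
  fixes E :: "real \<Rightarrow> 'a::euclidean_space \<Rightarrow> 'a" and M C :: real and \<phi> :: "real \<Rightarrow> real"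
  assumes E_measurable: "case_prod E \<in> borel_measurable borel"
    and E_bound: "\<And>t x. norm (E t x) \<le> M"
    and E_modulus: "\<And>t x y r. \<lbrakk>0 < r; norm (x - y) \<le> r\<rbrakk> \<Longrightarrow> norm (E t x - E t y) \<le> C * \<phi> r"
    and C_pos: "C > 0"
    and \<phi>_cont: "continuous_on {0..} \<phi>" and \<phi>_0: "\<phi> 0 = 0" and \<phi>_pos: "\<And>r. r > 0 \<Longrightarrow> \<phi> r > 0"
begin

lemma M_nonneg: "M \<ge> 0"
  using E_bound[of undefined undefined] norm_ge_zero order_trans by blast

lemma small_modulus:
  assumes "e > 0" obtains r where "r > 0" "C * \<phi> r < e"
proof -
  have "continuous (at 0 within {0..}) \<phi>" using \<phi>_cont by (simp add: continuous_on_eq_continuous_within)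
  then obtain d where d: "d > 0" "\<And>x. x \<ge> 0 \<Longrightarrow> dist x 0 < d \<Longrightarrow> dist (\<phi> x) (\<phi> 0) < e / C"
    unfolding continuous_within_eps_delta using assms C_pos by (metis atLeast_iff divide_pos_pos)
  from d(2)[of "d / 2"] d(1) C_pos \<phi>_pos[of "d / 2"] show ?thesis
    by (intro that[of "d / 2"]) (auto simp: \<phi>_0 field_simps)
qed

lemma E_continuous: "continuous_on UNIV (E t)"
  unfolding continuous_on_iff
proof (intro ballI allI impI)
  fix x and e :: real assume "e > 0"
  then obtain r where r: "r > 0" "C * \<phi> r < e" by (rule small_modulus)
  show "\<exists>d>0. \<forall>x'\<in>UNIV. dist x' x < d \<longrightarrow> dist (E t x') (E t x) < e"
  proof (intro exI[of _ r] conjI ballI impI r)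
    fix x' assume "dist x' x < r"
    then have "norm (E t x' - E t x) \<le> C * \<phi> r" using r by (intro E_modulus) (auto simp: dist_norm)
    with r show "dist (E t x') (E t x) < e" by (simp add: dist_norm)
  qed
qed

lemma E_tendsto: "y \<longlonglongrightarrow> x \<Longrightarrow> (\<lambda>n. E t (y n)) \<longlonglongrightarrow> E t x"
  using continuous_on_tendsto_compose[OF E_continuous[of t]] by simp

text \<open>The curve is only required to be measurable because the scheme evaluates the force along
  a step function.\<close>

lemma E_integrable:
  assumes y: "y \<in> borel_measurable (lebesgue_on {a..b})"
  shows "(\<lambda>s. E s (y s)) integrable_on {a..b}"
proof (rule measurable_bounded_by_integrable_imp_integrable[where g = "\<lambda>_. M"])
  have "(\<lambda>s. s) \<in> borel_measurable (lebesgue_on {a..b})"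
    by (intro measurable_restrict_space1 measurable_completion) simp
  then have "(\<lambda>s. (s, y s)) \<in> borel_measurable (lebesgue_on {a..b})"
    using y by (rule borel_measurable_Pair)
  from measurable_compose[OF this E_measurable]
  show "(\<lambda>s. E s (y s)) \<in> borel_measurable (lebesgue_on {a..b})" by simp
qed (auto simp: E_bound)

lemma E_integrable_continuous:
  "continuous_on {a..b} y \<Longrightarrow> (\<lambda>s. E s (y s)) integrable_on {a..b}"
  by (intro E_integrable continuous_imp_measurable_on_sets_lebesgue) auto

text \<open>From left to right this is the fundamental theorem of calculus for Lipschitz curves.
  Conversely, \<open>X\<close> is differentiable in the interior since \<open>V\<close> is
  continuous, whereas for \<open>V\<close> the almost everywhere differentiability of an indefinite
  integral is needed: the force along the curve is merely bounded and measurable.\<close>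

lemma solution_iff_trajectory:
  assumes "\<tau> > 0"
  shows "solution \<tau> E x v X V \<longleftrightarrow> trajectory E \<tau> x v X V"
proof
  assume sol: "solution \<tau> E x v X V"
  then obtain L where L: "L-lipschitz_on {0..\<tau>} (\<lambda>t. (X t, V t))" by (auto simp: solution_def)
  have L0: "L \<ge> 0" using L by (rule lipschitz_on_nonneg)
  have lipX: "L-lipschitz_on {0..\<tau>} X" and lipV: "L-lipschitz_on {0..\<tau>} V"
  proof -
    show "L-lipschitz_on {0..\<tau>} X"
      by (rule lipschitz_onI[OF _ L0], rule order.trans[OF _ lipschitz_onD[OF L]])
        (use dist_fst_le[of "(X _, V _)" "(X _, V _)"] in simp_all)
    show "L-lipschitz_on {0..\<tau>} V"
      by (rule lipschitz_onI[OF _ L0], rule order.trans[OF _ lipschitz_onD[OF L]])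
        (use dist_snd_le[of "(X _, V _)" "(X _, V _)"] in simp_all)
  qed
  have ae: "AE t in lebesgue. t \<in> {0<..<\<tau>} \<longrightarrow> (X has_vector_derivative V t) (at t)"
    "AE t in lebesgue. t \<in> {0<..<\<tau>} \<longrightarrow> (V has_vector_derivative E t (X t)) (at t)"
    using sol by (simp_all add: solution_def AE_restrict_space_iff)
  have "X t = x + integral {0..t} V \<and> V t = v + integral {0..t} (\<lambda>s. E s (X s))" if t: "t \<in> {0..\<tau>}" for t
  proof -
    have "AE s in lebesgue_on {0<..<t}. (X has_vector_derivative V s) (at s)"
      "AE s in lebesgue_on {0<..<t}. (V has_vector_derivative E s (X s)) (at s)"
      using ae t by (auto simp: AE_restrict_space_iff elim: eventually_mono)
    moreover have "L-lipschitz_on {0..t} X" "L-lipschitz_on {0..t} V"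
      using lipX lipV t by (auto intro: lipschitz_on_subset)
    ultimately have "(V has_integral (X t - X 0)) {0..t}" "((\<lambda>s. E s (X s)) has_integral (V t - V 0)) {0..t}"
      using t by (auto intro!: lipschitz_has_integral_ae_derivative)
    then show ?thesis using sol by (auto simp: solution_def has_integral_iff)
  qed
  moreover have "continuous_on {0..\<tau>} X" "continuous_on {0..\<tau>} V"
    using lipX lipV lipschitz_on_continuous_on by auto
  ultimately show "trajectory E \<tau> x v X V" by (simp add: trajectory_def)
next
  assume tr: "trajectory E \<tau> x v X V"
  then have cont: "continuous_on {0..\<tau>} X" "continuous_on {0..\<tau>} V"
    and Xeq: "\<And>t. t \<in> {0..\<tau>} \<Longrightarrow> X t = x + integral {0..t} V"
    and Veq: "\<And>t. t \<in> {0..\<tau>} \<Longrightarrow> V t = v + integral {0..t} (\<lambda>s. E s (X s))"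
    by (auto simp: trajectory_def)
  have Eint: "(\<lambda>s. E s (X s)) integrable_on {0..\<tau>}" by (rule E_integrable_continuous[OF cont(1)])
  have Vint: "V integrable_on {0..\<tau>}" by (rule integrable_continuous_real[OF cont(2)])
  obtain B where B: "B > 0" "\<And>t. t \<in> {0..\<tau>} \<Longrightarrow> norm (V t) \<le> B"
    using compact_imp_bounded[OF compact_continuous_image[OF cont(2)]] by (auto simp: bounded_pos)
  have "(B + M)-lipschitz_on {0..\<tau>} (\<lambda>t. (X t, V t))"
  proof (rule lipschitz_onI)
    fix s t assume st: "s \<in> {0..\<tau>}" "t \<in> {0..\<tau>}"
    have "dist (X s, V s) (X t, V t) \<le> norm (X s - X t) + norm (V s - V t)"
      unfolding dist_norm using norm_Pair_le[of "X s - X t" "V s - V t"] by simp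
    also have "\<dots> \<le> B * \<bar>s - t\<bar> + M * \<bar>s - t\<bar>"
      using st B E_bound M_nonneg
      by (intro add_mono lipschitz_indefinite_integral[OF Xeq Vint] lipschitz_indefinite_integral[OF Veq Eint]) auto
    finally show "dist (X s, V s) (X t, V t) \<le> (B + M) * dist s t" by (simp add: dist_real_def algebra_simps)
  qed (use B M_nonneg in auto)
  moreover have "X 0 = x" "V 0 = v" using Xeq[of 0] Veq[of 0] \<open>\<tau> > 0\<close> by auto
  moreover have "AE t in lebesgue_on {0<..<\<tau>}. (X has_vector_derivative V t) (at t) \<and> (V has_vector_derivative E t (X t)) (at t)"
    using indefinite_integral_ae_derivative[OF Eint] AE_space
  proof eventually_elim
    case (elim t)
    then have t: "t \<in> {0<..<\<tau>}" by simp
    have "((\<lambda>t. integral {0..t} V) has_vector_derivative V t) (at t within {0..\<tau>})"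
      using t by (intro integral_has_vector_derivative cont) auto
    moreover have "at t within {0..\<tau>} = at t" using t by (intro at_within_interior) auto
    ultimately have "((\<lambda>t. x + integral {0..t} V) has_vector_derivative V t) (at t)"
      by (auto intro!: derivative_eq_intros)
    then have "(X has_vector_derivative V t) (at t)"
      by (rule has_vector_derivative_transform_within_open[of _ _ _ "{0<..<\<tau>}"]) (use t Xeq in auto)
    moreover have "((\<lambda>t. v + integral {0..t} (\<lambda>s. E s (X s))) has_vector_derivative E t (X t)) (at t)"
      using elim by (auto intro!: derivative_eq_intros)
    then have "(V has_vector_derivative E t (X t)) (at t)"
      by (rule has_vector_derivative_transform_within_open[of _ _ _ "{0<..<\<tau>}"]) (use t Veq in auto)
    ultimately show ?case ..
  qed
  ultimately show "solution \<tau> E x v X V" by (auto simp: solution_def)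
qed

text \<open>Separating the curve \<open>yn\<close>, along which the force is evaluated, from the
  position \<open>Xn\<close> lets one statement serve both the scheme, where \<open>yn\<close> is a
  step function, and continuous dependence on the data, where \<open>yn = Xn\<close>. Positions and
  velocities are equi-Lipschitz, and since each \<open>E t\<close> is continuous the force passes to
  the limit by dominated convergence.\<close>

lemma approximate_trajectories_compact:
  fixes Xn Vn yn :: "nat \<Rightarrow> real \<Rightarrow> 'a"
  assumes "\<tau> \<ge> 0"
    and Xn: "\<And>n t. t \<in> {0..\<tau>} \<Longrightarrow> Xn n t = xn n + integral {0..t} (Vn n)"
    and Vn: "\<And>n t. t \<in> {0..\<tau>} \<Longrightarrow> Vn n t = vn n + integral {0..t} (\<lambda>s. E s (yn n s))"
    and yn: "\<And>n. yn n \<in> borel_measurable (lebesgue_on {0..\<tau>})"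
    and close: "\<And>n t. t \<in> {0..\<tau>} \<Longrightarrow> norm (Xn n t - yn n t) \<le> e n" and e: "e \<longlonglongrightarrow> 0"
    and xn: "xn \<longlonglongrightarrow> x" and vn: "vn \<longlonglongrightarrow> v"
  obtains r X V where "strict_mono (r :: nat \<Rightarrow> nat)" "trajectory E \<tau> x v X V"
    "\<And>t. t \<in> {0..\<tau>} \<Longrightarrow> (\<lambda>n. Xn (r n) t) \<longlonglongrightarrow> X t"
    "\<And>t. t \<in> {0..\<tau>} \<Longrightarrow> (\<lambda>n. Vn (r n) t) \<longlonglongrightarrow> V t"
proof -
  obtain Bx where Bx: "\<And>n. norm (xn n) \<le> Bx" using convergent_imp_Bseq[OF convergentI[OF xn]] by (auto simp: Bseq_def)
  obtain Bv where Bv: "\<And>n. norm (vn n) \<le> Bv" using convergent_imp_Bseq[OF convergentI[OF vn]] by (auto simp: Bseq_def)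
  define B where "B = Bv + M * \<tau>"
  have Eint: "(\<lambda>s. E s (yn n s)) integrable_on {0..\<tau>}" for n by (rule E_integrable[OF yn])
  have Vlip: "norm (Vn n t - Vn n s) \<le> M * \<bar>t - s\<bar>" if "s \<in> {0..\<tau>}" "t \<in> {0..\<tau>}" for n s t
    using that E_bound M_nonneg by (intro lipschitz_indefinite_integral[OF Vn Eint]) auto
  have Vcont: "continuous_on {0..\<tau>} (Vn n)" for n
    by (rule lipschitz_on_continuous_on[of M], rule lipschitz_onI) (use Vlip M_nonneg in \<open>auto simp: dist_norm\<close>)
  have Vb: "norm (Vn n t) \<le> B" if t: "t \<in> {0..\<tau>}" for n t
  proof -
    have "norm (Vn n t) \<le> norm (Vn n 0) + norm (Vn n t - Vn n 0)" by (metis add.commute diff_add_cancel norm_triangle_ineq)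
    also have "\<dots> \<le> Bv + M * \<tau>"
      using Vlip[of 0 t n] Bv[of n] Vn[of 0 n] t M_nonneg mult_left_mono[of t \<tau> M] by auto
    finally show ?thesis by (simp add: B_def)
  qed
  have B0: "B \<ge> 0" using order.trans[OF norm_ge_zero Vb[of 0 0]] \<open>\<tau> \<ge> 0\<close> by simp
  have Vint: "Vn n integrable_on {0..\<tau>}" for n by (rule integrable_continuous_real[OF Vcont])
  have Xlip: "norm (Xn n t - Xn n s) \<le> B * \<bar>t - s\<bar>" if "s \<in> {0..\<tau>}" "t \<in> {0..\<tau>}" for n s t
    using that Vb B0 by (intro lipschitz_indefinite_integral[OF Xn Vint]) auto
  have Xb: "norm (Xn n t) \<le> Bx + B * \<tau>" if t: "t \<in> {0..\<tau>}" for n t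
  proof -
    have "norm (Xn n t) \<le> norm (Xn n 0) + norm (Xn n t - Xn n 0)" by (metis add.commute diff_add_cancel norm_triangle_ineq)
    also have "\<dots> \<le> Bx + B * \<tau>"
      using Xlip[of 0 t n] Bx[of n] Xn[of 0 n] t B0 mult_left_mono[of t \<tau> B] by auto
    finally show ?thesis .
  qed
  define F where "F n t = (Xn n t, Vn n t)" for n t
  have Flip: "norm (F n t - F n s) \<le> (B + M) * \<bar>t - s\<bar>" if "s \<in> {0..\<tau>}" "t \<in> {0..\<tau>}" for n s t
    using norm_Pair_le[of "Xn n t - Xn n s" "Vn n t - Vn n s"] Xlip[OF that, of n] Vlip[OF that, of n]
    by (simp add: F_def algebra_simps)
  obtain g r where g: "continuous_on {0..\<tau>} g" "strict_mono (r :: nat \<Rightarrow> nat)"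
    and lim: "\<And>e. 0 < e \<Longrightarrow> \<exists>N. \<forall>n t. n \<ge> N \<and> t \<in> {0..\<tau>} \<longrightarrow> norm (F (r n) t - g t) < e"
  proof (rule Arzela_Ascoli[of "{0..\<tau>}" F "(Bx + B * \<tau>) + B"])
    show "norm (F n t) \<le> (Bx + B * \<tau>) + B" if "t \<in> {0..\<tau>}" for n t
      using norm_Pair_le[of "Xn n t" "Vn n t"] Xb[OF that, of n] Vb[OF that, of n] by (simp add: F_def)
  next
    fix t and e :: real assume t: "t \<in> {0..\<tau>}" and e: "0 < e"
    show "\<exists>d>0. \<forall>n s. s \<in> {0..\<tau>} \<and> norm (t - s) < d \<longrightarrow> norm (F n t - F n s) < e"
    \<comment> \<open>The additional 1 keeps the quotient meaningful when
      \<open>B + M = 0\<close>.\<close>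
    proof (intro exI[of _ "e / (B + M + 1)"] conjI allI impI)
      show "0 < e / (B + M + 1)" using e B0 M_nonneg by simp
      fix n s assume s: "s \<in> {0..\<tau>} \<and> norm (t - s) < e / (B + M + 1)"
      have "norm (F n t - F n s) \<le> (B + M) * \<bar>t - s\<bar>" using t s by (intro Flip) auto
      also have "\<dots> \<le> (B + M + 1) * \<bar>t - s\<bar>" by (intro mult_right_mono) auto
      also have "\<dots> < e" using s B0 M_nonneg by (simp add: field_simps)
      finally show "norm (F n t - F n s) < e" .
    qed
  qed auto
  have Flim: "(\<lambda>n. F (r n) t) \<longlonglongrightarrow> g t" if "t \<in> {0..\<tau>}" for t
    using lim that unfolding LIMSEQ_iff by meson
  define X V where "X t = fst (g t)" and "V t = snd (g t)" for t
  have Xlim: "(\<lambda>n. Xn (r n) t) \<longlonglongrightarrow> X t" and Vlim: "(\<lambda>n. Vn (r n) t) \<longlonglongrightarrow> V t" if "t \<in> {0..\<tau>}" for t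
    using tendsto_fst[OF Flim[OF that]] tendsto_snd[OF Flim[OF that]] by (simp_all add: F_def X_def V_def)
  have ylim: "(\<lambda>n. yn (r n) t) \<longlonglongrightarrow> X t" if t: "t \<in> {0..\<tau>}" for t
  proof -
    have "(\<lambda>n. e (r n)) \<longlonglongrightarrow> 0" using LIMSEQ_subseq_LIMSEQ[OF e g(2)] by (simp add: o_def)
    then have "(\<lambda>n. Xn (r n) t - yn (r n) t) \<longlonglongrightarrow> 0"
      by (rule Lim_null_comparison[rotated]) (use close[OF t] in auto)
    from tendsto_diff[OF Xlim[OF t] this] show ?thesis by simp
  qed
  have "trajectory E \<tau> x v X V"
    unfolding trajectory_def
  proof (intro conjI ballI)
    show "continuous_on {0..\<tau>} X" "continuous_on {0..\<tau>} V"
      using g(1) by (auto simp: X_def V_def intro!: continuous_intros)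
    fix t assume t: "t \<in> {0..\<tau>}"
    have "(\<lambda>n. integral {0..t} (Vn (r n))) \<longlonglongrightarrow> integral {0..t} V"
      by (rule dominated_convergence(2)[where h = "\<lambda>_. B"])
        (use t Vb Vlim integrable_on_subinterval[OF Vint] in auto)
    moreover have "(\<lambda>n. xn (r n)) \<longlonglongrightarrow> x" using LIMSEQ_subseq_LIMSEQ[OF xn g(2)] by (simp add: o_def)
    ultimately have "(\<lambda>n. xn (r n) + integral {0..t} (Vn (r n))) \<longlonglongrightarrow> x + integral {0..t} V"
      by (intro tendsto_add)
    then have "(\<lambda>n. Xn (r n) t) \<longlonglongrightarrow> x + integral {0..t} V" using Xn[OF t] by simp
    with Xlim[OF t] show "X t = x + integral {0..t} V" by (rule LIMSEQ_unique)
    have "(\<lambda>n. integral {0..t} (\<lambda>s. E s (yn (r n) s))) \<longlonglongrightarrow> integral {0..t} (\<lambda>s. E s (X s))"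
      by (rule dominated_convergence(2)[where h = "\<lambda>_. M"])
        (use t E_bound ylim E_tendsto integrable_on_subinterval[OF Eint] in auto)
    moreover have "(\<lambda>n. vn (r n)) \<longlonglongrightarrow> v" using LIMSEQ_subseq_LIMSEQ[OF vn g(2)] by (simp add: o_def)
    ultimately have "(\<lambda>n. vn (r n) + integral {0..t} (\<lambda>s. E s (yn (r n) s))) \<longlonglongrightarrow> v + integral {0..t} (\<lambda>s. E s (X s))"
      by (intro tendsto_add)
    then have "(\<lambda>n. Vn (r n) t) \<longlonglongrightarrow> v + integral {0..t} (\<lambda>s. E s (X s))" using Vn[OF t] by simp
    with Vlim[OF t] show "V t = v + integral {0..t} (\<lambda>s. E s (X s))" by (rule LIMSEQ_unique)
  qed
  from that[OF g(2) this Xlim Vlim] show ?thesis .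
qed

lemma reversed_force_field: "force_field (\<lambda>s. E (\<tau> - s)) M C \<phi>"
proof
  have "(\<lambda>p. (\<tau> - fst p, snd p)) \<in> borel_measurable (borel :: (real \<times> 'a) measure)"
    by (intro borel_measurable_continuous_onI continuous_intros)
  from measurable_compose[OF this E_measurable]
  show "(\<lambda>(s, x). E (\<tau> - s) x) \<in> borel_measurable borel" by (simp add: case_prod_beta)
qed (use E_bound E_modulus C_pos \<phi>_cont \<phi>_0 \<phi>_pos in auto)

text \<open>Time reversal changes the sign of the velocity, and the two sign changes in the
  acceleration cancel, so the reversed curve is again driven by a force of position and
  time.\<close>

lemma trajectory_reversed:
  assumes tr: "trajectory E \<tau> x v X V"
  shows "trajectory (\<lambda>s. E (\<tau> - s)) \<tau> (X \<tau>) (- V \<tau>) (\<lambda>s. X (\<tau> - s)) (\<lambda>s. - V (\<tau> - s))"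
proof -
  from tr have cont: "continuous_on {0..\<tau>} X" "continuous_on {0..\<tau>} V"
    and Xeq: "\<And>t. t \<in> {0..\<tau>} \<Longrightarrow> X t = x + integral {0..t} V"
    and Veq: "\<And>t. t \<in> {0..\<tau>} \<Longrightarrow> V t = v + integral {0..t} (\<lambda>s. E s (X s))"
    by (auto simp: trajectory_def)
  have rev: "integral {0..t} (\<lambda>s. f (\<tau> - s)) = F \<tau> - F (\<tau> - t)"
    if t: "t \<in> {0..\<tau>}" and f: "f integrable_on {0..\<tau>}" and F: "\<And>t. t \<in> {0..\<tau>} \<Longrightarrow> F t = c + integral {0..t} f"
    for t c and f F :: "real \<Rightarrow> 'a"
  proof -
    have int: "f integrable_on {x..y}" if "0 \<le> x" "y \<le> \<tau>" for x y
      using that by (intro integrable_on_subinterval[OF f]) auto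
    have "((\<lambda>s. f (\<tau> - s)) has_integral integral {\<tau> - t..\<tau>} f) {\<tau> - \<tau>..\<tau> - (\<tau> - t)}"
      using t by (intro reflect_has_integral integrable_integral int) auto
    moreover have "integral {0..\<tau> - t} f + integral {\<tau> - t..\<tau>} f = integral {0..\<tau>} f"
      using t by (intro Henstock_Kurzweil_Integration.integral_combine int) auto
    then have "integral {\<tau> - t..\<tau>} f = F \<tau> - F (\<tau> - t)"
      using F[of \<tau>] F[of "\<tau> - t"] t by (simp add: algebra_simps flip: add_diff_eq)
    ultimately show ?thesis by (simp add: has_integral_iff)
  qed
  have sub: "continuous_on {0..\<tau>} (\<lambda>s. f (\<tau> - s))" if "continuous_on {0..\<tau>} f" for f :: "real \<Rightarrow> 'a"
    by (rule continuous_on_compose2[OF that]) (auto intro!: continuous_intros)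
  show ?thesis
    unfolding trajectory_def
  proof (intro conjI ballI)
    show "continuous_on {0..\<tau>} (\<lambda>s. X (\<tau> - s))" "continuous_on {0..\<tau>} (\<lambda>s. - V (\<tau> - s))"
      using cont by (auto intro!: sub continuous_intros)
    fix t assume t: "t \<in> {0..\<tau>}"
    show "X (\<tau> - t) = X \<tau> + integral {0..t} (\<lambda>s. - V (\<tau> - s))"
      using rev[OF t integrable_continuous_real[OF cont(2)] Xeq] by simp
    show "- V (\<tau> - t) = - V \<tau> + integral {0..t} (\<lambda>s. E (\<tau> - s) (X (\<tau> - s)))"
      using rev[OF t E_integrable_continuous[OF cont(1)] Veq] by simp
  qed
qed

end

section \<open>Uniqueness under the Osgood condition and its consequence for approximations\<close>

locale osgood_force_field = force_field +
  assumes osgood: "diverges_at_0 (\<lambda>r. 1 / sqrt (integral {0..r} \<phi>))"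
begin

lemma trajectory_unique:
  assumes tr: "trajectory E \<tau> x v X V" and tr': "trajectory E \<tau> x v X' V'" and t: "t \<in> {0..\<tau>}"
  shows "X t = X' t \<and> V t = V' t"
proof -
  from tr tr' have cont: "continuous_on {0..\<tau>} X" "continuous_on {0..\<tau>} V" "continuous_on {0..\<tau>} X'" "continuous_on {0..\<tau>} V'"
    and eq: "\<And>t. t \<in> {0..\<tau>} \<Longrightarrow> X t = x + integral {0..t} V" "\<And>t. t \<in> {0..\<tau>} \<Longrightarrow> X' t = x + integral {0..t} V'"
     "\<And>t. t \<in> {0..\<tau>} \<Longrightarrow> V t = v + integral {0..t} (\<lambda>s. E s (X s))"
     "\<And>t. t \<in> {0..\<tau>} \<Longrightarrow> V' t = v + integral {0..t} (\<lambda>s. E s (X' s))"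
    by (auto simp: trajectory_def)
  define h where "h s = norm (E s (X s) - E s (X' s))" for s
  define u where "u t = integral {0..t} h" for t
  define w where "w t = integral {0..t} u" for t
  have Ediff: "(\<lambda>s. E s (X s) - E s (X' s)) integrable_on {0..\<tau>}"
    using E_integrable_continuous cont by (intro integrable_diff) auto
  have hint: "h integrable_on {0..\<tau>}"
  proof -
    have "(\<lambda>s. E s (X s) - E s (X' s)) absolutely_integrable_on {0..\<tau>}"
    proof (rule absolutely_integrable_integrable_bound[where g = "\<lambda>_. M + M"])
      show "norm (E s (X s) - E s (X' s)) \<le> M + M" for s
        by (rule order.trans[OF norm_triangle_ineq4 add_mono[OF E_bound E_bound]])
    qed (use Ediff in auto)
    then show ?thesis unfolding h_def by (simp add: absolutely_integrable_on_def)
  qed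
  have uint: "u integrable_on {0..\<tau>}"
    unfolding u_def by (intro integrable_continuous_real indefinite_integral_continuous_1 hint)
  have Vu: "norm (V t - V' t) \<le> u t" if t: "t \<in> {0..\<tau>}" for t
  proof -
    have "V t - V' t = integral {0..t} (\<lambda>s. E s (X s) - E s (X' s))"
      using t by (subst Henstock_Kurzweil_Integration.integral_diff)
        (auto simp: eq intro!: E_integrable_continuous continuous_on_subset[OF cont(1)] continuous_on_subset[OF cont(3)])
    also have "norm \<dots> \<le> integral {0..t} h"
      using t by (intro integral_norm_bound_integral integrable_on_subinterval[OF Ediff] integrable_on_subinterval[OF hint])
        (auto simp: h_def)
    finally show ?thesis by (simp add: u_def)
  qed
  have Xw: "norm (X t - X' t) \<le> w t" if t: "t \<in> {0..\<tau>}" for t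
  proof -
    have Vi: "V integrable_on {0..t}" "V' integrable_on {0..t}"
      using t by (auto intro!: integrable_continuous_real continuous_on_subset[OF cont(2)] continuous_on_subset[OF cont(4)])
    have "X t - X' t = integral {0..t} (\<lambda>s. V s - V' s)"
      using t by (subst Henstock_Kurzweil_Integration.integral_diff[OF Vi]) (auto simp: eq)
    also have "norm \<dots> \<le> integral {0..t} u"
      using t Vu by (intro integral_norm_bound_integral integrable_diff Vi integrable_on_subinterval[OF uint]) auto
    finally show ?thesis by (simp add: w_def)
  qed
  have hw: "h t \<le> C * \<phi> (w t)" if t: "t \<in> {0..\<tau>}" for t
  \<comment> \<open>\<open>E_modulus\<close> asks for a positive radius; when \<open>w t = 0\<close>
    the two positions coincide and \<open>h t\<close> vanishes.\<close>
  proof (cases "w t > 0")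
    case True
    then show ?thesis unfolding h_def by (intro E_modulus Xw t)
  next
    case False
    then have "norm (X t - X' t) \<le> 0" "w t = 0" using Xw[OF t] norm_ge_zero[of "X t - X' t"] by linarith+
    then show ?thesis by (simp add: h_def \<phi>_0)
  qed
  have w0: "w s = 0" if s: "s \<in> {0..\<tau>}" for s
  proof (rule osgood_second_order[of s C \<phi> h w u])
    show "h integrable_on {0..s}" using s by (intro integrable_on_subinterval[OF hint]) auto
  qed (use s hw C_pos \<phi>_cont \<phi>_0 \<phi>_pos osgood in \<open>auto simp: h_def u_def w_def\<close>)
  have XX: "X s = X' s" if "s \<in> {0..\<tau>}" for s using Xw[OF that] w0[OF that] by simp
  \<comment> \<open>Once the positions agree on the whole interval, the velocities are integrals of
    the same force.\<close>
  moreover have "V t = V' t"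
  proof -
    have "integral {0..t} (\<lambda>s. E s (X s)) = integral {0..t} (\<lambda>s. E s (X' s))"
      using t XX by (intro Henstock_Kurzweil_Integration.integral_cong) auto
    then show ?thesis using eq t by simp
  qed
  ultimately show ?thesis using t by simp
qed

text \<open>Every subsequence has a further one converging to some trajectory with the same data;
  uniqueness identifies that limit, so the whole sequence converges.\<close>

lemma approximate_trajectories_tendsto:
  fixes Xn Vn yn :: "nat \<Rightarrow> real \<Rightarrow> 'a"
  assumes "\<tau> \<ge> 0"
    and Xn: "\<And>n t. t \<in> {0..\<tau>} \<Longrightarrow> Xn n t = xn n + integral {0..t} (Vn n)"
    and Vn: "\<And>n t. t \<in> {0..\<tau>} \<Longrightarrow> Vn n t = vn n + integral {0..t} (\<lambda>s. E s (yn n s))"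
    and yn: "\<And>n. yn n \<in> borel_measurable (lebesgue_on {0..\<tau>})"
    and close: "\<And>n t. t \<in> {0..\<tau>} \<Longrightarrow> norm (Xn n t - yn n t) \<le> e n" and e: "e \<longlonglongrightarrow> 0"
    and xn: "xn \<longlonglongrightarrow> x" and vn: "vn \<longlonglongrightarrow> v"
    and tr: "trajectory E \<tau> x v X V"
  shows "(\<lambda>n. (Xn n \<tau>, Vn n \<tau>)) \<longlonglongrightarrow> (X \<tau>, V \<tau>)"
proof (rule LIMSEQ_if_subsequences)
  fix r :: "nat \<Rightarrow> nat" assume r: "strict_mono r"
  obtain s X' V' where s: "strict_mono s" and tr': "trajectory E \<tau> x v X' V'"
    and lim: "\<And>t. t \<in> {0..\<tau>} \<Longrightarrow> (\<lambda>n. Xn (r (s n)) t) \<longlonglongrightarrow> X' t" "\<And>t. t \<in> {0..\<tau>} \<Longrightarrow> (\<lambda>n. Vn (r (s n)) t) \<longlonglongrightarrow> V' t"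
    using approximate_trajectories_compact[of \<tau> "\<lambda>n. Xn (r n)" "\<lambda>n. xn (r n)" "\<lambda>n. Vn (r n)" "\<lambda>n. vn (r n)"
        "\<lambda>n. yn (r n)" "\<lambda>n. e (r n)" x v, OF \<open>\<tau> \<ge> 0\<close> Xn Vn yn close]
      LIMSEQ_subseq_LIMSEQ[OF e r] LIMSEQ_subseq_LIMSEQ[OF xn r] LIMSEQ_subseq_LIMSEQ[OF vn r]
    by (auto simp: o_def)
  have "X' \<tau> = X \<tau> \<and> V' \<tau> = V \<tau>" using trajectory_unique[OF tr' tr, of \<tau>] \<open>\<tau> \<ge> 0\<close> by simp
  then have "(\<lambda>n. (Xn (r (s n)) \<tau>, Vn (r (s n)) \<tau>)) \<longlonglongrightarrow> (X \<tau>, V \<tau>)"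
    using lim[of \<tau>] \<open>\<tau> \<ge> 0\<close> by (auto intro: tendsto_Pair)
  with s show "\<exists>s. strict_mono s \<and> (\<lambda>n. (Xn (r (s n)) \<tau>, Vn (r (s n)) \<tau>)) \<longlonglongrightarrow> (X \<tau>, V \<tau>)" by blast
qed

lemma reversed_osgood_force_field: "osgood_force_field (\<lambda>s. E (\<tau> - s)) M C \<phi>"
  using reversed_force_field osgood by (simp add: osgood_force_field_def osgood_force_field_axioms_def)

end

section \<open>Maps preserving Lebesgue measure\<close>

lemma emeasure_lborel_vimage_plus:
  fixes c :: "'a::euclidean_space"
  assumes "S \<in> sets borel"
  shows "emeasure lborel ((\<lambda>v. v + c) -` S) = emeasure lborel S"
proof -
  have "emeasure lborel S = emeasure (distr lborel borel ((+) c)) S" by (simp add: lborel_distr_plus)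
  also have "\<dots> = emeasure lborel ((+) c -` S)" using assms by (subst emeasure_distr) auto
  also have "(+) c = (\<lambda>v. v + c)" by (auto simp: add.commute)
  finally show ?thesis by simp
qed

text \<open>Composition and Fubini are carried out on Borel sets; the passage to the completed
  measure is made only once, for the flow itself.\<close>

definition borel_preserving :: "('b::euclidean_space \<Rightarrow> 'b) \<Rightarrow> bool" where
  "borel_preserving h \<longleftrightarrow> h \<in> borel_measurable borel \<and>
     (\<forall>A\<in>sets borel. emeasure lborel (h -` A) = emeasure lborel A)"

lemma borel_preserving_compose:
  assumes "borel_preserving g" "borel_preserving h"
  shows "borel_preserving (\<lambda>x. g (h x))"
proof -
  have "g -` A \<in> sets borel" if "A \<in> sets borel" for A
    using assms(1) measurable_sets[of g borel borel A] that by (simp add: borel_preserving_def)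
  moreover have "(\<lambda>x. g (h x)) -` A = h -` (g -` A)" for A by auto
  ultimately show ?thesis
    using assms by (auto simp: borel_preserving_def intro: measurable_compose[of h borel borel g])
qed

text \<open>Fubini over the first coordinate: the map keeps every fibre and preserves measure on it.
  It covers both the kick and the reflection of the velocity.\<close>

lemma borel_preserving_fibrewise:
  fixes G :: "'a::euclidean_space \<Rightarrow> 'a \<Rightarrow> 'a"
  assumes m: "(\<lambda>(x, v). (x, G x v)) \<in> borel_measurable borel"
    and fibre: "\<And>x S. S \<in> sets borel \<Longrightarrow> emeasure lborel (G x -` S) = emeasure lborel S"
  shows "borel_preserving (\<lambda>(x, v). (x, G x v))"
  unfolding borel_preserving_def
proof (intro conjI ballI m)
  fix A :: "('a \<times> 'a) set" assume A: "A \<in> sets borel"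
  then have A': "A \<in> sets (lborel \<Otimes>\<^sub>M lborel)" unfolding lborel_prod by simp
  have B: "(\<lambda>(x, v). (x, G x v)) -` A \<in> sets (lborel \<Otimes>\<^sub>M lborel)"
    using measurable_sets[OF m A] unfolding lborel_prod by simp
  have "emeasure (lborel \<Otimes>\<^sub>M lborel) ((\<lambda>(x, v). (x, G x v)) -` A)
      = (\<integral>\<^sup>+x. emeasure lborel (Pair x -` ((\<lambda>(x, v). (x, G x v)) -` A)) \<partial>lborel)"
    using B by (rule lborel.emeasure_pair_measure_alt)
  also have "\<dots> = (\<integral>\<^sup>+x. emeasure lborel (Pair x -` A) \<partial>lborel)"
  proof (intro nn_integral_cong)
    fix x
    have "Pair x -` A \<in> sets lborel" using A' by (rule sets_Pair1)
    moreover have "Pair x -` ((\<lambda>(x, v). (x, G x v)) -` A) = G x -` (Pair x -` A)" by auto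
    ultimately show "emeasure lborel (Pair x -` ((\<lambda>(x, v). (x, G x v)) -` A)) = emeasure lborel (Pair x -` A)"
      by (simp only: fibre sets_lborel)
  qed
  also have "\<dots> = emeasure (lborel \<Otimes>\<^sub>M lborel) A"
    using A' by (rule lborel.emeasure_pair_measure_alt[symmetric])
  finally show "emeasure lborel ((\<lambda>(x, v). (x, G x v)) -` A) = emeasure lborel A" by (simp only: lborel_prod)
qed

lemma borel_preserving_kick:
  fixes F :: "'a::euclidean_space \<Rightarrow> 'a"
  assumes F: "F \<in> borel_measurable borel"
  shows "borel_preserving (\<lambda>(x, v). (x, v + F x))"
proof (rule borel_preserving_fibrewise)
  have "(\<lambda>z::'a \<times> 'a. (fst z, snd z + F (fst z))) \<in> borel_measurable borel"
    by (intro borel_measurable_Pair borel_measurable_add measurable_compose[OF _ F])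
      (auto intro!: borel_measurable_continuous_onI continuous_intros)
  then show "(\<lambda>(x, v). (x, v + F x)) \<in> borel_measurable borel" by (simp add: case_prod_beta)
qed (rule emeasure_lborel_vimage_plus)

lemma borel_preserving_reflect_velocity:
  "borel_preserving (map_prod id uminus :: 'a::euclidean_space \<times> 'a \<Rightarrow> _)"
proof -
  have "borel_preserving (\<lambda>(x::'a, v::'a). (x, - v))"
  proof (rule borel_preserving_fibrewise)
    have "(\<lambda>z::'a \<times> 'a. (fst z, - snd z)) \<in> borel_measurable borel"
      by (intro borel_measurable_continuous_onI continuous_intros)
    then show "(\<lambda>(x::'a, v::'a). (x, - v)) \<in> borel_measurable borel" by (simp add: case_prod_beta)
    show "emeasure lborel (uminus -` S) = emeasure lborel S" if "S \<in> sets borel" for S :: "'a set"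
    proof -
      have "(lborel :: 'a measure) = distr lborel borel uminus"
        using lborel_affine[of "-1" "0::'a"] by (simp add: density_1)
      then have "emeasure lborel S = emeasure (distr lborel borel uminus) S" by simp
      then show ?thesis using that by (simp add: emeasure_distr)
    qed
  qed
  then show ?thesis by (simp add: map_prod_def)
qed

text \<open>The roles of the coordinates are exchanged: for fixed \<open>v\<close> the slice is
  translated by \<open>c *\<^sub>R v\<close>, so Fubini is used over the second coordinate.\<close>

lemma borel_preserving_drift:
  fixes c :: real
  shows "borel_preserving (\<lambda>(x::'a::euclidean_space, v). (x + c *\<^sub>R v, v))"
  unfolding borel_preserving_def
proof (intro conjI ballI)
  have "(\<lambda>z::'a \<times> 'a. (fst z + c *\<^sub>R snd z, snd z)) \<in> borel_measurable borel"
    by (intro borel_measurable_continuous_onI continuous_intros)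
  then show m: "(\<lambda>(x::'a, v). (x + c *\<^sub>R v, v)) \<in> borel_measurable borel" by (simp add: case_prod_beta)
  fix A :: "('a \<times> 'a) set" assume A: "A \<in> sets borel"
  then have A': "A \<in> sets (lborel \<Otimes>\<^sub>M lborel)" unfolding lborel_prod by simp
  have B: "(\<lambda>(x, v). (x + c *\<^sub>R v, v)) -` A \<in> sets (lborel \<Otimes>\<^sub>M lborel)"
    using measurable_sets[OF m A] unfolding lborel_prod by simp
  have "emeasure (lborel \<Otimes>\<^sub>M lborel) ((\<lambda>(x, v). (x + c *\<^sub>R v, v)) -` A)
      = (\<integral>\<^sup>+v. emeasure lborel ((\<lambda>x. (x, v)) -` ((\<lambda>(x, v). (x + c *\<^sub>R v, v)) -` A)) \<partial>lborel)"
    using B by (rule lborel_pair.emeasure_pair_measure_alt2)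
  also have "\<dots> = (\<integral>\<^sup>+v. emeasure lborel ((\<lambda>x. (x, v)) -` A) \<partial>lborel)"
  proof (intro nn_integral_cong)
    fix v
    have "(\<lambda>x. (x, v)) -` A \<in> sets lborel" using A' by (rule sets_Pair2)
    moreover have "(\<lambda>x. (x, v)) -` ((\<lambda>(x, v). (x + c *\<^sub>R v, v)) -` A) = (\<lambda>x. x + c *\<^sub>R v) -` ((\<lambda>x. (x, v)) -` A)" by auto
    ultimately show "emeasure lborel ((\<lambda>x. (x, v)) -` ((\<lambda>(x, v). (x + c *\<^sub>R v, v)) -` A)) = emeasure lborel ((\<lambda>x. (x, v)) -` A)"
      by (simp only: emeasure_lborel_vimage_plus sets_lborel)
  qed
  also have "\<dots> = emeasure (lborel \<Otimes>\<^sub>M lborel) A"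
    using A' by (rule lborel_pair.emeasure_pair_measure_alt2[symmetric])
  finally show "emeasure lborel ((\<lambda>(x, v). (x + c *\<^sub>R v, v)) -` A) = emeasure lborel A" by (simp only: lborel_prod)
qed

text \<open>Fatou's lemma: the indicator function of an open set is lower semicontinuous.\<close>
lemma emeasure_vimage_open_le:
  fixes h :: "'b::euclidean_space \<Rightarrow> 'b"
  assumes hn: "\<And>n. borel_preserving (hn n)" and lim: "\<And>z. (\<lambda>n. hn n z) \<longlonglongrightarrow> h z"
    and h: "h \<in> borel_measurable borel" and U: "open U"
  shows "emeasure lborel (h -` U) \<le> emeasure lborel U"
proof -
  have Un: "hn n -` U \<in> sets lborel" for n
    using measurable_sets[of "hn n" borel borel U] hn[of n] U by (simp add: borel_preserving_def)
  have Uh: "h -` U \<in> sets lborel" using measurable_sets[OF h, of U] U by simp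
  have "emeasure lborel (h -` U) = (\<integral>\<^sup>+z. indicator (h -` U) z \<partial>lborel)" using Uh by simp
  also have "\<dots> \<le> (\<integral>\<^sup>+z. liminf (\<lambda>n. indicator (hn n -` U) z) \<partial>lborel)"
  proof (intro nn_integral_mono)
    fix z
    show "(indicator (h -` U) z :: ennreal) \<le> liminf (\<lambda>n. indicator (hn n -` U) z)"
    proof (cases "h z \<in> U")
      case True
      then have "\<forall>\<^sub>F n in sequentially. hn n z \<in> U" using topological_tendstoD[OF lim U] by blast
      then have "\<forall>\<^sub>F n in sequentially. (1::ennreal) \<le> indicator (hn n -` U) z"
        by eventually_elim simp
      then have "1 \<le> liminf (\<lambda>n. indicator (hn n -` U) z :: ennreal)" by (rule Liminf_bounded)
      then show ?thesis using True by simp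
    qed simp
  qed
  also have "\<dots> \<le> liminf (\<lambda>n. \<integral>\<^sup>+z. indicator (hn n -` U) z \<partial>lborel)"
    by (rule nn_integral_liminf) (use Un in simp)
  also have "\<dots> = emeasure lborel U"
    using hn U Un by (simp add: borel_preserving_def Liminf_const)
  finally show ?thesis .
qed

text \<open>Outer regularity extends the inequality from open sets. Measurability of the preimage of
  \<open>A\<close> itself plays no part in the estimate: monotonicity is applied with the preimage
  of an open superset, which is Borel.\<close>

lemma emeasure_vimage_lebesgue_le:
  fixes h :: "'b::euclidean_space \<Rightarrow> 'b"
  assumes open_le: "\<And>U. open U \<Longrightarrow> emeasure lborel (h -` U) \<le> emeasure lborel U"
    and h: "h \<in> borel_measurable borel" and A: "A \<in> sets lebesgue"
  shows "emeasure lebesgue (h -` A) \<le> emeasure lebesgue A"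
proof (rule ennreal_le_epsilon)
  fix e :: real assume "e > 0"
  then obtain U where U: "open U" "A \<subseteq> U" "U - A \<in> lmeasurable" "emeasure lebesgue (U - A) < ennreal e"
    using sets_lebesgue_outer_open[OF A] by metis
  have Ub: "U \<in> sets borel" "h -` U \<in> sets borel" using U(1) measurable_sets[OF h, of U] by auto
  have "emeasure lebesgue (h -` A) \<le> emeasure lebesgue (h -` U)"
    using U(2) Ub by (intro emeasure_mono) auto
  also have "\<dots> = emeasure lborel (h -` U)" using Ub by simp
  also have "\<dots> \<le> emeasure lborel U" by (rule open_le[OF U(1)])
  also have "\<dots> = emeasure lebesgue (A \<union> (U - A))" using Ub U(2) by (simp add: Un_absorb1)
  also have "\<dots> \<le> emeasure lebesgue A + emeasure lebesgue (U - A)"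
    using A U(3) by (intro emeasure_subadditive) auto
  also have "\<dots> \<le> emeasure lebesgue A + ennreal e" using U(4) by (intro add_mono) auto
  finally show "emeasure lebesgue (h -` A) \<le> emeasure lebesgue A + ennreal e" .
qed

lemma lebesgue_preserving_inverse_pair:
  fixes h g :: "'b::euclidean_space \<Rightarrow> 'b"
  assumes h: "h \<in> borel_measurable borel" and g: "g \<in> borel_measurable borel"
    and hg: "\<And>z. h (g z) = z"
    and h_le: "\<And>U. open U \<Longrightarrow> emeasure lborel (h -` U) \<le> emeasure lborel U"
    and g_le: "\<And>U. open U \<Longrightarrow> emeasure lborel (g -` U) \<le> emeasure lborel U"
  shows "lebesgue_preserving h"
proof -
  have hl: "h \<in> measurable lebesgue lborel" using measurable_completion[of h lborel borel] h by simp
  \<comment> \<open>A Borel map need not pull Lebesgue sets back to Lebesgue sets. This does hold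
    once preimages of null sets are null, which the inequality provides.\<close>
  have "null_sets lborel \<subseteq> null_sets (distr lebesgue lborel h)"
  proof
    fix N assume N: "N \<in> null_sets (lborel :: 'b measure)"
    have "emeasure lebesgue N = 0" "N \<in> sets lebesgue"
      using null_sets_completionI[OF N] by (auto simp: null_sets_def)
    then have "emeasure lebesgue (h -` N) \<le> 0"
      using emeasure_vimage_lebesgue_le[OF h_le h, of N] by simp
    then show "N \<in> null_sets (distr lebesgue lborel h)"
      using N hl by (auto simp: null_sets_def emeasure_distr)
  qed
  then have meas: "h \<in> measurable lebesgue lebesgue"
    using completion.measurable_completion2[OF hl] by simp
  moreover have "emeasure lebesgue (h -` A) = emeasure lebesgue A" if A: "A \<in> sets lebesgue" for A
  proof (rule antisym)
    show "emeasure lebesgue (h -` A) \<le> emeasure lebesgue A"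
      using h_le h A by (rule emeasure_vimage_lebesgue_le)
    \<comment> \<open>The reverse inequality is that of the inverse \<open>g\<close>, applied to the
      set pulled back by \<open>h\<close>.\<close>
    have "h -` A \<in> sets lebesgue" using measurable_sets[OF meas A] by simp
    then have "emeasure lebesgue (g -` (h -` A)) \<le> emeasure lebesgue (h -` A)"
      using emeasure_vimage_lebesgue_le[OF g_le g] by blast
    moreover have "g -` (h -` A) = A" using hg by auto
    ultimately show "emeasure lebesgue A \<le> emeasure lebesgue (h -` A)" by simp
  qed
  ultimately show ?thesis by (simp add: lebesgue_preserving_def)
qed

section \<open>The kick-drift scheme and the flow\<close>

context force_field
begin

definition impulse :: "real \<Rightarrow> nat \<Rightarrow> 'a \<Rightarrow> 'a" where
  "impulse h k x = integral {real k * h..real (Suc k) * h} (\<lambda>s. E s x)"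

text \<open>Symplectic Euler scheme with step \<open>h\<close>: each step is a kick (a shear in \<open>v\<close>) followed by a drift
  (a shear in \<open>x\<close>), hence preserves Lebesgue measure although \<open>E\<close> is not differentiable.\<close>
primrec scheme :: "real \<Rightarrow> nat \<Rightarrow> 'a \<times> 'a \<Rightarrow> 'a \<times> 'a" where
  "scheme h 0 z = z"
| "scheme h (Suc k) z =
    (case (case scheme h k z of (x, v) \<Rightarrow> (x, v + impulse h k x)) of (x, v) \<Rightarrow> (x + h *\<^sub>R v, v))"

lemma E_const_integrable: "(\<lambda>s. E s x) integrable_on {a..b}"
  by (rule E_integrable_continuous) simp

lemma continuous_impulse: "continuous_on UNIV (impulse h k)"
  unfolding continuous_on_sequentially
proof (intro ballI allI impI)
  fix y x assume "(\<forall>n. (y n :: 'a) \<in> UNIV) \<and> y \<longlonglongrightarrow> x"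
  then have y: "y \<longlonglongrightarrow> x" by simp
  show "(impulse h k \<circ> y) \<longlonglongrightarrow> impulse h k x"
    unfolding impulse_def o_def
    by (rule dominated_convergence(2)[where h = "\<lambda>_. M"])
      (use y E_tendsto E_bound E_const_integrable in auto)
qed

lemma borel_preserving_scheme: "borel_preserving (scheme h k)"
proof (induction k)
  case 0
  then show ?case by (simp add: borel_preserving_def)
next
  case (Suc k)
  have "borel_preserving (\<lambda>(x, v). (x, v + impulse h k x))"
    by (intro borel_preserving_kick borel_measurable_continuous_onI continuous_impulse)
  from borel_preserving_compose[OF borel_preserving_drift[of h] borel_preserving_compose[OF this Suc]]
  show ?case by simp
qed

text \<open>The position frozen at the left grid point, where the scheme evaluates the force. The
  two curves below solve the integral equations with this frozen position: the velocity reproduces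
  the scheme exactly at grid points, the position only up to first order, since the scheme drifts
  with the velocity at the end of each step.\<close>

definition step_curve :: "real \<Rightarrow> 'a \<times> 'a \<Rightarrow> real \<Rightarrow> 'a" where
  "step_curve h z s = fst (scheme h (nat \<lfloor>s / h\<rfloor>) z)"

definition scheme_V :: "real \<Rightarrow> 'a \<times> 'a \<Rightarrow> real \<Rightarrow> 'a" where
  "scheme_V h z t = snd z + integral {0..t} (\<lambda>s. E s (step_curve h z s))"

definition scheme_X :: "real \<Rightarrow> 'a \<times> 'a \<Rightarrow> real \<Rightarrow> 'a" where
  "scheme_X h z t = fst z + integral {0..t} (scheme_V h z)"

lemma step_curve_measurable: "step_curve h z \<in> borel_measurable (lebesgue_on {a..b})"
proof -
  have "(\<lambda>s::real. \<lfloor>s / h\<rfloor>) \<in> measurable borel (count_space UNIV)" by measurable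
  then have "(\<lambda>s. fst (scheme h (nat \<lfloor>s / h\<rfloor>) z)) \<in> borel_measurable borel"
    by (rule measurable_compose) simp
  then have "step_curve h z \<in> borel_measurable lborel" by (simp add: step_curve_def[abs_def])
  then show ?thesis by (intro measurable_restrict_space1 measurable_completion)
qed

lemma scheme_V_lipschitz:
  assumes "0 \<le> s" "0 \<le> t"
  shows "norm (scheme_V h z t - scheme_V h z s) \<le> M * \<bar>t - s\<bar>"
  using assms M_nonneg E_bound
  by (intro lipschitz_indefinite_integral[OF scheme_V_def E_integrable[OF step_curve_measurable], of "max s t"]) auto

lemma scheme_V_continuous: "continuous_on {0..t} (scheme_V h z)"
  by (rule lipschitz_on_continuous_on[of M], rule lipschitz_onI)
    (use scheme_V_lipschitz M_nonneg in \<open>auto simp: dist_norm\<close>)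

lemma scheme_V_bound:
  assumes "0 \<le> t" "t \<le> \<tau>"
  shows "norm (scheme_V h z t) \<le> norm (snd z) + M * \<tau>"
proof -
  have "scheme_V h z 0 = snd z" by (simp add: scheme_V_def)
  then have "norm (scheme_V h z t) \<le> norm (snd z) + norm (scheme_V h z t - scheme_V h z 0)"
    by (metis add.commute diff_add_cancel norm_triangle_ineq)
  also have "norm (scheme_V h z t - scheme_V h z 0) \<le> M * t" using scheme_V_lipschitz[of 0 t] assms by simp
  also have "M * t \<le> M * \<tau>" using assms M_nonneg by (intro mult_left_mono) auto
  finally show ?thesis by simp
qed

lemma scheme_X_lipschitz:
  assumes "s \<in> {0..\<tau>}" "t \<in> {0..\<tau>}"
  shows "norm (scheme_X h z t - scheme_X h z s) \<le> (norm (snd z) + M * \<tau>) * \<bar>t - s\<bar>"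
proof (rule lipschitz_indefinite_integral[where f = "scheme_V h z" and \<tau> = \<tau>])
  show "scheme_V h z integrable_on {0..\<tau>}" by (rule integrable_continuous_real[OF scheme_V_continuous])
qed (use assms M_nonneg in \<open>auto simp: scheme_X_def intro!: scheme_V_bound\<close>)

lemma scheme_V_grid:
  assumes h: "h > 0"
  shows "scheme_V h z (real k * h) = snd (scheme h k z)"
proof (induction k)
  case 0
  then show ?case by (simp add: scheme_V_def)
next
  case (Suc k)
  let ?f = "\<lambda>s. E s (step_curve h z s)"
  let ?a = "real k * h" and ?b = "real (Suc k) * h"
  have ab: "0 \<le> ?a" "?a \<le> ?b" using h by (auto simp: algebra_simps)
  have "integral {0..?a} ?f + integral {?a..?b} ?f = integral {0..?b} ?f"
    using ab by (intro Henstock_Kurzweil_Integration.integral_combine E_integrable step_curve_measurable)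
  moreover have "integral {?a..?b} ?f = impulse h k (fst (scheme h k z))"
    unfolding impulse_def
  \<comment> \<open>At the right endpoint the floor has already jumped to \<open>k + 1\<close>, so
    this single point is discarded.\<close>
  proof (rule integral_spike[of "{?b}"])
    fix s assume s: "s \<in> {?a..?b} - {?b}"
    then have "real k \<le> s / h" "s / h < real k + 1" using h by (auto simp: field_simps)
    then have "\<lfloor>s / h\<rfloor> = int k" by (intro floor_unique) auto
    then show "E s (fst (scheme h k z)) = ?f s" by (simp add: step_curve_def)
  qed auto
  ultimately have "scheme_V h z ?b = scheme_V h z ?a + impulse h k (fst (scheme h k z))"
    by (simp add: scheme_V_def)
  then show ?case using Suc by (simp add: case_prod_beta)
qed

text \<open>The scheme drifts with the final velocity of each step instead of integrating the
  velocity. As the latter is \<open>M\<close>-Lipschitz, one step costs at most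
  \<open>M * h * h\<close>, hence a time \<open>k * h \<le> \<tau>\<close> costs at most
  \<open>M * \<tau> * h\<close>.\<close>

lemma scheme_X_grid:
  assumes h: "h > 0"
  shows "norm (scheme_X h z (real k * h) - fst (scheme h k z)) \<le> real k * (M * h * h)"
proof (induction k)
  case 0
  then show ?case by (simp add: scheme_X_def)
next
  case (Suc k)
  let ?a = "real k * h" and ?b = "real (Suc k) * h"
  let ?v = "scheme_V h z ?b"
  have ab: "0 \<le> ?a" "?a \<le> ?b" using h by (auto simp: algebra_simps)
  have int: "scheme_V h z integrable_on {x..y}" if "0 \<le> x" for x y
    by (rule integrable_continuous_real, rule continuous_on_subset[OF scheme_V_continuous[of y]]) (use that in auto)
  have "integral {0..?a} (scheme_V h z) + integral {?a..?b} (scheme_V h z) = integral {0..?b} (scheme_V h z)"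
    using ab by (intro Henstock_Kurzweil_Integration.integral_combine int) auto
  then have X: "scheme_X h z ?b = scheme_X h z ?a + integral {?a..?b} (scheme_V h z)" by (simp add: scheme_X_def)
  have E: "fst (scheme h (Suc k) z) = fst (scheme h k z) + integral {?a..?b} (\<lambda>_. ?v)"
    unfolding scheme_V_grid[OF h] using ab h by (simp add: case_prod_beta algebra_simps)
  have "norm (integral {?a..?b} (\<lambda>s. scheme_V h z s - ?v)) \<le> integral {?a..?b} (\<lambda>_. M * h)"
  proof (rule integral_norm_bound_integral)
    fix s assume s: "s \<in> {?a..?b}"
    have "norm (scheme_V h z s - ?v) \<le> M * \<bar>s - ?b\<bar>"
      using s ab by (intro scheme_V_lipschitz) auto
    also have "\<dots> \<le> M * h" using s M_nonneg by (intro mult_left_mono) (auto simp: algebra_simps)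
    finally show "norm (scheme_V h z s - ?v) \<le> M * h" .
  qed (use ab in \<open>auto intro!: integrable_diff int\<close>)
  also have "\<dots> = M * h * h" using h by (simp add: algebra_simps)
  finally have step: "norm (integral {?a..?b} (\<lambda>s. scheme_V h z s - ?v)) \<le> M * h * h" .
  have "scheme_X h z ?b - fst (scheme h (Suc k) z)
      = (scheme_X h z ?a - fst (scheme h k z)) + integral {?a..?b} (\<lambda>s. scheme_V h z s - ?v)"
    using ab by (subst Henstock_Kurzweil_Integration.integral_diff) (auto simp: X E simp del: scheme.simps of_nat_Suc intro!: int)
  also have "norm \<dots> \<le> real k * (M * h * h) + M * h * h"
    by (rule order.trans[OF norm_triangle_ineq add_mono[OF Suc step]])
  finally show ?case by (simp add: algebra_simps)
qed

text \<open>Two errors add up: the motion since the last grid point, at speed at most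
  \<open>norm (snd z) + M * \<tau>\<close>, and the accumulated grid error
  \<open>M * \<tau> * h\<close>.\<close>

lemma scheme_X_close:
  assumes h: "h > 0" and s: "s \<in> {0..\<tau>}"
  shows "norm (scheme_X h z s - step_curve h z s) \<le> (norm (snd z) + 2 * M * \<tau>) * h"
proof -
  define k where "k = nat \<lfloor>s / h\<rfloor>"
  have "0 \<le> \<lfloor>s / h\<rfloor>" using s h by simp
  then have "real k \<le> s / h" "s / h < real k + 1" by (auto simp: k_def)
  then have k: "real k * h \<le> s" "s - real k * h \<le> h" using h by (auto simp: field_simps)
  have "norm (scheme_X h z s - scheme_X h z (real k * h)) \<le> (norm (snd z) + M * \<tau>) * \<bar>s - real k * h\<bar>"
    using s k h by (intro scheme_X_lipschitz) auto
  also have "\<dots> \<le> (norm (snd z) + M * \<tau>) * h"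
    using k s M_nonneg by (intro mult_left_mono) auto
  finally have 1: "norm (scheme_X h z s - scheme_X h z (real k * h)) \<le> (norm (snd z) + M * \<tau>) * h" .
  have "norm (scheme_X h z (real k * h) - step_curve h z s) \<le> real k * (M * h * h)"
    using scheme_X_grid[OF h] by (simp add: step_curve_def k_def)
  also have "\<dots> = (real k * h) * (M * h)" by simp
  also have "\<dots> \<le> \<tau> * (M * h)" using k s h M_nonneg by (intro mult_right_mono) auto
  finally have "norm (scheme_X h z (real k * h) - step_curve h z s) \<le> M * \<tau> * h" by (simp add: mult_ac)
  with 1 have "norm (scheme_X h z s - scheme_X h z (real k * h)) + norm (scheme_X h z (real k * h) - step_curve h z s)
      \<le> (norm (snd z) + 2 * M * \<tau>) * h" by (simp add: algebra_simps)
  moreover have "norm (scheme_X h z s - step_curve h z s)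
      \<le> norm (scheme_X h z s - scheme_X h z (real k * h)) + norm (scheme_X h z (real k * h) - step_curve h z s)"
    by (metis diff_add_cancel diff_add_eq norm_triangle_ineq add_diff_eq)
  ultimately show ?thesis by simp
qed

lemma mesh_tendsto_0: "(\<lambda>n. c * (\<tau> / real (Suc n))) \<longlonglongrightarrow> 0"
  using tendsto_mult_right_zero[OF LIMSEQ_inverse_real_of_nat, of "c * \<tau>"] by (simp add: divide_inverse mult.assoc)

lemma trajectory_exists:
  assumes \<tau>: "\<tau> > 0"
  shows "\<exists>X V. trajectory E \<tau> x v X V"
proof -
  let ?h = "\<lambda>n. \<tau> / real (Suc n)"
  have h: "?h n > 0" for n using \<tau> by simp
  show ?thesis
    by (rule approximate_trajectories_compact[of \<tau> "\<lambda>n. scheme_X (?h n) (x, v)" "\<lambda>_. x"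
          "\<lambda>n. scheme_V (?h n) (x, v)" "\<lambda>_. v" "\<lambda>n. step_curve (?h n) (x, v)" "\<lambda>n. (norm v + 2 * M * \<tau>) * ?h n" x v])
      (use \<tau> scheme_X_close[OF h, of _ \<tau> _ "(x, v)"] step_curve_measurable mesh_tendsto_0 in
        \<open>auto simp: scheme_X_def scheme_V_def simp del: of_nat_Suc\<close>)
qed

end

section \<open>The flow: continuity, inversion by time reversal, preservation of measure\<close>

context osgood_force_field
begin

lemma scheme_tendsto:
  assumes \<tau>: "\<tau> > 0" and tr: "trajectory E \<tau> x v X V"
  shows "(\<lambda>n. scheme (\<tau> / real (Suc n)) (Suc n) (x, v)) \<longlonglongrightarrow> (X \<tau>, V \<tau>)"
proof -
  let ?h = "\<lambda>n. \<tau> / real (Suc n)" and ?z = "(x, v)"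
  have h: "?h n > 0" and total: "real (Suc n) * ?h n = \<tau>" for n using \<tau> by auto
  have lim: "(\<lambda>n. (scheme_X (?h n) ?z \<tau>, scheme_V (?h n) ?z \<tau>)) \<longlonglongrightarrow> (X \<tau>, V \<tau>)"
    by (rule approximate_trajectories_tendsto[of \<tau> "\<lambda>n. scheme_X (?h n) ?z" "\<lambda>_. x" "\<lambda>n. scheme_V (?h n) ?z" "\<lambda>_. v"
          "\<lambda>n. step_curve (?h n) ?z" "\<lambda>n. (norm v + 2 * M * \<tau>) * ?h n" x v])
      (use \<tau> tr scheme_X_close[OF h, of _ \<tau> _ "?z"] step_curve_measurable mesh_tendsto_0 in
        \<open>auto simp: scheme_X_def scheme_V_def simp del: of_nat_Suc\<close>)
  \<comment> \<open>The limit was obtained for the interpolated position; the iterates themselves,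
    which preserve measure, differ from it by a multiple of the step at the grid time
    \<tau>.\<close>
  have "(\<lambda>n. scheme_X (?h n) ?z \<tau> - fst (scheme (?h n) (Suc n) ?z)) \<longlonglongrightarrow> 0"
  proof (rule Lim_null_comparison[OF always_eventually[OF allI]])
    show "norm (scheme_X (?h n) ?z \<tau> - fst (scheme (?h n) (Suc n) ?z)) \<le> (M * \<tau>) * ?h n" for n
    proof -
      have "norm (scheme_X (?h n) ?z \<tau> - fst (scheme (?h n) (Suc n) ?z)) \<le> real (Suc n) * (M * ?h n * ?h n)"
        using scheme_X_grid[OF h, of n ?z "Suc n"] unfolding total .
      also have "\<dots> = M * ?h n * (real (Suc n) * ?h n)" by (simp only: mult_ac)
      finally show ?thesis unfolding total by (simp add: mult_ac)
    qed
  qed (rule mesh_tendsto_0)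
  from tendsto_diff[OF tendsto_fst[OF lim] this]
  have "(\<lambda>n. fst (scheme (?h n) (Suc n) ?z)) \<longlonglongrightarrow> X \<tau>" by simp
  moreover have "(\<lambda>n. snd (scheme (?h n) (Suc n) ?z)) \<longlonglongrightarrow> V \<tau>"
    using tendsto_snd[OF lim] scheme_V_grid[OF h, of n ?z "Suc n" for n] unfolding total by simp
  ultimately have "(\<lambda>n. (fst (scheme (?h n) (Suc n) ?z), snd (scheme (?h n) (Suc n) ?z))) \<longlonglongrightarrow> (X \<tau>, V \<tau>)"
    by (rule tendsto_Pair)
  then show ?thesis by simp
qed

text \<open>The Hilbert choice in \<open>flow\<close> selects one solution on the whole of
  \<open>{0..T}\<close>, independently of the time; its restriction to \<open>{0..\<tau>}\<close> is
  the trajectory.\<close>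

lemma flow_trajectory:
  assumes "T > 0" and \<tau>: "\<tau> \<in> {0..T}"
  obtains X V where "trajectory E \<tau> x v X V" "flow T E \<tau> (x, v) = (X \<tau>, V \<tau>)"
proof -
  define Z where "Z = (SOME Z. solution T E x v (fst \<circ> Z) (snd \<circ> Z))"
  obtain X V where "trajectory E T x v X V" using trajectory_exists[OF \<open>T > 0\<close>] by blast
  then have "solution T E x v (fst \<circ> (\<lambda>t. (X t, V t))) (snd \<circ> (\<lambda>t. (X t, V t)))"
    using solution_iff_trajectory[OF \<open>T > 0\<close>] by (simp add: o_def)
  then have "solution T E x v (fst \<circ> Z) (snd \<circ> Z)" 
    unfolding Z_def by (rule someI[where P = "\<lambda>Z. solution T E x v (fst \<circ> Z) (snd \<circ> Z)"])
  then have "trajectory E \<tau> x v (fst \<circ> Z) (snd \<circ> Z)"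
    using solution_iff_trajectory[OF \<open>T > 0\<close>] trajectory_subinterval \<tau> by auto
  then show ?thesis by (rule that) (simp add: flow_def Z_def)
qed

text \<open>A trajectory known only on \<open>{0..\<tau>}\<close> already determines the flow at
  time \<tau>. Reversed trajectories are of this kind, while \<open>flow\<close> refers to curves on
  all of \<open>{0..T}\<close>.\<close>

lemma flow_eq:
  assumes "T > 0" and \<tau>: "\<tau> \<in> {0..T}" and tr: "trajectory E \<tau> x v X V"
  shows "flow T E \<tau> (x, v) = (X \<tau>, V \<tau>)"
proof -
  obtain X' V' where "trajectory E \<tau> x v X' V'" "flow T E \<tau> (x, v) = (X' \<tau>, V' \<tau>)"
    using flow_trajectory[OF assms(1,2)] .
  with trajectory_unique[OF _ tr, of X' V' \<tau>] \<tau> show ?thesis by auto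
qed

text \<open>Trajectories with converging data are approximations of the limit trajectory with zero
  error \<open>e\<close>, so continuous dependence is another instance of the compactness
  argument.\<close>

lemma continuous_flow:
  assumes "T > 0" and \<tau>: "\<tau> \<in> {0..T}"
  shows "continuous_on UNIV (flow T E \<tau>)"
  unfolding continuous_on_sequentially
proof (intro ballI allI impI)
  fix zn :: "nat \<Rightarrow> 'a \<times> 'a" and z assume "(\<forall>n. zn n \<in> UNIV) \<and> zn \<longlonglongrightarrow> z"
  then have lim: "zn \<longlonglongrightarrow> z" by simp
  have "\<exists>X V. trajectory E \<tau> (fst (zn n)) (snd (zn n)) X V \<and> flow T E \<tau> (zn n) = (X \<tau>, V \<tau>)" for n
    using flow_trajectory[OF assms, of "fst (zn n)" "snd (zn n)"] by (metis prod.collapse)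
  then obtain Xn Vn where tr: "\<And>n. trajectory E \<tau> (fst (zn n)) (snd (zn n)) (Xn n) (Vn n)"
    and fl: "\<And>n. flow T E \<tau> (zn n) = (Xn n \<tau>, Vn n \<tau>)" by metis
  obtain X V where XV: "trajectory E \<tau> (fst z) (snd z) X V" "flow T E \<tau> (fst z, snd z) = (X \<tau>, V \<tau>)"
    using flow_trajectory[OF assms] .
  have "(\<lambda>n. (Xn n \<tau>, Vn n \<tau>)) \<longlonglongrightarrow> (X \<tau>, V \<tau>)"
  proof (rule approximate_trajectories_tendsto[where yn = Xn and e = "\<lambda>_. 0" and x = "fst z" and v = "snd z"])
    show "Xn n \<in> borel_measurable (lebesgue_on {0..\<tau>})" for n
      using tr[of n] by (intro continuous_imp_measurable_on_sets_lebesgue) (auto simp: trajectory_def)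
  qed (use \<tau> tr XV lim in \<open>auto simp: trajectory_def intro: tendsto_fst tendsto_snd\<close>)
  then show "(flow T E \<tau> \<circ> zn) \<longlonglongrightarrow> flow T E \<tau> z"
    using XV(2) by (simp add: o_def fl)
qed

text \<open>For times beyond \<tau> the reversed field evaluates \<open>E\<close> at negative times;
  this is harmless because the assumptions on \<open>E\<close> hold for all real times and the flow
  is only read off at \<tau>.\<close>

lemma flow_reversed:
  assumes "T > 0" and \<tau>: "\<tau> \<in> {0..T}"
  shows "flow T (\<lambda>s. E (\<tau> - s)) \<tau> (map_prod id uminus (flow T E \<tau> z)) = map_prod id uminus z"
proof -
  interpret R: osgood_force_field "\<lambda>s. E (\<tau> - s)" M C \<phi> by (rule reversed_osgood_force_field)
  obtain x v where z: "z = (x, v)" by (cases z)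
  obtain X V where tr: "trajectory E \<tau> x v X V" and fl: "flow T E \<tau> (x, v) = (X \<tau>, V \<tau>)"
    using flow_trajectory[OF assms] .
  have "X 0 = x" "V 0 = v" using tr \<tau> by (auto simp: trajectory_def)
  then show ?thesis
    using R.flow_eq[OF assms trajectory_reversed[OF tr]] by (simp add: z fl)
qed

lemma flow_inverse:
  assumes "T > 0" and \<tau>: "\<tau> \<in> {0..T}"
  defines "g \<equiv> \<lambda>z. map_prod id uminus (flow T (\<lambda>s. E (\<tau> - s)) \<tau> (map_prod id uminus z))"
  shows "g (flow T E \<tau> z) = z" "flow T E \<tau> (g z) = z" "continuous_on UNIV g"
proof -
  interpret R: osgood_force_field "\<lambda>s. E (\<tau> - s)" M C \<phi> by (rule reversed_osgood_force_field)
  have neg: "map_prod id uminus (map_prod id uminus w) = (w :: 'a \<times> 'a)" for w by (cases w) simp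
  show "g (flow T E \<tau> z) = z" by (simp add: g_def flow_reversed[OF assms(1,2)] neg)
  \<comment> \<open>Reversing twice gives back \<open>E\<close>, so the same identity for the
    reversed field yields the inverse on the other side.\<close>
  show "flow T E \<tau> (g z) = z"
    using R.flow_reversed[OF assms(1,2), of "map_prod id uminus z"] by (simp add: g_def neg)
  have cN: "continuous_on UNIV (map_prod id uminus :: 'a \<times> 'a \<Rightarrow> 'a \<times> 'a)"
    by (auto simp: map_prod_def case_prod_beta intro!: continuous_intros)
  show "continuous_on UNIV g"
    unfolding g_def
    using continuous_on_compose2[OF cN continuous_on_compose2[OF R.continuous_flow[OF assms(1,2)] cN subset_UNIV] subset_UNIV] .
qed

lemma homeomorphism_flow:
  assumes "T > 0" and \<tau>: "\<tau> \<in> {0..T}"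
  shows "\<exists>g. homeomorphism UNIV UNIV (flow T E \<tau>) g"
proof (intro exI homeomorphismI)
  show "continuous_on UNIV (flow T E \<tau>)" by (rule continuous_flow[OF assms])
  show "continuous_on UNIV (\<lambda>z. map_prod id uminus (flow T (\<lambda>s. E (\<tau> - s)) \<tau> (map_prod id uminus z)))"
    by (rule flow_inverse(3)[OF assms])
qed (simp_all add: flow_inverse(1,2)[OF assms])

lemma emeasure_vimage_flow_le:
  assumes "T > 0" and \<tau>: "\<tau> \<in> {0..T}" and U: "open U"
  shows "emeasure lborel (flow T E \<tau> -` U) \<le> emeasure lborel U"
proof (cases "\<tau> = 0")
  \<comment> \<open>Time 0 is separate because the scheme needs a positive step.\<close>
  case True
  have "flow T E \<tau> z = z" for z
  proof -
    obtain X V where "trajectory E \<tau> (fst z) (snd z) X V" "flow T E \<tau> (fst z, snd z) = (X \<tau>, V \<tau>)"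
      using flow_trajectory[OF assms(1,2)] .
    then show ?thesis using True by (auto simp: trajectory_def)
  qed
  then have "flow T E \<tau> -` U = U" by auto
  then show ?thesis by simp
next
  case False
  then have "\<tau> > 0" using \<tau> by simp
  have "(\<lambda>n. scheme (\<tau> / real (Suc n)) (Suc n) z) \<longlonglongrightarrow> flow T E \<tau> z" for z
  proof -
    obtain X V where "trajectory E \<tau> (fst z) (snd z) X V" "flow T E \<tau> (fst z, snd z) = (X \<tau>, V \<tau>)"
      using flow_trajectory[OF assms(1,2)] .
    then show ?thesis using scheme_tendsto[OF \<open>\<tau> > 0\<close>, of "fst z" "snd z"] by simp
  qed
  then show ?thesis
    by (rule emeasure_vimage_open_le[OF borel_preserving_scheme])
      (use U continuous_flow[OF assms(1,2)] in \<open>auto intro: borel_measurable_continuous_onI\<close>)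
qed

lemma lebesgue_preserving_flow:
  assumes "T > 0" and \<tau>: "\<tau> \<in> {0..T}"
  shows "lebesgue_preserving (flow T E \<tau>)"
proof -
  interpret R: osgood_force_field "\<lambda>s. E (\<tau> - s)" M C \<phi> by (rule reversed_osgood_force_field)
  let ?N = "map_prod id uminus :: 'a \<times> 'a \<Rightarrow> 'a \<times> 'a"
  let ?F = "flow T (\<lambda>s. E (\<tau> - s)) \<tau>"
  let ?g = "\<lambda>z. ?N (?F (?N z))"
  show ?thesis
  proof (rule lebesgue_preserving_inverse_pair[of _ ?g])
    show "flow T E \<tau> \<in> borel_measurable borel" "?g \<in> borel_measurable borel"
      using continuous_flow[OF assms] flow_inverse(3)[OF assms] by (auto intro: borel_measurable_continuous_onI)
    show "flow T E \<tau> (?g z) = z" for z by (rule flow_inverse(2)[OF assms])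
    show "emeasure lborel (flow T E \<tau> -` U) \<le> emeasure lborel U" if "open U" for U
      using assms that by (rule emeasure_vimage_flow_le)
    show "emeasure lborel (?g -` U) \<le> emeasure lborel U" if U: "open U" for U
    proof -
      \<comment> \<open>The inverse is the reversed flow conjugated by the reflection of the
        velocity, and the reflection preserves measure exactly.\<close>
      have N: "borel_preserving ?N" by (rule borel_preserving_reflect_velocity)
      have cN: "continuous_on UNIV ?N"
        by (auto simp: map_prod_def case_prod_beta intro!: continuous_intros)
      have NU: "open (?N -` U)" using cN U by (simp add: continuous_on_open_vimage)
      then have "open (?F -` (?N -` U))" using R.continuous_flow[OF assms] by (simp add: continuous_on_open_vimage)
      then have "emeasure lborel (?N -` (?F -` (?N -` U))) = emeasure lborel (?F -` (?N -` U))"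
        using N by (simp add: borel_preserving_def)
      also have "\<dots> \<le> emeasure lborel (?N -` U)" by (rule R.emeasure_vimage_flow_le[OF assms NU])
      also have "\<dots> = emeasure lborel U" using N U by (simp add: borel_preserving_def)
      finally show ?thesis by (simp add: vimage_def)
    qed
  qed
qed

end

section \<open>The field of a density\<close>

text \<open>The exceptional set consists of times only and does not depend on the curve, so a change
  of the field there affects no solution.\<close>

lemma solution_cong_AE:
  assumes ae: "AE t in lebesgue_on {0..T}. E t = E' t"
  shows "solution T E = solution T E'"
proof -
  have "solution T F x v X V"
    if sol: "solution T E x v X V" and ae: "AE t in lebesgue_on {0..T}. E t = F t" for E F :: "real \<Rightarrow> 'a \<Rightarrow> 'a" and x v X V
  proof -
    have "AE t in lebesgue_on {0<..<T}. E t = F t"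
      using ae by (auto simp: AE_restrict_space_iff elim: eventually_mono)
    moreover have "AE t in lebesgue_on {0<..<T}. (X has_vector_derivative V t) (at t) \<and> (V has_vector_derivative E t (X t)) (at t)"
      using sol unfolding solution_def by blast
    ultimately have "AE t in lebesgue_on {0<..<T}. (X has_vector_derivative V t) (at t) \<and> (V has_vector_derivative F t (X t)) (at t)"
      by eventually_elim simp
    then show ?thesis using sol unfolding solution_def by blast
  qed
  from this[OF _ ae] this[of E' _ _ _ _ E] show ?thesis
    using ae by (intro ext iffI) (auto simp: eq_commute)
qed

lemma integral_lebesgue_eq_lborel_AE:
  fixes f :: "'a::euclidean_space \<Rightarrow> 'b::euclidean_space"
  assumes ae: "AE x in lborel. f x = g x" and g: "g \<in> borel_measurable borel"
  shows "integral\<^sup>L lebesgue f = integral\<^sup>L lborel g"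
proof -
  have ae': "AE x in lebesgue. f x = g x" using ae by (rule AE_completion)
  have gl: "g \<in> borel_measurable lebesgue" using g by (intro measurable_completion) simp
  then have "f \<in> borel_measurable lebesgue"
    by (rule borel_measurable_AE) (use ae' in \<open>auto elim: eventually_mono\<close>)
  then have "integral\<^sup>L lebesgue f = integral\<^sup>L lebesgue g"
    using gl ae' by (rule integral_cong_AE)
  also have "\<dots> = integral\<^sup>L lborel g" using g by (intro integral_completion) simp
  finally show ?thesis .
qed

text \<open>A non-integrable function has integral 0 by convention, so slices of a density can be
  estimated without knowing that each of them is integrable.\<close>

lemma norm_integral_le_nn_integral:
  fixes f :: "'a \<Rightarrow> 'b::{banach, second_countable_topology}"
  shows "ennreal (norm (integral\<^sup>L M f)) \<le> (\<integral>\<^sup>+x. ennreal (norm (f x)) \<partial>M)"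
  by (cases "integrable M f") (auto simp: not_integrable_integral_eq intro: integral_norm_bound_ennreal)

lemma Y_ul_norm_local_bound:
  assumes norm: "Y_ul_norm \<Theta> g \<le> ennreal C" and C: "C \<le> B" "0 < B" and p: "p \<ge> 1" and \<Theta>: "\<Theta> p > 0"
  shows "(\<integral>\<^sup>+y\<in>ball x 1. ennreal (\<bar>g y\<bar> powr p) \<partial>lebesgue) \<le> ennreal ((B * \<Theta> p) powr p)"
proof -
  define I where "I = (\<integral>\<^sup>+y\<in>ball x 1. ennreal (\<bar>g y\<bar> powr p) \<partial>lebesgue)"
  have "Lp_norm_on p (ball x 1) g / ennreal (\<Theta> p) \<le> Lp_ul_norm p g / ennreal (\<Theta> p)"
    unfolding Lp_ul_norm_def by (intro divide_right_mono_ennreal SUP_upper) simp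
  also have "\<dots> \<le> Y_ul_norm \<Theta> g" unfolding Y_ul_norm_def using p by (intro SUP_upper) simp
  also have "\<dots> \<le> ennreal B" using norm C by (meson ennreal_leI order.trans)
  finally have "Lp_norm_on p (ball x 1) g / ennreal (\<Theta> p) * ennreal (\<Theta> p) \<le> ennreal B * ennreal (\<Theta> p)"
    by (rule mult_right_mono) simp
  moreover have "a / ennreal (\<Theta> p) * ennreal (\<Theta> p) = a" for a
    using \<Theta> ennreal_mult_divide_eq[of "ennreal (\<Theta> p)" a] ennreal_times_divide[of "ennreal (\<Theta> p)" a "ennreal (\<Theta> p)"]
    by (simp add: mult.commute)
  ultimately have L: "Lp_norm_on p (ball x 1) g \<le> ennreal (B * \<Theta> p)"
    using \<Theta> C by (simp add: ennreal_mult)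
  then have fin: "I \<noteq> \<infinity>" by (auto simp: Lp_norm_on_def Let_def I_def top_unique)
  then have "ennreal (enn2real I powr (1 / p)) \<le> ennreal (B * \<Theta> p)"
    using L by (simp add: Lp_norm_on_def Let_def flip: I_def)
  then have "enn2real I powr (1 / p) \<le> B * \<Theta> p" using \<Theta> C by simp
  then have "(enn2real I powr (1 / p)) powr p \<le> (B * \<Theta> p) powr p" using p by (intro powr_mono2) auto
  then have "enn2real I \<le> (B * \<Theta> p) powr p" using p by (simp add: powr_powr)
  then show ?thesis using fin unfolding I_def[symmetric]
    by (metis ennreal_enn2real ennreal_leI infinity_ennreal_def less_top)
qed

lemma phi_pos:
  assumes "growth_fun \<Theta>" "r > 0"
  shows "phi d \<Theta> r > 0"
proof (cases "r < exp (- real d - 1)")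
  case True
  then have "ln r < - real d - 1" using ln_less_cancel_iff[of r "exp (- real d - 1)"] assms by simp
  then have "\<bar>ln r\<bar> > 0" by simp
  moreover have "\<Theta> \<bar>ln r\<bar> > 0" using assms by (simp add: growth_fun_def)
  ultimately show ?thesis using assms True by (simp add: phi_def)
qed (use assms in \<open>auto simp: phi_def growth_fun_def\<close>)

lemma Phi_eq_integral:
  assumes "continuous_on {0..} (phi d \<Theta>)"
  shows "Phi d \<Theta> r = integral {0..r} (phi d \<Theta>)"
proof -
  have "set_integrable lborel {0..r} (phi d \<Theta>)"
    by (rule borel_integrable_atLeastAtMost', rule continuous_on_subset[OF assms]) auto
  then show ?thesis unfolding Phi_def by (rule set_borel_integral_eq_integral)
qed

lemma sets_borel_pair_lborel:
  "sets (borel \<Otimes>\<^sub>M (lborel :: 'b::euclidean_space measure)) = sets (borel :: ('a::euclidean_space \<times> 'b) measure)"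
  unfolding borel_prod[symmetric] by (rule sets_pair_measure_cong) simp_all

text \<open>The point is joint measurability in time and space. \<open>f\<close> agrees almost
  everywhere with a Borel function \<open>F\<close>, whose velocity integral and field are Borel by
  Fubini. Only times in a Borel set \<open>G\<close> of full measure are kept; there all bounds hold
  and the new field equals the original one.\<close>

lemma A_space_borel_force_field:
  fixes f :: "real \<Rightarrow> 'a::euclidean_space \<times> 'a \<Rightarrow> real"
  assumes \<kappa>: "\<kappa> \<in> {-1, 1}" and \<Theta>: "growth_fun \<Theta>"
    and cont: "continuous_on {0..} (phi DIM('a) \<Theta>)" and f: "f \<in> A_space \<Theta> T"
  obtains E M C where "force_field E M C (phi DIM('a) \<Theta>)" "AE t in lebesgue_on {0..T}. E_field \<kappa> f t = E t"
proof -
  have fm: "case_prod f \<in> borel_measurable (lebesgue_on ({0..T} \<times> UNIV))"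
    using f by (simp add: A_space_def Linf_L1_def)
  obtain A0 where A0: "AE t in lebesgue_on {0..T}. integrable lebesgue (f t) \<and> (\<integral>z. \<bar>f t z\<bar> \<partial>lebesgue) \<le> A0"
    using f by (auto simp: A_space_def Linf_L1_def)
  obtain B0 :: real where B0: "AE t in lebesgue_on {0..T}. rho f t \<in> Y_ul \<Theta> \<and> Y_ul_norm \<Theta> (rho f t) \<le> ennreal B0"
    using f by (auto simp: A_space_def)
  define A B where "A = max A0 0" and "B = max B0 1"
  let ?S = "{0..T} \<times> (UNIV :: ('a \<times> 'a) set)"
  have "closed ?S" by (intro closed_Times) auto
  then have S: "?S \<in> sets lebesgue" by (simp add: borel_closed)
  have "(\<lambda>p. if p \<in> ?S then case_prod f p else 0) \<in> borel_measurable (completion lborel)"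
    using fm borel_measurable_if[OF S, of "case_prod f"] by simp
  from completion_ex_borel_measurable_real[OF this]
  obtain F where F: "F \<in> borel_measurable lborel" and FAE: "AE p in lborel. (if p \<in> ?S then case_prod f p else 0) = F p"
    by blast
  have Fb: "F \<in> borel_measurable borel" using F by simp
  have slice2: "(\<lambda>v. F (t, y, v)) \<in> borel_measurable borel" and slice1: "(\<lambda>z. F (t, z)) \<in> borel_measurable borel" for t y
    by (rule measurable_compose[OF _ Fb], rule borel_measurable_continuous_onI, intro continuous_intros)+
  have "AE p in lborel \<Otimes>\<^sub>M lborel. (if p \<in> ?S then case_prod f p else 0) = F p"
    using FAE by (simp only: lborel_prod)
  from lborel_pair.AE_pair[OF this]
  have Feq: "AE t in lborel. AE z in lborel. (if (t, z) \<in> ?S then f t z else 0) = F (t, z)"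
    by (simp only: case_prod_conv)
  define good where "good t \<longleftrightarrow> integrable lebesgue (f t) \<and> (\<integral>z. \<bar>f t z\<bar> \<partial>lebesgue) \<le> A0 \<and>
    rho f t \<in> Y_ul \<Theta> \<and> Y_ul_norm \<Theta> (rho f t) \<le> ennreal B0 \<and> (AE z in lborel. f t z = F (t, z))" for t
  have "AE t in lebesgue. t \<in> {0..T} \<longrightarrow> good t"
  proof -
    have "AE t in lebesgue. t \<in> {0..T} \<longrightarrow> integrable lebesgue (f t) \<and> (\<integral>z. \<bar>f t z\<bar> \<partial>lebesgue) \<le> A0"
      using A0 by (subst (asm) AE_restrict_space_iff) auto
    moreover have "AE t in lebesgue. t \<in> {0..T} \<longrightarrow> rho f t \<in> Y_ul \<Theta> \<and> Y_ul_norm \<Theta> (rho f t) \<le> ennreal B0"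
      using B0 by (subst (asm) AE_restrict_space_iff) auto
    moreover have "AE t in lebesgue. AE z in lborel. (if (t, z) \<in> ?S then f t z else 0) = F (t, z)"
      using Feq by (rule AE_completion)
    ultimately show ?thesis by eventually_elim (auto simp: good_def)
  qed
  then have "AE t in lborel. t \<in> {0..T} \<longrightarrow> good t" by (simp only: AE_completion_iff)
  then obtain N where N: "{t. \<not> (t \<in> {0..T} \<longrightarrow> good t)} \<subseteq> N" "N \<in> null_sets lborel"
    by (auto elim!: AE_E simp: null_sets_def)
  \<comment> \<open>Removing a Borel null set makes \<open>G\<close> itself Borel, so that cutting
    the field off outside \<open>G\<close> preserves measurability.\<close>
  define G where "G = {0..T} - N"
  have Gb: "G \<in> sets borel" using N(2) by (auto simp: G_def null_sets_def)
  have Ggood: "good t" if "t \<in> G" for t using that N(1) by (auto simp: G_def)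
  have GAE: "AE t in lebesgue_on {0..T}. t \<in> G"
    using null_sets_completionI[OF N(2)] by (subst AE_restrict_space_iff) (auto simp: G_def intro!: AE_I'[of N])
  define \<rho> where "\<rho> t y = (\<integral>v. F (t, y, v) \<partial>lborel)" for t y
  define E0 where "E0 t x = \<kappa> *\<^sub>R (\<integral>y. \<rho> t y *\<^sub>R K (x - y) \<partial>lborel)" for t x
  have \<rho>b: "(\<lambda>(t, y). \<rho> t y) \<in> borel_measurable borel"
  proof -
    have "(\<lambda>q :: (real \<times> 'a) \<times> 'a. F (fst (fst q), snd (fst q), snd q)) \<in> borel_measurable borel"
      by (rule measurable_compose[OF _ Fb], rule borel_measurable_continuous_onI, intro continuous_intros)
    then have "(\<lambda>(p, v). F (fst p, snd p, v)) \<in> borel_measurable (borel \<Otimes>\<^sub>M lborel)"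
      unfolding measurable_cong_sets[OF sets_borel_pair_lborel refl] by (simp add: case_prod_beta)
    from lborel.borel_measurable_lebesgue_integral[OF this] show ?thesis by (simp add: \<rho>_def case_prod_beta)
  qed
  have E0b: "(\<lambda>(t, x). E0 t x) \<in> borel_measurable borel"
  proof -
    have "(\<lambda>q :: (real \<times> 'a) \<times> 'a. case (fst (fst q), snd q) of (t, y) \<Rightarrow> \<rho> t y) \<in> borel_measurable borel"
      by (rule measurable_compose[OF _ \<rho>b], rule borel_measurable_continuous_onI, intro continuous_intros)
    moreover have "(\<lambda>q :: (real \<times> 'a) \<times> 'a. K (snd (fst q) - snd q)) \<in> borel_measurable borel"
      by (rule measurable_compose[OF _ measurable_K], rule borel_measurable_continuous_onI, intro continuous_intros)
    ultimately have "(\<lambda>q :: (real \<times> 'a) \<times> 'a. \<rho> (fst (fst q)) (snd q) *\<^sub>R K (snd (fst q) - snd q)) \<in> borel_measurable borel"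
      by (intro borel_measurable_scaleR) simp
    then have "(\<lambda>(p, y). \<rho> (fst p) y *\<^sub>R K (snd p - y)) \<in> borel_measurable (borel \<Otimes>\<^sub>M lborel)"
      unfolding measurable_cong_sets[OF sets_borel_pair_lborel refl] by (simp add: case_prod_beta)
    from lborel.borel_measurable_lebesgue_integral[OF this] show ?thesis by (simp add: E0_def case_prod_beta)
  qed
  have \<rho>s: "\<rho> t \<in> borel_measurable borel" for t
    using measurable_compose[OF _ \<rho>b, of "\<lambda>y. (t, y)" borel] by simp
  have rho_eq: "AE y in lborel. rho f t y = \<rho> t y" if "t \<in> G" for t
  proof -
    have "AE z in lborel \<Otimes>\<^sub>M lborel. f t z = F (t, z)" using Ggood[OF that] unfolding lborel_prod good_def by blast
    from lborel_pair.AE_pair[OF this] show ?thesis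
      unfolding rho_def \<rho>_def
      by eventually_elim (intro integral_lebesgue_eq_lborel_AE slice2, simp)
  qed
  \<comment> \<open>Equality holds at every \<open>x\<close>, not just almost everywhere, because an
    almost everywhere change of the density leaves each convolution integral unchanged.\<close>
  have E_eq: "E_field \<kappa> f t x = E0 t x" if "t \<in> G" for t x
  proof -
    have "(\<integral>y. rho f t y *\<^sub>R K (x - y) \<partial>lebesgue) = (\<integral>y. \<rho> t y *\<^sub>R K (x - y) \<partial>lborel)"
    proof (rule integral_lebesgue_eq_lborel_AE)
      show "AE y in lborel. rho f t y *\<^sub>R K (x - y) = \<rho> t y *\<^sub>R K (x - y)"
        using rho_eq[OF that] by eventually_elim simp
      show "(\<lambda>y. \<rho> t y *\<^sub>R K (x - y)) \<in> borel_measurable borel" using \<rho>s by measurable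
    qed
    then show ?thesis by (simp add: E_field_def E0_def)
  qed
  have dens: "ul_density (\<rho> t) \<Theta> A B" if t: "t \<in> G" for t
  proof
    show "\<rho> t \<in> borel_measurable borel" by (rule \<rho>s)
    show "growth_fun \<Theta>" by (rule \<Theta>)
    show "0 \<le> A" "0 < B" by (auto simp: A_def B_def)
    show "(\<integral>\<^sup>+y\<in>ball x 1. ennreal (\<bar>\<rho> t y\<bar> powr p) \<partial>lborel) \<le> ennreal ((B * \<Theta> p) powr p)" if "p \<ge> 1" for p x
    proof -
      have "(\<integral>\<^sup>+y\<in>ball x 1. ennreal (\<bar>\<rho> t y\<bar> powr p) \<partial>lborel) = (\<integral>\<^sup>+y\<in>ball x 1. ennreal (\<bar>rho f t y\<bar> powr p) \<partial>lborel)"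
        using rho_eq[OF t] by (intro nn_integral_cong_AE) (auto elim: eventually_mono)
      also have "\<dots> = (\<integral>\<^sup>+y\<in>ball x 1. ennreal (\<bar>rho f t y\<bar> powr p) \<partial>lebesgue)"
        by (rule nn_integral_completion[symmetric])
      also have "\<dots> \<le> ennreal ((B * \<Theta> p) powr p)"
        using Ggood[OF t] \<Theta> that by (intro Y_ul_norm_local_bound[of _ _ B0]) (auto simp: good_def B_def growth_fun_def)
      finally show ?thesis .
    qed
    show "(\<integral>\<^sup>+y. ennreal \<bar>\<rho> t y\<bar> \<partial>lborel) \<le> ennreal A"
    proof -
      have "(\<integral>\<^sup>+y. ennreal \<bar>\<rho> t y\<bar> \<partial>lborel) \<le> (\<integral>\<^sup>+y. (\<integral>\<^sup>+v. ennreal \<bar>F (t, y, v)\<bar> \<partial>lborel) \<partial>lborel)"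
        unfolding \<rho>_def using norm_integral_le_nn_integral[of lborel "\<lambda>v. F (t, y, v)" for y] by (intro nn_integral_mono) simp
      also have "\<dots> = (\<integral>\<^sup>+z. ennreal \<bar>F (t, z)\<bar> \<partial>(lborel \<Otimes>\<^sub>M lborel))"
        using slice1[of t] by (intro lborel.nn_integral_fst) (simp only: lborel_prod, simp)
      also have "\<dots> = (\<integral>\<^sup>+z. ennreal \<bar>F (t, z)\<bar> \<partial>lborel)" by (simp only: lborel_prod)
      also have "\<dots> = (\<integral>\<^sup>+z. ennreal \<bar>f t z\<bar> \<partial>lborel)"
        using Ggood[OF t] by (intro nn_integral_cong_AE) (auto simp: good_def elim: eventually_mono)
      also have "\<dots> = (\<integral>\<^sup>+z. ennreal \<bar>f t z\<bar> \<partial>lebesgue)" by (rule nn_integral_completion[symmetric])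
      also have "\<dots> = ennreal (\<integral>z. \<bar>f t z\<bar> \<partial>lebesgue)"
        using Ggood[OF t] by (intro nn_integral_eq_integral) (auto simp: good_def)
      also have "\<dots> \<le> ennreal A" using Ggood[OF t] by (intro ennreal_leI) (auto simp: good_def A_def)
      finally show ?thesis .
    qed
  qed
  \<comment> \<open>The constants depend on the density only through \<open>A\<close> and
    \<open>B\<close>, so they are the same for all times in \<open>G\<close>.\<close>
  define M where "M = ul_density.field_bound TYPE('a) \<Theta> A B"
  define c where "c = ul_density.modulus_const TYPE('a) \<Theta> A B"
  define \<phi>1 where "\<phi>1 = phi DIM('a) \<Theta> (exp (- real DIM('a) - 1))"
  have \<phi>1: "\<phi>1 > 0" unfolding \<phi>1_def by (rule phi_pos[OF \<Theta>]) simp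
  define E where "E t x = (if t \<in> G then E0 t x else 0)" for t x
  define M' where "M' = max M 0"
  \<comment> \<open>The middle term serves radii above the threshold, where \<open>phi\<close> has
    the constant value \<open>\<phi>1\<close> and the crude bound \<open>2 * M'\<close> on the
    difference is used; the 1 makes \<open>C\<close> positive. Maxima with 0 settle the signs even
    if \<open>G\<close> is empty.\<close>
  define C where "C = max c 0 + 2 * M' / \<phi>1 + 1"
  have "2 * M' / \<phi>1 \<ge> 0" using \<phi>1 by (simp add: M'_def)
  then have C: "C > 0" "max c 0 \<le> C" "2 * M' / \<phi>1 \<le> C" by (auto simp: C_def)
  then have C': "2 * M' \<le> C * \<phi>1" using \<phi>1 by (simp add: field_simps)
  have \<kappa>1: "\<bar>\<kappa>\<bar> = 1" using \<kappa> by auto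
  have bound: "norm (E t x) \<le> M'" for t x
    using ul_density.norm_field_le[OF dens, of t x] \<kappa>1 by (auto simp: E_def E0_def M_def M'_def)
  have "force_field E M' C (phi DIM('a) \<Theta>)"
  proof
    have "(\<lambda>p. if fst p \<in> G then (case p of (t, x) \<Rightarrow> E0 t x) else 0) \<in> borel_measurable borel"
    proof (rule measurable_If[OF E0b])
      have "(fst :: real \<times> 'a \<Rightarrow> real) \<in> borel_measurable borel" by (intro borel_measurable_continuous_onI continuous_intros)
      from measurable_sets[OF this Gb] show "{p \<in> space borel. fst p \<in> G} \<in> sets (borel :: (real \<times> 'a) measure)"
        by (simp add: vimage_def)
    qed simp
    moreover have "(\<lambda>p. if fst p \<in> G then (case p of (t, x) \<Rightarrow> E0 t x) else 0) = case_prod E"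
      by (auto simp: E_def fun_eq_iff)
    ultimately show "case_prod E \<in> borel_measurable borel" by simp
    show "norm (E t x) \<le> M'" for t x by (rule bound)
    show "norm (E t x - E t y) \<le> C * phi DIM('a) \<Theta> r" if r: "0 < r" "norm (x - y) \<le> r" for t x y r
    proof (cases "r < exp (- real DIM('a) - 1)")
      case True
      have "norm (E t x - E t y) \<le> max c 0 * phi DIM('a) \<Theta> r"
      proof (cases "t \<in> G")
        case t: True
        have "E t x - E t y = \<kappa> *\<^sub>R ((\<integral>z. \<rho> t z *\<^sub>R K (x - z) \<partial>lborel) - (\<integral>z. \<rho> t z *\<^sub>R K (y - z) \<partial>lborel))"
          using t by (simp add: E_def E0_def scaleR_diff_right)
        then have "norm (E t x - E t y) \<le> c * phi DIM('a) \<Theta> r"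
          using ul_density.norm_field_diff_le[OF dens[OF t] r(1) True r(2)] \<kappa>1 by (simp add: c_def)
        also have "\<dots> \<le> max c 0 * phi DIM('a) \<Theta> r"
          using phi_pos[OF \<Theta> r(1)] by (intro mult_right_mono) (auto simp: less_imp_le)
        finally show ?thesis .
      next
        case False
        then show ?thesis using phi_pos[OF \<Theta> r(1), of "DIM('a)"] by (simp add: E_def)
      qed
      also have "\<dots> \<le> C * phi DIM('a) \<Theta> r"
        using phi_pos[OF \<Theta> r(1)] C(2) by (intro mult_right_mono) (auto simp: less_imp_le)
      finally show ?thesis .
    next
      case False
      then have "phi DIM('a) \<Theta> r = \<phi>1" using r by (simp add: phi_def \<phi>1_def)
      moreover have "norm (E t x - E t y) \<le> M' + M'"
        by (rule order.trans[OF norm_triangle_ineq4 add_mono[OF bound bound]])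
      ultimately show ?thesis using C' by simp
    qed
    show "C > 0" by (rule C(1))
    show "continuous_on {0..} (phi DIM('a) \<Theta>)" by (rule cont)
    show "phi DIM('a) \<Theta> 0 = 0" by (simp add: phi_def)
    show "phi DIM('a) \<Theta> r > 0" if "r > 0" for r using \<Theta> that by (rule phi_pos)
  qed
  moreover have "AE t in lebesgue_on {0..T}. E_field \<kappa> f t = E t"
    using GAE by eventually_elim (auto simp: E_def E_eq)
  ultimately show ?thesis by (rule that)
qed

theorem theorem1p5:
  fixes T \<kappa> :: real
    and \<Theta> :: "real \<Rightarrow> real"
    and f :: "real \<Rightarrow> 'a::euclidean_space \<times> 'a \<Rightarrow> real"
  assumes "T > 0"
    and "\<kappa> \<in> {-1, 1}"
    and "growth_fun \<Theta>"
    and "continuous_on {0..} (phi DIM('a) \<Theta>)"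
    and "f \<in> A_space \<Theta> T"
  shows "(\<forall>x v. \<exists>X V. solution T (E_field \<kappa> f) x v X V) \<and>
    (diverges_at_0 (\<lambda>r. 1 / sqrt (Phi DIM('a) \<Theta> r)) \<longrightarrow>
      (\<forall>x v X V X' V'.
         solution T (E_field \<kappa> f) x v X V \<longrightarrow> solution T (E_field \<kappa> f) x v X' V' \<longrightarrow>
         (\<forall>t\<in>{0..T}. X t = X' t \<and> V t = V' t)) \<and>
      (\<forall>t\<in>{0..T}.
         (\<exists>g. homeomorphism UNIV UNIV (flow T (E_field \<kappa> f) t) g) \<and>
         lebesgue_preserving (flow T (E_field \<kappa> f) t)))"
proof -
  obtain E M C where ff: "force_field E M C (phi DIM('a) \<Theta>)"
    and ae: "AE t in lebesgue_on {0..T}. E_field \<kappa> f t = E t"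
    using A_space_borel_force_field[OF assms(2-5)] .
  interpret force_field E M C "phi DIM('a) \<Theta>" by (rule ff)
  have sol: "solution T (E_field \<kappa> f) = solution T E" by (rule solution_cong_AE[OF ae])
  \<comment> \<open>The two solution predicates are equal, so the Hilbert choice picks the same
    curve for both fields.\<close>
  then have flow: "flow T (E_field \<kappa> f) = flow T E" by (simp add: flow_def[abs_def])
  note iff = solution_iff_trajectory[OF \<open>T > 0\<close>]
  have "osgood_force_field E M C (phi DIM('a) \<Theta>)" if "diverges_at_0 (\<lambda>r. 1 / sqrt (Phi DIM('a) \<Theta> r))"
    using that ff by (simp add: osgood_force_field_def osgood_force_field_axioms_def Phi_eq_integral[OF assms(4)])
  note osgood = osgood_force_field.trajectory_unique[OF this] osgood_force_field.homeomorphism_flow[OF this]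
    osgood_force_field.lebesgue_preserving_flow[OF this]
  show ?thesis
    unfolding sol flow iff
    using trajectory_exists[OF \<open>T > 0\<close>] osgood \<open>T > 0\<close> by blast
qed

end
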